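(* Let $M$ satisfy $2 \le M \le 10$ or $M \in \{12, 13, 16, 18, 25\}$. Let $N$ be a positive integer which is coprime to $M$ and is not a perfect square. Then: \begin{enumerate} \item $\displaystyle \sum_{x \in \mathbb{Z},\ x^2 < 4N} H^M(4N - x^2) = \sum_{ad = N} |a - d|$ if one of the following holds: (a) $M \in \{2,3,5,7,13\}$; (b) $M = 9$ and $N \equiv -1 \pmod 3$; (c) $M = 25$ and $N \equiv \pm 2 \pmod 5$. \item $\displaystyle \sum_{x \in \mathbb{Z},\ x^2 < 4N} H^4(4N - x^2) = 2\sum_{ad = N,\ a > d} (a - 2d)$ if $M = 4$. \item $\displaystyle \sum_{x \in \mathbb{Z},\ x^2 < 4N} H^M(4N - x^2) = 2\sum_{ad = N,\ a > d} (a - 3d)$ if one of the following holds: (a) $M \in \{6, 8, 10\}$; (b) $M = 9$ and $N \equiv 1 \pmod 3$; (c) $M = 16$ and $N \equiv -1 \pmod 4$; (d) $M = 18$ and $N \equiv -1 \pmod 6$. \item $\displaystyle \sum_{x \in \mathbb{Z},\ x^2 < 4N} H^{M}(4N - x^2) = 2\sum_{ad = N,\ a > d} (a - 5d)$ if one of the following holds: (a) $M = 12$; (b) $M = 16$ and $N \equiv 1 \pmod 4$. \item $\displaystyle \sum_{x \in \mathbb{Z},\ x^2 < 4N} H^{18}(4N - x^2) = 2\sum_{ad = N,\ a > d} (a - 7d)$ if $M = 18$ and $N \equiv 1 \pmod 6$. \item $\displaystyle \sum_{x \in \mathbb{Z},\ x^2 < 4N} H^{25}(4N - x^2) = \sum_{ad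 = N} |a - d| - 8 \sum_{ad = N,\ a > d,\ a \equiv d \bmod 5} d$ if $M = 25$ and $N \equiv \pm 1 \pmod 5$. \end{enumerate} Here all sums over $ad = N$ run over pairs of positive integers $(a,d)$ with $ad = N$.
   Context: For a positive integer $M$, $\Gamma_0(M) = \{\gamma \in \mathrm{SL}_2(\mathbb{Z}) : \gamma \equiv \begin{pmatrix} * & * \\ 0 & * \end{pmatrix} \bmod M\}$. For integers $a,b,c$ write $[a,b,c]$ for the binary quadratic form $aX^2 + bXY + cY^2$, with discriminant $b^2 - 4ac$. For a positive integer $D \equiv 0, 3 \pmod 4$, let $\mathcal{Q}^M_{-D,>0}$ be the set of forms $Q = [Ma, b, c]$ with $a,b,c \in \mathbb{Z}$, $a > 0$, and discriminant $-D$. The group $\Gamma_0(M)$ acts on this set by $(Q \circ \begin{pmatrix} \alpha & \beta \\ \gamma & \delta\end{pmatrix})(X,Y) = Q(\alpha X + \beta Y, \gamma X + \delta Y)$; $\Gamma_0(M)_Q$ denotes the stabilizer of $Q$. The Hurwitz class number of level $M$ is $H^M(D) := \sum_{[Q] \in \mathcal{Q}^M_{-D,>0}/\Gamma_0(M)} \frac{2}{\#\Gamma_0(M)_Q}$. *)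

theory Defs
  imports
    "HOL-Analysis.Determinants"
    "HOL-Number_Theory.Cong"
    "HOL-Computational_Algebra.Nth_Powers"
begin

definition SL2Z :: "(int^2^2) set"
  where "SL2Z = {A. det A = 1}"

definition Gamma0 :: "nat \<Rightarrow> (int^2^2) set"
  where "Gamma0 M = {A \<in> SL2Z. [A $ 2 $ 1 = 0] (mod int M)}"

text \<open>The triple \<open>(a, b, c)\<close> encodes the form \<open>[a, b, c] = a X^2 + b X Y + c Y^2\<close>.\<close>

type_synonym bqf = "int \<times> int \<times> int"

fun eval_form :: "bqf \<Rightarrow> int \<Rightarrow> int \<Rightarrow> int"
  where "eval_form (a, b, c) X Y = a * X\<^sup>2 + b * X * Y + c * Y\<^sup>2"

fun discr :: "bqf \<Rightarrow> int"
  where "discr (a, b, c) = b\<^sup>2 - 4 * a * c"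

text \<open>The coefficients of \<open>Q(\<alpha>X + \<beta>Y, \<gamma>X + \<delta>Y)\<close>; the lemma \<open>eval_act_form\<close> below
  states the defining substitution property, which by \<open>eval_form_inject\<close> determines them.\<close>

fun act_form :: "bqf \<Rightarrow> int^2^2 \<Rightarrow> bqf"
  where "act_form (a, b, c) A =
    (let \<alpha> = A $ 1 $ 1; \<beta> = A $ 1 $ 2; \<gamma> = A $ 2 $ 1; \<delta> = A $ 2 $ 2 in
      (a * \<alpha>\<^sup>2 + b * \<alpha> * \<gamma> + c * \<gamma>\<^sup>2,
       2 * a * \<alpha> * \<beta> + b * (\<alpha> * \<delta> + \<beta> * \<gamma>) + 2 * c * \<gamma> * \<delta>,
       a * \<beta>\<^sup>2 + b * \<beta> * \<delta> + c * \<delta>\<^sup>2))"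

declare act_form.simps [simp del]

definition pos_forms :: "nat \<Rightarrow> int \<Rightarrow> bqf set"
  where "pos_forms M D = {(int M * a, b, c) | a b c. a > 0 \<and> discr (int M * a, b, c) = - D}"

definition form_equiv :: "nat \<Rightarrow> int \<Rightarrow> (bqf \<times> bqf) set"
  where "form_equiv M D =
    {(Q, Q'). Q \<in> pos_forms M D \<and> Q' \<in> pos_forms M D \<and> (\<exists>A\<in>Gamma0 M. Q' = act_form Q A)}"

definition stab_form :: "nat \<Rightarrow> bqf \<Rightarrow> (int^2^2) set"
  where "stab_form M Q = {A \<in> Gamma0 M. act_form Q A = Q}"

text \<open>The summand is evaluated at an arbitrary representative of the class; it does not
  depend on the choice by \<open>card_stab_form_equiv\<close>.  The definition is meant for \<open>M, D > 0\<close>, where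
  reduction theory makes the quotient and all stabilizers finite, so the defaults of \<open>sum\<close> and
  \<open>card\<close> on infinite sets play no role.\<close>

definition hurwitz_class_number :: "nat \<Rightarrow> int \<Rightarrow> real"
  where "hurwitz_class_number M D =
    (\<Sum>C \<in> pos_forms M D // form_equiv M D. 2 / real (card (stab_form M (SOME Q. Q \<in> C))))"

definition factor_pairs :: "nat \<Rightarrow> (nat \<times> nat) set"
  where "factor_pairs N = {(a, d). a > 0 \<and> d > 0 \<and> a * d = N}"


lemma eval_act_form:
  "eval_form (act_form Q A) X Y =
    eval_form Q (A $ 1 $ 1 * X + A $ 1 $ 2 * Y) (A $ 2 $ 1 * X + A $ 2 $ 2 * Y)"
  by (cases Q) (simp add: act_form.simps Let_def algebra_simps power2_eq_square)

lemma eval_form_inject: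
  assumes "\<And>X Y. eval_form Q X Y = eval_form Q' X Y"
  shows "Q = Q'"
  using assms[of 1 0] assms[of 0 1] assms[of 1 1] by (cases Q; cases Q') simp

lemma matrix_mult_2_nth:
  fixes A B :: "int^2^2"
  shows "(A ** B) $ i $ j = A $ i $ 1 * B $ 1 $ j + A $ i $ 2 * B $ 2 $ j"
  by (simp add: matrix_matrix_mult_def sum_2)

lemma act_form_mult: "act_form Q (A ** B) = act_form (act_form Q A) B"
  by (rule eval_form_inject) (simp add: eval_act_form matrix_mult_2_nth algebra_simps)

lemma act_form_one: "act_form Q (mat 1) = Q"
  by (rule eval_form_inject) (simp add: eval_act_form mat_def)

lemma discr_act_form: "discr (act_form Q A) = (det A)\<^sup>2 * discr Q"
  by (cases Q) (simp add: act_form.simps Let_def det_2 algebra_simps power2_eq_square)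

lemma one_in_Gamma0: "mat 1 \<in> Gamma0 M"
  by (simp add: Gamma0_def SL2Z_def mat_def det_2)

lemma mult_in_Gamma0:
  assumes "A \<in> Gamma0 M" "B \<in> Gamma0 M"
  shows "A ** B \<in> Gamma0 M"
  using assms by (auto simp: Gamma0_def SL2Z_def det_mul matrix_mult_2_nth cong_0_iff)

lemma inverse_in_Gamma0:
  assumes "A \<in> Gamma0 M"
  obtains B where "B \<in> Gamma0 M" "A ** B = mat 1" "B ** A = mat 1"
proof -
  define B :: "int^2^2" where
    "B = (\<chi> i j. if i = 1 then (if j = 1 then A $ 2 $ 2 else - A $ 1 $ 2)
                 else (if j = 1 then - A $ 2 $ 1 else A $ 1 $ 1))"
  have B: "B $ 1 $ 1 = A $ 2 $ 2" "B $ 1 $ 2 = - A $ 1 $ 2"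
    "B $ 2 $ 1 = - A $ 2 $ 1" "B $ 2 $ 2 = A $ 1 $ 1"
    by (simp_all add: B_def)
  have d: "A $ 1 $ 1 * A $ 2 $ 2 - A $ 1 $ 2 * A $ 2 $ 1 = 1"
    using assms by (simp add: Gamma0_def SL2Z_def det_2)
  have "B \<in> Gamma0 M"
    using assms d by (simp add: Gamma0_def SL2Z_def det_2 B cong_0_iff algebra_simps)
  moreover have "A ** B = mat 1" "B ** A = mat 1"
    using d by (simp_all add: vec_eq_iff forall_2 matrix_mult_2_nth B mat_def algebra_simps)
  ultimately show thesis by (rule that)
qed

lemma act_form_in_pos_forms:
  assumes "M > 0" "D > 0" "Q \<in> pos_forms M D" "A \<in> Gamma0 M"
  shows "act_form Q A \<in> pos_forms M D"
proof -
  obtain a b c where Q: "Q = (int M * a, b, c)" and a: "a > 0"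
    and disc: "discr (int M * a, b, c) = - D"
    using assms(3) by (auto simp: pos_forms_def)
  obtain k where k: "A $ 2 $ 1 = int M * k"
    using assms(4) by (auto simp: Gamma0_def cong_0_iff)
  have det: "det A = 1"
    using assms(4) by (simp add: Gamma0_def SL2Z_def)
  define \<alpha> where "\<alpha> = A $ 1 $ 1"
  define a' where "a' = a * \<alpha>\<^sup>2 + b * \<alpha> * k + c * int M * k\<^sup>2"
  obtain b' c' where Q': "act_form Q A = (int M * a', b', c')"
    by (auto simp: act_form.simps Q k a'_def \<alpha>_def Let_def algebra_simps power2_eq_square)
  have "discr (act_form Q A) = - D"
    using disc by (simp only: discr_act_form det Q) simp
  moreover have "a' > 0"
  proof -
    have ak: "\<alpha> \<noteq> 0 \<or> k \<noteq> 0"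
      using det by (auto simp: det_2 k \<alpha>_def)
    have eq: "4 * a * a' = (2 * a * \<alpha> + b * k)\<^sup>2 + D * k\<^sup>2"
    proof -
      have D: "D = 4 * (int M * a) * c - b\<^sup>2" using disc by simp
      show ?thesis unfolding D by (simp add: a'_def algebra_simps power2_eq_square)
    qed
    have "(2 * a * \<alpha> + b * k)\<^sup>2 + D * k\<^sup>2 > 0"
    proof (cases "k = 0")
      case True
      then show ?thesis using ak a by simp
    next
      case False
      then show ?thesis using assms(2) by (simp add: add_nonneg_pos)
    qed
    then have "4 * a * a' > 0" using eq by simp
    then show ?thesis using a by (simp add: zero_less_mult_iff)
  qed
  ultimately show ?thesis
    by (auto simp: pos_forms_def Q')
qed

lemma equiv_form_equiv: "equiv (pos_forms M D) (form_equiv M D)"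
proof (rule equivI)
  show "form_equiv M D \<subseteq> pos_forms M D \<times> pos_forms M D"
    by (auto simp: form_equiv_def)
  show "refl_on (pos_forms M D) (form_equiv M D)"
    by (rule refl_onI) (auto simp: form_equiv_def intro!: bexI[OF _ one_in_Gamma0] act_form_one[symmetric])
  show "sym (form_equiv M D)"
  proof (rule symI)
    fix Q Q' assume "(Q, Q') \<in> form_equiv M D"
    then obtain A where QQ': "Q \<in> pos_forms M D" "Q' \<in> pos_forms M D"
      and A: "A \<in> Gamma0 M" "Q' = act_form Q A"
      by (auto simp: form_equiv_def)
    obtain B where "B \<in> Gamma0 M" "A ** B = mat 1"
      using A(1) by (rule inverse_in_Gamma0)
    then show "(Q', Q) \<in> form_equiv M D"
      using QQ' A by (auto simp: form_equiv_def simp flip: act_form_mult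
          intro!: bexI[of _ B] act_form_one[symmetric])
  qed
  show "trans (form_equiv M D)"
  proof (rule transI)
    fix Q Q' Q'' assume "(Q, Q') \<in> form_equiv M D" "(Q', Q'') \<in> form_equiv M D"
    then obtain A B where "Q \<in> pos_forms M D" "Q'' \<in> pos_forms M D"
      and "A \<in> Gamma0 M" "B \<in> Gamma0 M" "Q'' = act_form Q (A ** B)"
      by (auto simp: form_equiv_def act_form_mult)
    then show "(Q, Q'') \<in> form_equiv M D"
      using mult_in_Gamma0 by (auto simp: form_equiv_def)
  qed
qed

lemma card_stab_form_act:
  assumes "A \<in> Gamma0 M"
  shows "card (stab_form M (act_form Q A)) = card (stab_form M Q)"
proof -
  obtain B where B: "B \<in> Gamma0 M" "A ** B = mat 1" "B ** A = mat 1"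
    using assms by (rule inverse_in_Gamma0)
  have AB: "A ** (B ** X) = X" "B ** (A ** X) = X" for X
    using B by (simp_all add: matrix_mul_assoc)
  have act: "act_form (act_form P A) B = P" for P
    using B by (simp add: act_form_one flip: act_form_mult)
  have "bij_betw (\<lambda>S. A ** S ** B) (stab_form M (act_form Q A)) (stab_form M Q)"
  proof (rule bij_betw_byWitness[where f' = "\<lambda>S. B ** S ** A"])
    show "(\<lambda>S. A ** S ** B) ` stab_form M (act_form Q A) \<subseteq> stab_form M Q"
      using assms B(1) by (auto simp: stab_form_def act_form_mult act mult_in_Gamma0)
    show "(\<lambda>S. B ** S ** A) ` stab_form M Q \<subseteq> stab_form M (act_form Q A)"
      using assms B(1) by (auto simp: stab_form_def act_form_mult act mult_in_Gamma0)
  qed (auto simp: AB B simp flip: matrix_mul_assoc)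
  then show ?thesis by (rule bij_betw_same_card)
qed

lemma card_stab_form_equiv:
  assumes "(Q, Q') \<in> form_equiv M D"
  shows "card (stab_form M Q') = card (stab_form M Q)"
  using assms by (auto simp: form_equiv_def card_stab_form_act)

end

(*
  An elliptic class of integral matrices m of determinant N corresponds to a form of discriminant
  tr(m)^2 - 4N, so the sum of the class numbers counts the fixed points in the upper half plane of
  the Hecke correspondence T_N on X_0(M), which has genus zero.  We compute this number by the
  Lefschetz formula on the Farey triangulation.  Choosing for the image of each edge and triangle a
  chain of edges or triangles makes the traces on 1-chains and 2-chains sums of explicit weights
  wt1, wt2 over all m, multiplied by the number of fixed points of m on the projective line modulo M.
  For each m these weights differ by a finitely supported coboundary from wt_fix, which picks the
  m whose fixed point lies in one ideal triangle, that is, whose form is reduced, and subtracts the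
  hyperbolic m with two rational fixed points.  On the other hand, an explicit contraction of the
  chain complex of the sphere, certified by a finite computation for each M, shows that the
  alternating trace only involves the degree sigma(N) and the cusps fixed by diag(a, d), ad = N.
*)
theory Submission
  imports Defs "HOL-Analysis.Infinite_Sum"
begin

text \<open>The obstacle is convergence: the side tests \<open>wt_u\<close>, \<open>wt_side\<close>
  and \<open>wt_cusp\<close>, from which the weights are built, are nonzero for infinitely many
  matrices of determinant N, so only their differences can be summed. These have finite support
  because outside a finite box every test agrees with the one that asks on which side of the
  geodesic the point i lies.

  Chains are not taken on orbits. Edge chains are functions on the projective line modulo M that are
  odd under \<open>S2\<close>, triangle chains are functions invariant under \<open>U2\<close>, and
  operators are kernels in two points. Orbits shortened by a fixed point of \<open>S2\<close> or
  \<open>U2\<close> then need no separate treatment in the trace computation; the price is a handful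
  of factors 2, 3 and 6.

  For N = ad with a > d, the pairs (a, d) and (d, a) together receive 2(a + d) from the homology of
  the sphere in degrees 0 and 2, while every fixed cusp costs 2d. If v cusps are fixed, this leaves
  2(a - (v - 1)d). That N is not a square excludes parabolic matrices and the pair a = d.\<close>

type_synonym mat2 = "int \<times> int \<times> int \<times> int"

fun mat2_mult :: "mat2 \<Rightarrow> mat2 \<Rightarrow> mat2" (infixl "\<odot>" 70)
  where "(a, b, c, d) \<odot> (a', b', c', d') =
    (a * a' + b * c', a * b' + b * d', c * a' + d * c', c * b' + d * d')"

fun mat2_app :: "mat2 \<Rightarrow> int \<times> int \<Rightarrow> int \<times> int" (infixr "\<cdot>" 75)
  where "(a, b, c, d) \<cdot> (x, y) = (a * x + b * y, c * x + d * y)"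

fun det2 :: "mat2 \<Rightarrow> int"
  where "det2 (a, b, c, d) = a * d - b * c"

fun adj2 :: "mat2 \<Rightarrow> mat2"
  where "adj2 (a, b, c, d) = (d, - b, - c, a)"

definition mats :: "int \<Rightarrow> mat2 set"
  where "mats n = {m. det2 m = n}"

text \<open>As Moebius maps, \<open>S2\<close> exchanges infinity and 0, and \<open>U2\<close> turns
  infinity to 0, 0 to 1 and 1 to infinity. Thus \<open>U2\<close> generates the rotations of the
  ideal triangle with these vertices; its cube is minus the identity.\<close>

definition S2 :: mat2 where "S2 = (0, -1, 1, 0)"
definition U2 :: mat2 where "U2 = (0, 1, -1, 1)"
definition T2 :: mat2 where "T2 = (1, 1, 0, 1)"

lemma mat2_mult_assoc: "(l \<odot> m) \<odot> n = l \<odot> (m \<odot> n)"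
  by (cases l; cases m; cases n) (simp add: algebra_simps)

lemma mat2_mult_one [simp]: "(1, 0, 0, 1) \<odot> m = m" "m \<odot> (1, 0, 0, 1) = m"
  by (cases m; simp)+

lemma mat2_app_mult: "(m \<odot> n) \<cdot> v = m \<cdot> n \<cdot> v"
  by (cases m; cases n; cases v) (simp add: algebra_simps)

lemma det2_mult: "det2 (m \<odot> n) = det2 m * det2 n"
  by (cases m; cases n) (simp add: algebra_simps)

lemma det2_adj [simp]: "det2 (adj2 m) = det2 m"
  by (cases m) (simp add: algebra_simps)

lemma adj2_mult: "det2 g = 1 \<Longrightarrow> adj2 g \<odot> g = (1, 0, 0, 1)" "det2 g = 1 \<Longrightarrow> g \<odot> adj2 g = (1, 0, 0, 1)"
  by (cases g; simp add: algebra_simps)+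

lemma adj2_cancel:
  assumes "g \<in> mats 1"
  shows "adj2 g \<odot> (g \<odot> m) = m" "g \<odot> (adj2 g \<odot> m) = m"
    "(m \<odot> adj2 g) \<odot> g = m" "(m \<odot> g) \<odot> adj2 g = m"
proof -
  have "det2 g = 1" using assms by (simp add: mats_def)
  note * = adj2_mult[OF this]
  show "adj2 g \<odot> (g \<odot> m) = m" "g \<odot> (adj2 g \<odot> m) = m"
    by (simp_all add: * flip: mat2_mult_assoc)
  show "(m \<odot> adj2 g) \<odot> g = m" "(m \<odot> g) \<odot> adj2 g = m"
    by (simp_all add: * mat2_mult_assoc)
qed

lemma adj2_app_cancel:
  assumes "g \<in> mats 1"
  shows "adj2 g \<cdot> g \<cdot> v = v" "g \<cdot> adj2 g \<cdot> v = v"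
proof -
  have "det2 g = 1" using assms by (simp add: mats_def)
  note * = adj2_mult[OF this]
  show "adj2 g \<cdot> g \<cdot> v = v" "g \<cdot> adj2 g \<cdot> v = v"
    by (cases v; simp add: * flip: mat2_app_mult)+
qed

lemma S2_in [simp]: "S2 \<in> mats 1" and U2_in [simp]: "U2 \<in> mats 1" and T2_in [simp]: "T2 \<in> mats 1"
  by (simp_all add: mats_def S2_def U2_def T2_def)

lemma adj2_in_mats [simp]: "adj2 g \<in> mats n \<longleftrightarrow> g \<in> mats n"
  by (simp add: mats_def)

lemma mult_in_mats: "g \<in> mats 1 \<Longrightarrow> m \<in> mats n \<Longrightarrow> g \<odot> m \<in> mats n"
  "g \<in> mats 1 \<Longrightarrow> m \<in> mats n \<Longrightarrow> m \<odot> g \<in> mats n"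
  by (simp_all add: mats_def det2_mult)

lemma bij_betw_mult_left: "g \<in> mats 1 \<Longrightarrow> bij_betw (\<lambda>m. g \<odot> m) (mats n) (mats n)"
  by (rule bij_betw_byWitness[where f' = "\<lambda>m. adj2 g \<odot> m"])
     (auto simp: adj2_cancel mult_in_mats)

lemma bij_betw_mult_right: "g \<in> mats 1 \<Longrightarrow> bij_betw (\<lambda>m. m \<odot> g) (mats n) (mats n)"
  by (rule bij_betw_byWitness[where f' = "\<lambda>m. m \<odot> adj2 g"])
     (auto simp: adj2_cancel mult_in_mats)

text \<open>The value \<open>1/2\<close> at \<open>0\<close> makes \<open>hs_minus\<close> hold without exception.\<close>

definition hs :: "int \<Rightarrow> real"
  where "hs x = (if x > 0 then 1 else if x = 0 then 1 / 2 else 0)"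

lemma hs_minus: "hs (- x) = 1 - hs x"
  by (simp add: hs_def)

section \<open>Reduction of positive definite forms\<close>

fun form_mult :: "bqf \<Rightarrow> mat2 \<Rightarrow> bqf"
  where "form_mult (A, B, C) (a, b, c, d) =
    (A * a\<^sup>2 + B * a * c + C * c\<^sup>2,
     2 * A * a * b + B * (a * d + b * c) + 2 * C * c * d,
     A * b\<^sup>2 + B * b * d + C * d\<^sup>2)"

lemma form_mult_mult: "form_mult Q (g \<odot> h) = form_mult (form_mult Q g) h"
  by (cases Q; cases g; cases h) (simp add: algebra_simps power2_eq_square)

lemma form_mult_one [simp]: "form_mult Q (1, 0, 0, 1) = Q"
  by (cases Q) simp

lemma discr_form_mult: "discr (form_mult Q g) = (det2 g)\<^sup>2 * discr Q"
  by (cases Q; cases g) (simp add: algebra_simps power2_eq_square)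

definition pos_def :: "bqf \<Rightarrow> bool"
  where "pos_def Q \<longleftrightarrow> fst Q > 0 \<and> discr Q < 0"

lemma pos_def_eval:
  assumes "pos_def Q" "(x, y) \<noteq> (0, 0)"
  shows "eval_form Q x y > 0"
proof -
  obtain a b c where Q: "Q = (a, b, c)" by (cases Q)
  have a: "a > 0" "b\<^sup>2 - 4 * a * c < 0" using assms by (auto simp: pos_def_def Q)
  have "4 * a * (a * x\<^sup>2 + b * x * y + c * y\<^sup>2) = (2 * a * x + b * y)\<^sup>2 + (4 * a * c - b\<^sup>2) * y\<^sup>2"
    by (simp add: algebra_simps power2_eq_square)
  also have "\<dots> > 0"
  proof (cases "y = 0")
    case True
    then show ?thesis using assms a by auto
  next
    case False
    then have "(4 * a * c - b\<^sup>2) * y\<^sup>2 > 0" using a by (intro mult_pos_pos) auto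
    then show ?thesis by (simp add: add_nonneg_pos)
  qed
  finally show ?thesis using a by (simp add: Q zero_less_mult_iff)
qed

lemma pos_def_form_mult:
  assumes "pos_def Q" "det2 g \<noteq> 0"
  shows "pos_def (form_mult Q g)"
proof -
  obtain A B C a b c d where Q: "Q = (A, B, C)" and g: "g = (a, b, c, d)" by (cases Q; cases g)
  have "eval_form Q a c > 0"
    by (rule pos_def_eval[OF assms(1)]) (use assms(2) in \<open>auto simp: g\<close>)
  moreover have "discr (form_mult Q g) < 0"
    using assms by (simp add: discr_form_mult pos_def_def mult_less_0_iff del: discr.simps)
  ultimately show ?thesis by (simp add: pos_def_def Q g)
qed

text \<open>Twice the form is (2A + B) X^2 + (2C + B) Y^2 - B (X - Y)^2. The coefficients are its
  Selling parameters, and their sum serves as the height for reduction.\<close>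

fun selling_size :: "bqf \<Rightarrow> int"
  where "selling_size (A, B, C) = 2 * A + B + 2 * C"

text \<open>For a positive definite form this places the root in the closed ideal triangle with
  vertices infinity, 0 and 1, one inequality for each edge. Unlike the Gauss domain, this domain
  matches the Farey triangulation; its stabilizer in SL2(Z) has order 6.\<close>

fun reduced :: "bqf \<Rightarrow> bool"
  where "reduced (A, B, C) \<longleftrightarrow> B \<le> 0 \<and> 2 * C + B \<ge> 0 \<and> 2 * A + B \<ge> 0"

text \<open>For positive definite forms: 1 if the root is inside the triangle, 1/2 on an edge, 0
  outside. The halves make the translates of the triangle add up exactly.\<close>

fun red_weight :: "bqf \<Rightarrow> real"
  where "red_weight (A, B, C) = hs (- B) + hs (2 * C + B) + hs (2 * A + B) - 2"

text \<open>Two Selling parameters add up to twice a value of the form at (1, 0), (0, 1) or (1, 1).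
  Hence at most one is negative, and then the other two are positive and the weight is 1 + 1 - 2 =
  0.\<close>

lemma red_weight_nonzero_imp_reduced:
  assumes "pos_def Q" "red_weight Q \<noteq> 0"
  shows "reduced Q"
proof -
  obtain A B C where Q: "Q = (A, B, C)" by (cases Q)
  have pos: "eval_form Q 1 0 > 0" "eval_form Q 0 1 > 0" "eval_form Q 1 1 > 0"
    by (rule pos_def_eval[OF assms(1)]; simp)+
  then show ?thesis using assms(2) by (auto simp: Q hs_def split: if_splits)
qed

text \<open>Descent on \<open>selling_size\<close>: if a parameter is negative, the root lies beyond
  one edge of the triangle, and passing to the neighbour across that edge lowers the size.\<close>

lemma exists_reduced:
  assumes "pos_def Q"
  obtains g where "g \<in> mats 1" "reduced (form_mult Q g)"
proof -
  define f where "f g = nat (selling_size (form_mult Q g))" for g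
  obtain g where g: "g \<in> mats 1" and min: "\<And>h. h \<in> mats 1 \<Longrightarrow> f g \<le> f h"
    using ex_has_least_nat[of "\<lambda>g. g \<in> mats 1" S2 f] by auto
  obtain A B C where Q: "form_mult Q g = (A, B, C)" by (cases "form_mult Q g")
  have pd: "pos_def (A, B, C)"
    using pos_def_form_mult[OF assms, of g] g by (simp add: Q mats_def)
  have pos: "eval_form (A, B, C) 1 0 > 0" "eval_form (A, B, C) 0 1 > 0" "eval_form (A, B, C) 1 1 > 0"
     "eval_form (A, B, C) 1 (-1) > 0"
    by (rule pos_def_eval[OF pd]; simp)+
  have 1: "f g \<le> f (g \<odot> h)" if "h \<in> mats 1" for h
    by (rule min) (simp add: mult_in_mats g that)
  have "B \<le> 0"
    using 1[of S2] pos by (simp add: f_def form_mult_mult Q S2_def mats_def)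
  \<comment> \<open>\<open>S2\<close> crosses the edge from infinity to 0; the powers of
    \<open>U2\<close> carry this edge to the other two.\<close>
  moreover have "2 * C + B \<ge> 0"
    using 1[of "U2 \<odot> S2"] pos by (simp add: f_def form_mult_mult Q U2_def S2_def mats_def)
  moreover have "2 * A + B \<ge> 0"
    using 1[of "U2 \<odot> (U2 \<odot> S2)"] pos by (simp add: f_def form_mult_mult Q U2_def S2_def mats_def)
  ultimately show thesis using that[of g] g by (simp add: Q)
qed

lemma hex_norm_ge_1:
  fixes p q :: int
  assumes "(p, q) \<noteq> (0, 0)"
  shows "p\<^sup>2 + p * q + q\<^sup>2 \<ge> 1"
proof -
  have "pos_def (1, 1, 1)" by (simp add: pos_def_def)
  from pos_def_eval[OF this assms] show ?thesis by simp
qed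

lemma hex_norm_eq_1:
  fixes p q :: int
  assumes "p\<^sup>2 + p * q + q\<^sup>2 = 1"
  shows "(p, q) \<in> {(1, 0), (0, 1), (-1, 1), (-1, 0), (0, -1), (1, -1)}"
proof -
  have 4: "(2 * p + q)\<^sup>2 + 3 * q\<^sup>2 = 4" "(2 * q + p)\<^sup>2 + 3 * p\<^sup>2 = 4"
    using assms by (auto simp: algebra_simps power2_eq_square)
  have "q\<^sup>2 < 4" using 4(1) zero_le_power2[of "2 * p + q"] by linarith
  moreover have "p\<^sup>2 < 4" using 4(2) zero_le_power2[of "2 * q + p"] by linarith
  ultimately have "\<bar>q\<bar> < 2" "\<bar>p\<bar> < 2"
    using power2_less_imp_less[of "\<bar>q\<bar>" 2] power2_less_imp_less[of "\<bar>p\<bar>" 2] by auto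
  then have "q \<in> {-1, 0, 1}" "p \<in> {-1, 0, 1}" by auto
  then show ?thesis using assms by auto
qed

text \<open>Each of the squares X^2, Y^2 and (X - Y)^2 that make up the form becomes the square of
  some pX + qY, and that square has size 2(p^2 + pq + q^2). So the size is a combination of
  hexagonal norms with the Selling parameters as coefficients.\<close>

lemma selling_size_form_mult:
  "selling_size (form_mult (A, B, C) (a, b, c, d)) =
    (2 * A + B) * (a\<^sup>2 + a * b + b\<^sup>2) + (2 * C + B) * (c\<^sup>2 + c * d + d\<^sup>2)
      + (- B) * ((a - c)\<^sup>2 + (a - c) * (b - d) + (b - d)\<^sup>2)"
  by (simp add: algebra_simps power2_eq_square)

lemma reduced_size_le:
  assumes "reduced Q" "g \<in> mats 1"
  shows "selling_size Q \<le> selling_size (form_mult Q g)"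
proof -
  obtain A B C a b c d where Q: "Q = (A, B, C)" and g: "g = (a, b, c, d)" by (cases Q; cases g)
  have det: "a * d - b * c = 1" using assms by (simp add: g mats_def)
  have h: "a\<^sup>2 + a * b + b\<^sup>2 \<ge> 1" "c\<^sup>2 + c * d + d\<^sup>2 \<ge> 1"
    "(a - c)\<^sup>2 + (a - c) * (b - d) + (b - d)\<^sup>2 \<ge> 1"
    by (rule hex_norm_ge_1; use det in auto)+
  have "(2 * A + B) * 1 \<le> (2 * A + B) * (a\<^sup>2 + a * b + b\<^sup>2)"
    "(2 * C + B) * 1 \<le> (2 * C + B) * (c\<^sup>2 + c * d + d\<^sup>2)"
    "(- B) * 1 \<le> (- B) * ((a - c)\<^sup>2 + (a - c) * (b - d) + (b - d)\<^sup>2)"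
    by (rule mult_left_mono; use assms h in \<open>auto simp: Q\<close>)+
  then show ?thesis
    unfolding Q g selling_size_form_mult by simp
qed

text \<open>Up to sign, the six matrices that carry the triangle infinity, 0, 1 to itself or to its
  neighbour infinity, 0, -1.\<close>

definition hex_mats :: "mat2 set"
  where "hex_mats =
    {(1, 0, 0, 1), (1, 0, -1, 1), (0, 1, -1, 1), (0, 1, -1, 0), (-1, 1, -1, 0), (-1, 1, 0, -1),
     (-1, 0, 0, -1), (-1, 0, 1, -1), (0, -1, 1, -1), (0, -1, 1, 0), (1, -1, 1, 0), (1, -1, 0, 1)}"

text \<open>Both forms are reduced, so both have minimal size and equality holds term by term. Where
  the coefficient is positive, the hexagonal norm of the row must be 1, which leaves six choices.
  Only \<open>- B\<close> may vanish, so the root may still lie on the edge from infinity to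
  0.\<close>

lemma reduced_form_mult_imp_hex:
  assumes Q: "reduced (A, B, C)" "2 * A + B > 0" "2 * C + B > 0"
    and g: "g \<in> mats 1" "reduced (form_mult (A, B, C) g)"
  shows "g \<in> hex_mats"
proof -
  obtain a b c d where g': "g = (a, b, c, d)" by (cases g)
  have det: "a * d - b * c = 1" using g by (simp add: g' mats_def)
  have "selling_size (form_mult (A, B, C) g) \<le> selling_size (form_mult (form_mult (A, B, C) g) (adj2 g))"
    by (rule reduced_size_le) (use g in auto)
  then have le: "selling_size (form_mult (A, B, C) g) \<le> selling_size (A, B, C)"
    using g by (simp add: adj2_mult mats_def flip: form_mult_mult)
  have h: "a\<^sup>2 + a * b + b\<^sup>2 \<ge> 1" "c\<^sup>2 + c * d + d\<^sup>2 \<ge> 1"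
    "(a - c)\<^sup>2 + (a - c) * (b - d) + (b - d)\<^sup>2 \<ge> 1"
    by (rule hex_norm_ge_1; use det in auto)+
  have nn: "0 \<le> (2 * A + B) * (a\<^sup>2 + a * b + b\<^sup>2 - 1)" "0 \<le> (2 * C + B) * (c\<^sup>2 + c * d + d\<^sup>2 - 1)"
    "0 \<le> (- B) * ((a - c)\<^sup>2 + (a - c) * (b - d) + (b - d)\<^sup>2 - 1)"
    by (rule mult_nonneg_nonneg; use Q h in auto)+
  have "(2 * A + B) * (a\<^sup>2 + a * b + b\<^sup>2 - 1) + (2 * C + B) * (c\<^sup>2 + c * d + d\<^sup>2 - 1)
      + (- B) * ((a - c)\<^sup>2 + (a - c) * (b - d) + (b - d)\<^sup>2 - 1) \<le> 0"
    using le unfolding g' selling_size_form_mult by (simp add: algebra_simps)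
  then have "(2 * A + B) * (a\<^sup>2 + a * b + b\<^sup>2 - 1) = 0" "(2 * C + B) * (c\<^sup>2 + c * d + d\<^sup>2 - 1) = 0"
    using nn by linarith+
  then have "a\<^sup>2 + a * b + b\<^sup>2 = 1" "c\<^sup>2 + c * d + d\<^sup>2 = 1" using Q by auto
  from hex_norm_eq_1[OF this(1)] hex_norm_eq_1[OF this(2)] show ?thesis
    using det unfolding g' hex_mats_def by (elim insertE emptyE Pair_inject) simp_all
qed

text \<open>If B < 0, only the six matrices that preserve the triangle count; if B = 0, all twelve
  count 1/2.\<close>

lemma sum_red_weight_hex:
  assumes "reduced (A, B, C)" "2 * A + B > 0" "2 * C + B > 0"
  shows "(\<Sum>g\<in>hex_mats. red_weight (form_mult (A, B, C) g)) = 6"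
  using assms by (simp add: hex_mats_def hs_def)

lemma red_weight_partition:
  assumes "pos_def Q"
  shows "finite {g \<in> mats 1. red_weight (form_mult Q g) \<noteq> 0}" (is "finite ?F")
    and "infsum (\<lambda>g. red_weight (form_mult Q g)) (mats 1) = 6"
proof -
  obtain g0 A B C where g0: "g0 \<in> mats 1" and Q: "form_mult Q g0 = (A, B, C)"
    and red: "reduced (A, B, C)" "2 * A + B > 0" "2 * C + B > 0"
  proof -
    obtain g where g: "g \<in> mats 1" "reduced (form_mult Q g)" using exists_reduced[OF assms] .
    obtain A B C where Q: "form_mult Q g = (A, B, C)" by (cases "form_mult Q g")
    have pd: "pos_def (A, B, C)" using pos_def_form_mult[OF assms, of g] g by (simp add: Q mats_def)
    then have pos: "A > 0" "C > 0" "B\<^sup>2 < 4 * A * C" using pos_def_eval[OF pd, of 0 1]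
      by (auto simp: pos_def_def)
    have "0 < 2 * A + B \<and> 0 < 2 * C + B \<or> 2 * A + B = 0 \<or> 2 * C + B = 0"
      using g(2) by (simp add: Q) linarith
    moreover have nz: "2 * A + B \<noteq> 0 \<or> 2 * C + B \<noteq> 0"
    proof (rule ccontr)
      assume "\<not> ?thesis"
      then have "B = - 2 * A" "C = A" by auto
      then show False using pos(3) by (simp add: power2_eq_square)
    qed
    \<comment> \<open>If the root lies on another edge, a power of \<open>U2\<close> turns that edge
      to the one from infinity to 0, and the count over \<open>hex_mats\<close> applies.\<close>
    ultimately consider "2 * A + B > 0" "2 * C + B > 0" | "2 * A + B = 0" | "2 * C + B = 0"
      by blast
    then show thesis
    proof cases
      case 1
      then show thesis using that[OF g(1) Q] g by (simp add: Q)
    next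
      case 2
      then have "2 * C + B > 0" using g(2) nz by (auto simp: Q)
      then show thesis using that[of "g \<odot> (U2 \<odot> U2)"] g 2 pos
        by (simp add: form_mult_mult Q U2_def mats_def det2_mult)
    next
      case 3
      then have "2 * A + B > 0" using g(2) nz by (auto simp: Q)
      then show thesis using that[of "g \<odot> U2"] g 3 pos
        by (simp add: form_mult_mult Q U2_def mats_def det2_mult)
    qed
  qed
  have pd: "pos_def (A, B, C)" using pos_def_form_mult[OF assms, of g0] g0 by (simp add: Q mats_def)
  have hex: "h \<in> hex_mats" if "h \<in> mats 1" "red_weight (form_mult (A, B, C) h) \<noteq> 0" for h
    by (rule reduced_form_mult_imp_hex[OF red that(1)], rule red_weight_nonzero_imp_reduced[OF _ that(2)])
       (use that pos_def_form_mult[OF pd, of h] in \<open>simp add: mats_def\<close>)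
  have "?F \<subseteq> (\<lambda>h. g0 \<odot> h) ` hex_mats"
  proof
    fix g assume "g \<in> ?F"
    then have "adj2 g0 \<odot> g \<in> hex_mats"
      by (intro hex) (auto simp: mult_in_mats g0 adj2_cancel simp flip: Q form_mult_mult)
    then show "g \<in> (\<lambda>h. g0 \<odot> h) ` hex_mats"
      by (rule rev_image_eqI) (simp add: adj2_cancel g0)
  qed
  then show "finite ?F" by (rule finite_subset) (simp add: hex_mats_def)
  have sub: "hex_mats \<subseteq> mats 1" by (simp add: hex_mats_def mats_def)
  have "infsum (\<lambda>g. red_weight (form_mult Q g)) (mats 1) =
      infsum (\<lambda>h. red_weight (form_mult Q (g0 \<odot> h))) (mats 1)"
    by (rule infsum_reindex_bij_betw[OF bij_betw_mult_left[OF g0], symmetric])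
  also have "\<dots> = infsum (\<lambda>h. red_weight (form_mult (A, B, C) h)) hex_mats"
    by (rule infsum_cong_neutral)
       (use hex sub in \<open>auto simp: form_mult_mult Q\<close>)
  also have "\<dots> = (\<Sum>g\<in>hex_mats. red_weight (form_mult (A, B, C) g))"
    by (rule infsum_finite) (simp add: hex_mats_def)
  also have "\<dots> = 6" by (rule sum_red_weight_hex[OF red])
  finally show "infsum (\<lambda>g. red_weight (form_mult Q g)) (mats 1) = 6" .
qed

section \<open>Weights on matrices of fixed determinant\<close>

text \<open>Let \<open>D\<close> be the ideal triangle with vertices \<open>\<infinity>, 0, 1\<close>, with center \<open>\<rho> = (1 + \<surd>-3)/2\<close>.
  \<open>wt_u m\<close> is \<open>1\<close>, \<open>1/2\<close> or \<open>0\<close> as \<open>\<rho>\<close> lies to the left of, on, or to the right of the geodesic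
  from \<open>m\<infinity>\<close> to \<open>m0\<close>.  Hence \<open>wt1 m\<close> is the multiplicity of the edge \<open>\<infinity> \<rightarrow> 0\<close> in a path
  homotopic to the image of that edge under \<open>m\<close>, and \<open>wt2 m\<close> that of \<open>D\<close> in \<open>mD\<close>.\<close>

fun wt_u :: "mat2 \<Rightarrow> real"
  where "wt_u (a, b, c, d) = hs (a * d + b * c - 2 * a * b - 2 * c * d)"

definition wt1 :: "mat2 \<Rightarrow> real"
  where "wt1 m = wt_u m - wt_u (S2 \<odot> m)"

definition wt2 :: "mat2 \<Rightarrow> real"
  where "wt2 m = wt_u m + wt_u (m \<odot> U2) + wt_u (m \<odot> U2 \<odot> U2) - 2"

text \<open>The arguments of \<open>side\<close> are the values \<open>x, y, z\<close> of the form \<open>c X^2 + (d - a) X Y - b Y^2\<close>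
  at \<open>(1, 0), (0, 1), (1, 1)\<close> and the trace \<open>t\<close>.  \<open>wt_side m\<close> says whether the fixed point of
  \<open>m\<close> in the upper half plane, or the repelling one on the real line if \<open>m\<close> is hyperbolic, lies to
  the left of the geodesic from \<open>\<infinity>\<close> to \<open>0\<close>; it agrees with \<open>wt_u m\<close> for almost all \<open>m\<close>.\<close>

definition side :: "int \<Rightarrow> int \<Rightarrow> int \<Rightarrow> int \<Rightarrow> real"
  where "side x y z t = (if x * y > 0 then hs (x * (x + y - z)) else hs (t * (y - x)))"

fun wt_side :: "mat2 \<Rightarrow> real"
  where "wt_side (a, b, c, d) = side c (- b) (c + d - a - b) (a + d)"

definition conjU :: "mat2 \<Rightarrow> mat2"
  where "conjU m = adj2 U2 \<odot> m \<odot> U2"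

definition wt_fix :: "mat2 \<Rightarrow> real"
  where "wt_fix m = wt_side m + wt_side (conjU m) + wt_side (conjU (conjU m)) - 2"

text \<open>The side test for the point iy with y large: the sign of cd decides unless the geodesic
  ends at infinity, and then the position of its other end point does.\<close>

fun wt_cusp :: "mat2 \<Rightarrow> real"
  where "wt_cusp (a, b, c, d) = hs (- (if c * d = 0 then a * b else c * d))"

text \<open>The jump of \<open>wt_cusp\<close> under a translation by 1, for a geodesic that starts
  at infinity.\<close>

fun wt_upper :: "mat2 \<Rightarrow> real"
  where "wt_upper (a, b, c, d) = (if c = 0 then hs (- a * b) - hs (- a * (b + d)) else 0)"

text \<open>In \<open>wt_split\<close> the condition x = 0 says that infinity is fixed. The value 1
  means that infinity is the repelling fixed point and the other one lies strictly between 0 and 1.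
  A diagonal matrix counts 1/2, whichever of its fixed points is repelling.\<close>

definition split3 :: "int \<Rightarrow> int \<Rightarrow> int \<Rightarrow> int \<Rightarrow> real"
  where "split3 x y z t =
    (if x \<noteq> 0 then 0 else if y = 0 then 1 / 2 else if t * y < 0 \<and> t * z > 0 then 1 else 0)"

fun wt_split :: "mat2 \<Rightarrow> real"
  where "wt_split (a, b, c, d) = split3 c (- b) (c + d - a - b) (a + d)"

text \<open>\<open>U2\<close> is a rotation about \<rho>.\<close>

lemma wt_u_U2: "wt_u (U2 \<odot> m) = wt_u m"
  by (cases m) (simp add: U2_def algebra_simps)

lemma wt_u_mult_S2: "wt_u (m \<odot> S2) = 1 - wt_u m"
  by (cases m) (simp add: S2_def algebra_simps flip: hs_minus)

text \<open>Both inverses map \<rho> to \<rho> - 1, the center of the triangle on the other side of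
  the edge from infinity to 0.\<close>

lemma wt_u_S2_T2: "wt_u (S2 \<odot> m) = wt_u (T2 \<odot> m)"
  by (cases m) (simp add: S2_def T2_def algebra_simps)

lemma wt_u_S2_S2: "wt_u (S2 \<odot> (S2 \<odot> m)) = wt_u m"
  by (cases m) (simp add: S2_def)

lemma wt1_S2: "wt1 (S2 \<odot> m) = - wt1 m"
  by (simp add: wt1_def wt_u_S2_S2)

lemma wt1_mult_S2: "wt1 (m \<odot> S2) = - wt1 m"
  by (simp add: wt1_def wt_u_mult_S2 flip: mat2_mult_assoc)

lemma wt2_U2: "wt2 (U2 \<odot> m) = wt2 m"
  by (simp add: wt2_def mat2_mult_assoc wt_u_U2)

text \<open>The chain map property: the multiplicities of the two triangles at the edge from
  infinity to 0 differ by the multiplicity of this edge in the image of the boundary.\<close>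

lemma wt2_diff_S2: "wt2 m - wt2 (S2 \<odot> m) = wt1 m + wt1 (m \<odot> U2) + wt1 (m \<odot> U2 \<odot> U2)"
  by (simp add: wt2_def wt1_def mat2_mult_assoc)

text \<open>The form (1, -1, 1) has the root \<rho>, and composing it with m moves the root to the
  preimage of \<rho> under m.\<close>

lemma wt2_eq_red_weight: "wt2 m = red_weight (form_mult (1, -1, 1) m)"
  by (cases m) (simp add: wt2_def U2_def algebra_simps power2_eq_square)

lemma wt_side_conjU:
  "wt_side (conjU (a, b, c, d)) = side (- b) (c + d - a - b) c (a + d)"
  "wt_side (conjU (conjU (a, b, c, d))) = side (c + d - a - b) c (- b) (a + d)"
  by (simp_all add: conjU_def U2_def algebra_simps)

lemma wt_split_conjU:
  "wt_split (conjU (a, b, c, d)) = split3 (- b) (c + d - a - b) c (a + d)"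
  "wt_split (conjU (conjU (a, b, c, d))) = split3 (c + d - a - b) c (- b) (a + d)"
  by (simp_all add: conjU_def U2_def algebra_simps)

lemma wt_fix_eq: "wt_fix (a, b, c, d) =
    (let x = c; y = - b; z = c + d - a - b; t = a + d in side x y z t + side y z x t + side z x y t - 2)"
  by (simp add: wt_fix_def wt_side_conjU Let_def)

lemma wt_side_S2:
  assumes "det2 m > 0"
  shows "wt_side (adj2 S2 \<odot> m \<odot> S2) = 1 - wt_side m"
proof -
  obtain a b c d where m: "m = (a, b, c, d)" by (cases m)
  show ?thesis
  proof (cases "b * c < 0")
    case True
    then have "c > 0 \<and> b < 0 \<or> c < 0 \<and> b > 0" by (auto simp: mult_less_0_iff)
    then show ?thesis
      by (auto simp: m S2_def side_def hs_def mult_less_0_iff zero_less_mult_iff)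
  next
    case False
    then show ?thesis
      by (simp add: m S2_def side_def mult.commute[of c b] flip: hs_minus) (simp add: algebra_simps)
  qed
qed

section \<open>Agreement of the side tests outside a finite box\<close>

lemma finite_box:
  assumes "n > 0"
  shows "finite {(a, b, c, d). (a, b, c, d) \<in> mats n \<and> \<bar>a * b\<bar> \<le> B \<and> \<bar>c * d\<bar> \<le> B}"
proof (rule finite_subset)
  let ?K = "B + n"
  let ?I = "{- ?K..?K}"
  show "finite (?I \<times> ?I \<times> ?I \<times> ?I)" by simp
  have le: "\<bar>x\<bar> \<le> \<bar>x * y\<bar>" if "y \<noteq> 0" for x y :: int
    using that mult_left_mono[of 1 "\<bar>y\<bar>" "\<bar>x\<bar>"] by (simp add: abs_mult)
  show "{(a, b, c, d). (a, b, c, d) \<in> mats n \<and> \<bar>a * b\<bar> \<le> B \<and> \<bar>c * d\<bar> \<le> B} \<subseteq> ?I \<times> ?I \<times> ?I \<times> ?I"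
  proof safe
    fix a b c d :: int
    assume "(a, b, c, d) \<in> mats n" and B: "\<bar>a * b\<bar> \<le> B" "\<bar>c * d\<bar> \<le> B"
    then have det: "a * d - b * c = n" by (simp add: mats_def)
    have B0: "B \<ge> 0" using B by linarith
    \<comment> \<open>If y is nonzero, the product with y bounds x; if y = 0, the determinant
      does.\<close>
    have *: "\<bar>x\<bar> \<le> ?K" if "\<bar>x * y\<bar> \<le> B" "\<bar>x * z - y * w\<bar> = n" for x y z w :: int
    proof (cases "y = 0")
      case True
      then show ?thesis
        using that le[of z x] B0 assms by (cases "z = 0") auto
    next
      case False
      then show ?thesis using that le[of y x] assms by auto
    qed
    have "\<bar>a\<bar> \<le> ?K" using *[of a b d c] B det assms by auto
    moreover have "\<bar>b\<bar> \<le> ?K" using *[of b a c d] B det assms by (auto simp: mult.commute abs_minus_commute)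
    moreover have "\<bar>c\<bar> \<le> ?K" using *[of c d b a] B det assms by (auto simp: mult.commute abs_minus_commute)
    moreover have "\<bar>d\<bar> \<le> ?K" using *[of d c a b] B det assms by (auto simp: mult.commute abs_minus_commute)
    ultimately show "a \<in> ?I" "b \<in> ?I" "c \<in> ?I" "d \<in> ?I" by auto
  qed
qed

lemma hs_cong: "(x > 0 \<longleftrightarrow> y > 0) \<Longrightarrow> (x = 0 \<longleftrightarrow> y = 0) \<Longrightarrow> hs x = hs y"
  by (simp add: hs_def)

lemma hs_dominant: "\<bar>s\<bar> < \<bar>2 * r\<bar> \<Longrightarrow> hs (s - 2 * r) = hs (- r)"
  by (auto simp: hs_def)

text \<open>Here n is the sum of the positive integers ad and -bc, so all four entries are bounded
  by n.\<close>

lemma in_box: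
  assumes "(a, b, c, d) \<in> mats n" "a * d > 0" "b * c < 0"
  shows "\<bar>a * b\<bar> \<le> n\<^sup>2 \<and> \<bar>c * d\<bar> \<le> n\<^sup>2"
proof -
  have *: "\<bar>a\<bar> * \<bar>d\<bar> < n" "\<bar>b\<bar> * \<bar>c\<bar> < n" "a \<noteq> 0" "b \<noteq> 0" "c \<noteq> 0" "d \<noteq> 0"
    using assms by (auto simp: mats_def simp flip: abs_mult)
  have "\<bar>x\<bar> \<le> n \<and> \<bar>y\<bar> \<le> n" if "\<bar>x\<bar> * \<bar>y\<bar> < n" "x \<noteq> 0" "y \<noteq> 0" for x y :: int
  proof -
    have "\<bar>x\<bar> * 1 \<le> \<bar>x\<bar> * \<bar>y\<bar>" "1 * \<bar>y\<bar> \<le> \<bar>x\<bar> * \<bar>y\<bar>"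
      using that by (auto intro!: mult_left_mono mult_right_mono)
    then show ?thesis using that by linarith
  qed
  from this[OF *(1)] this[OF *(2)] * have "\<bar>a\<bar> \<le> n" "\<bar>b\<bar> \<le> n" "\<bar>c\<bar> \<le> n" "\<bar>d\<bar> \<le> n" by auto
  then have "\<bar>a\<bar> * \<bar>b\<bar> \<le> n * n" "\<bar>c\<bar> * \<bar>d\<bar> \<le> n * n" by (auto intro!: mult_mono)
  then show ?thesis by (simp add: abs_mult power2_eq_square)
qed

text \<open>The sign of -(ab + cd) is the side test for the point i. The remaining term ad + bc has
  the square n^2 + 4(ab)(cd), which is too small to matter outside the box.\<close>

lemma wt_u_outside_box:
  assumes "(a, b, c, d) \<in> mats n" "n > 0" "\<not> (\<bar>a * b\<bar> \<le> n \<and> \<bar>c * d\<bar> \<le> n)"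
  shows "wt_u (a, b, c, d) = hs (- (a * b + c * d))"
proof -
  define P Q where "P = a * b" and "Q = c * d"
  have det: "a * d - b * c = n" using assms by (simp add: mats_def)
  have s: "(a * d + b * c)\<^sup>2 = n\<^sup>2 + 4 * P * Q"
    by (simp add: P_def Q_def power2_eq_square algebra_simps flip: det)
  have "n\<^sup>2 < P\<^sup>2 \<or> n\<^sup>2 < Q\<^sup>2"
    using assms by (auto simp: P_def Q_def not_le power2_strict_mono)
  moreover have "4 * (P\<^sup>2 + P * Q + Q\<^sup>2) = 3 * P\<^sup>2 + (P + 2 * Q)\<^sup>2"
    "4 * (P\<^sup>2 + P * Q + Q\<^sup>2) = 3 * Q\<^sup>2 + (Q + 2 * P)\<^sup>2"
    by (simp_all add: power2_eq_square algebra_simps)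
  ultimately have "n\<^sup>2 < 4 * (P\<^sup>2 + P * Q + Q\<^sup>2)"
    using zero_le_power2[of "P + 2 * Q"] zero_le_power2[of "Q + 2 * P"]
      zero_le_power2[of P] zero_le_power2[of Q] by linarith
  then have "(a * d + b * c)\<^sup>2 < (2 * (P + Q))\<^sup>2"
    unfolding s by (simp add: power2_eq_square algebra_simps)
  then have "\<bar>a * d + b * c\<bar> < \<bar>2 * (P + Q)\<bar>"
    by (metis abs_le_square_iff not_le)
  from hs_dominant[OF this] show ?thesis by (simp add: P_def Q_def algebra_simps)
qed


lemma hs_opposite: "x * y < 0 \<Longrightarrow> hs x = hs (- y)"
  by (auto simp: hs_def mult_less_0_iff)

text \<open>In either branch of \<open>side\<close>, the product of the tested quantity with ab + cd
  expands into terms of one sign.\<close>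

lemma wt_side_outside_box:
  assumes "(a, b, c, d) \<in> mats n" "n > 0" "\<not> (\<bar>a * b\<bar> \<le> n\<^sup>2 \<and> \<bar>c * d\<bar> \<le> n\<^sup>2)"
  shows "wt_side (a, b, c, d) = hs (- (a * b + c * d))"
proof -
  have det: "a * d - b * c = n" using assms by (simp add: mats_def)
  have nz: "a * b \<noteq> 0 \<or> c * d \<noteq> 0" using assms by auto
  show ?thesis
  proof (cases "b * c < 0")
    case True
    have 0: "a * d \<le> 0" using in_box[OF assms(1) _ True] assms(3) by linarith
    have side: "wt_side (a, b, c, d) = hs (c * (a - d))"
      using True by (simp add: side_def mult.commute[of c b])
    have "a\<^sup>2 * (b * c) + c\<^sup>2 * (a * d) - (a * d) * (b * c) - (c * d)\<^sup>2 < 0"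
    proof -
      have "(a * d) * (b * c) \<ge> 0" "c\<^sup>2 * (a * d) \<le> 0" "a\<^sup>2 * (b * c) \<le> 0"
        using 0 True by (simp_all add: mult_nonpos_nonpos mult_nonneg_nonpos)
      moreover have "a\<^sup>2 * (b * c) < 0 \<or> (c * d)\<^sup>2 > 0"
        using nz True by (auto simp: mult_less_0_iff zero_less_mult_iff)
      ultimately show ?thesis using zero_le_power2[of "c * d"] by linarith
    qed
    then have "c * (a - d) * (a * b + c * d) < 0" by (simp add: power2_eq_square algebra_simps)
    then show ?thesis unfolding side by (rule hs_opposite)
  next
    case False
    have side: "wt_side (a, b, c, d) = hs ((a + d) * (- b - c))"
      using False by (simp add: side_def mult.commute[of c b])
    have ad: "a * d > 0" using False det assms(2) by linarith
    have "(a * b + c * d)\<^sup>2 + (a * d) * (b\<^sup>2 + c\<^sup>2) + (b * c) * (a\<^sup>2 + d\<^sup>2) > 0"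
    proof -
      have "b\<^sup>2 + c\<^sup>2 > 0" using nz by (auto simp: sum_power2_gt_zero_iff)
      then have "(a * d) * (b\<^sup>2 + c\<^sup>2) > 0" "(b * c) * (a\<^sup>2 + d\<^sup>2) \<ge> 0"
        using ad False by simp_all
      then show ?thesis using zero_le_power2[of "a * b + c * d"] by linarith
    qed
    then have "(a + d) * (- b - c) * (a * b + c * d) < 0" by (simp add: power2_eq_square algebra_simps)
    then show ?thesis unfolding side by (rule hs_opposite)
  qed
qed

text \<open>If ab and cd had opposite signs, then ad > 0 > bc and the matrix would lie in the box.
  So their sum has the sign of cd, or that of ab if cd = 0.\<close>

lemma wt_cusp_outside_box:
  assumes "(a, b, c, d) \<in> mats n" "n > 0" "\<not> (\<bar>a * b\<bar> \<le> n\<^sup>2 \<and> \<bar>c * d\<bar> \<le> n\<^sup>2)"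
  shows "wt_cusp (a, b, c, d) = hs (- (a * b + c * d))"
proof -
  have det: "a * d - b * c = n" using assms by (simp add: mats_def)
  have 0: "(a * b) * (c * d) \<ge> 0"
  proof (rule ccontr)
    assume "\<not> ?thesis"
    then have "(a * d) * (b * c) < 0" by (simp add: mult_ac)
    then have "a * d > 0 \<and> b * c < 0 \<or> a * d < 0 \<and> b * c > 0"
      by (simp only: mult_less_0_iff)
    then have "a * d > 0 \<and> b * c < 0" using det assms(2) by linarith
    then show False using in_box[OF assms(1)] assms(3) by blast
  qed
  show ?thesis
  proof (cases "c * d = 0")
    case False
    have "0 \<le> a * b \<and> 0 \<le> c * d \<or> a * b \<le> 0 \<and> c * d \<le> 0"
      using 0 by (simp only: zero_le_mult_iff)
    then have "(c * d > 0 \<longleftrightarrow> a * b + c * d > 0) \<and> (c * d = 0 \<longleftrightarrow> a * b + c * d = 0)"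
      using False by linarith
    then have "hs (- (c * d)) = hs (- (a * b + c * d))" by (auto simp: hs_def)
    then show ?thesis using False by simp
  qed (simp only: wt_cusp.simps if_True add_0_right refl)
qed


definition fin_supp :: "int \<Rightarrow> (mat2 \<Rightarrow> real) \<Rightarrow> bool"
  where "fin_supp n f \<longleftrightarrow> finite {m \<in> mats n. f m \<noteq> 0}"

lemma fin_suppI_box:
  assumes "n > 0" "\<And>a b c d. (a, b, c, d) \<in> mats n \<Longrightarrow> \<not> (\<bar>a * b\<bar> \<le> B \<and> \<bar>c * d\<bar> \<le> B) \<Longrightarrow> f (a, b, c, d) = 0"
  shows "fin_supp n f"
  unfolding fin_supp_def by (rule finite_subset[OF _ finite_box[OF assms(1)]]) (use assms(2) in auto)

lemma fin_supp_wt1: "n > 0 \<Longrightarrow> fin_supp n wt1"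
proof (rule fin_suppI_box)
  fix a b c d assume *: "n > 0" "(a, b, c, d) \<in> mats n" "\<not> (\<bar>a * b\<bar> \<le> n \<and> \<bar>c * d\<bar> \<le> n)"
  have "wt_u (- c, - d, a, b) = hs (- (c * d + a * b))"
    using wt_u_outside_box[of "- c" "- d" a b n] * by (auto simp: mats_def mult.commute)
  then show "wt1 (a, b, c, d) = 0"
    using wt_u_outside_box[OF *(2,1,3)] by (simp add: wt1_def S2_def add.commute)
qed

lemma box_mono:
  fixes n :: int
  assumes "n > 0" "\<not> (\<bar>x\<bar> \<le> n\<^sup>2 \<and> \<bar>y\<bar> \<le> n\<^sup>2)"
  shows "\<not> (\<bar>x\<bar> \<le> n \<and> \<bar>y\<bar> \<le> n)"
  using assms self_le_power[of n 2] by auto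

lemma fin_supp_wt_side: "n > 0 \<Longrightarrow> fin_supp n (\<lambda>m. wt_u m - wt_side m)"
  by (rule fin_suppI_box[where B = "n\<^sup>2"])
     (use wt_u_outside_box wt_side_outside_box box_mono in \<open>metis diff_self\<close>)+

lemma fin_supp_wt_cusp: "n > 0 \<Longrightarrow> fin_supp n (\<lambda>m. wt_u m - wt_cusp m)"
  by (rule fin_suppI_box[where B = "n\<^sup>2"])
     (use wt_u_outside_box wt_cusp_outside_box box_mono in \<open>metis diff_self\<close>)+

text \<open>A translation fixes infinity, so the test near infinity changes only for geodesics with
  an end there: those with c = 0 and, after reversal by \<open>S2\<close>, those with d = 0.\<close>

lemma wt_cusp_diff:
  assumes "m \<in> mats n" "n > 0"
  shows "wt_cusp m - wt_cusp (T2 \<odot> m) = wt_upper m - wt_upper (m \<odot> S2)"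
proof -
  obtain a b c d where m: "m = (a, b, c, d)" by (cases m)
  have "c \<noteq> 0 \<or> d \<noteq> 0" using assms by (auto simp: m mats_def)
  then show ?thesis
    using hs_minus[of "a * b"] hs_minus[of "a * b + b * c"] by (auto simp: m T2_def S2_def algebra_simps)
qed

section \<open>Elliptic and hyperbolic matrices\<close>

lemma side_minus: "side (- x) (- y) (- z) (- t) = side x y z t"
  by (simp add: side_def algebra_simps)

lemma split3_minus: "split3 (- x) (- y) (- z) (- t) = split3 x y z t"
  by (simp add: split3_def)

lemma wt_fix_minus: "wt_fix (- a, - b, - c, - d) = wt_fix (a, b, c, d)"
proof -
  have "- c + - d - - a - - b = - (c + d - a - b)" "- a + - d = - (a + d)" by simp_all
  then show ?thesis by (simp only: wt_fix_eq Let_def side_minus)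
qed

lemma wt_fix_elliptic:
  assumes "(a + d)\<^sup>2 < 4 * n" "(a, b, c, d) \<in> mats n" "c > 0"
  shows "pos_def (c, d - a, - b)" "wt_fix (a, b, c, d) = red_weight (c, d - a, - b)"
proof -
  have det: "a * d - b * c = n" using assms by (simp add: mats_def)
  show pd: "pos_def (c, d - a, - b)"
    using assms det by (simp add: pos_def_def power2_eq_square algebra_simps)
  have "- b > 0" "c + d - a - b > 0"
    using pos_def_eval[OF pd, of 0 1] pos_def_eval[OF pd, of 1 1] by simp_all
  then show "wt_fix (a, b, c, d) = red_weight (c, d - a, - b)"
    using assms(3) by (simp add: wt_fix_eq Let_def side_def hs_def zero_less_mult_iff mult_less_0_iff)
qed

lemma side_pos: "x > 0 \<Longrightarrow> y > 0 \<Longrightarrow> side x y z t = hs (x + y - z)"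
  and side_neg: "x < 0 \<Longrightarrow> y < 0 \<Longrightarrow> side x y z t = hs (z - x - y)"
  and side_mixed: "t > 0 \<Longrightarrow> x \<ge> 0 \<and> y \<le> 0 \<or> x \<le> 0 \<and> y \<ge> 0 \<Longrightarrow> side x y z t = hs (y - x)"
  by (auto simp: side_def zero_less_mult_iff mult_less_0_iff mult_le_0_iff intro!: hs_cong)

text \<open>A real point that is not a vertex is cut off from the triangle by exactly one edge, so
  two of the three tests succeed and the sum vanishes. The right-hand side accounts for a repelling
  fixed point at a vertex.\<close>

lemma side_sum_hyperbolic:
  assumes "t \<noteq> 0" "x\<^sup>2 + y\<^sup>2 + z\<^sup>2 > 2 * (x * y + y * z + z * x)"
  shows "side x y z t + side y z x t + side z x y t - 2 =
    - (split3 x y z t + split3 y z x t + split3 z x y t)"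
proof -
  have *: "side x y z t + side y z x t + side z x y t - 2 =
    - (split3 x y z t + split3 y z x t + split3 z x y t)"
    if "t > 0" and d: "x\<^sup>2 + y\<^sup>2 + z\<^sup>2 > 2 * (x * y + y * z + z * x)" for x y z t
  proof -
    \<comment> \<open>The left-hand side is minus the discriminant. This nonlinear fact is turned
      into sign conditions, after which only linear case distinctions remain.\<close>
    have prod: "(x + y - z) * (y + z - x) + (y + z - x) * (z + x - y) + (z + x - y) * (x + y - z) < 0"
      using d by (simp add: power2_eq_square algebra_simps)
    have "\<not> (x + y - z \<ge> 0 \<and> y + z - x \<ge> 0 \<and> z + x - y \<ge> 0)"
      using prod by (metis add_nonneg_nonneg mult_nonneg_nonneg not_less)
    moreover have "\<not> (x + y - z \<le> 0 \<and> y + z - x \<le> 0 \<and> z + x - y \<le> 0)"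
      using prod by (metis add_nonneg_nonneg mult_nonpos_nonpos not_less)
    moreover have "\<not> (x = 0 \<and> y = z) \<and> \<not> (y = 0 \<and> x = z) \<and> \<not> (z = 0 \<and> x = y)"
      using d by (auto simp: power2_eq_square)
    moreover have "x > 0 \<or> x = 0 \<or> x < 0" "y > 0 \<or> y = 0 \<or> y < 0" "z > 0 \<or> z = 0 \<or> z < 0"
      by linarith+
    ultimately show ?thesis
      using \<open>t > 0\<close>
      by (elim disjE; simp add: side_pos side_neg side_mixed split3_def zero_less_mult_iff mult_less_0_iff)
         (auto simp: hs_def)
  qed
  show ?thesis
  proof (cases "t > 0")
    case True
    then show ?thesis using * assms by blast
  next
    case False
    from False show ?thesis
      using *[of "- t" "- x" "- y" "- z"] assms by (simp add: side_minus split3_minus)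
  qed
qed

lemma wt_fix_hyperbolic:
  assumes "(a + d)\<^sup>2 > 4 * n" "(a, b, c, d) \<in> mats n" "n > 0"
  shows "wt_fix (a, b, c, d) =
    - (wt_split (a, b, c, d) + wt_split (conjU (a, b, c, d)) + wt_split (conjU (conjU (a, b, c, d))))"
proof -
  have det: "a * d - b * c = n" using assms by (simp add: mats_def)
  have "a + d \<noteq> 0" using assms by auto
  from side_sum_hyperbolic[OF this, of c "- b" "c + d - a - b"] show ?thesis
    using assms(1) det by (simp add: wt_fix_eq wt_split_conjU Let_def power2_eq_square algebra_simps)
qed

section \<open>The degree of a Hecke correspondence\<close>

definition hnf :: "nat \<Rightarrow> mat2 set"
  where "hnf N = (\<lambda>((a, d), b). (int a, b, 0, int d)) ` (SIGMA (a, d):factor_pairs N. {0..<int a})"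

lemma finite_factor_pairs: "N > 0 \<Longrightarrow> finite (factor_pairs N)"
proof -
  assume "N > 0"
  have "factor_pairs N \<subseteq> {..N} \<times> {..N}" by (auto simp: factor_pairs_def)
  then show ?thesis by (rule finite_subset) simp
qed

lemma finite_hnf: "N > 0 \<Longrightarrow> finite (hnf N)"
  unfolding hnf_def by (intro finite_imageI finite_SigmaI finite_factor_pairs) auto

lemma in_hnf_iff: "(a, b, c, d) \<in> hnf N \<longleftrightarrow> c = 0 \<and> a > 0 \<and> d > 0 \<and> a * d = int N \<and> 0 \<le> b \<and> b < a"
  (is "_ \<longleftrightarrow> ?R")
proof
  assume "(a, b, c, d) \<in> hnf N"
  then show ?R by (auto simp: hnf_def factor_pairs_def)
next
  assume R: ?R
  then have "nat a * nat d = N" by (metis int_nat_eq nat_int nat_mult_distrib less_imp_le)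
  then show "(a, b, c, d) \<in> hnf N"
    unfolding hnf_def using R
    by (intro image_eqI[where x = "((nat a, nat d), b)"]) (auto simp: factor_pairs_def)
qed

lemma card_hnf: "N > 0 \<Longrightarrow> real (card (hnf N)) = (\<Sum>(a, d)\<in>factor_pairs N. real a)"
proof -
  assume N: "N > 0"
  have "card (hnf N) = card (SIGMA (a, d):factor_pairs N. {0..<int a})"
    unfolding hnf_def by (rule card_image) (auto simp: inj_on_def)
  also have "\<dots> = (\<Sum>(a, d)\<in>factor_pairs N. a)"
    by (subst card_SigmaI) (auto simp: finite_factor_pairs N split_def)
  finally show ?thesis by (simp add: split_def)
qed

lemma mats_eq_Union_hnf:
  assumes "N > 0"
  shows "mats (int N) = (\<Union>h\<in>hnf N. (\<lambda>g. h \<odot> g) ` mats 1)"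
proof (intro equalityI subsetI)
  fix m assume m: "m \<in> mats (int N)"
  obtain a b c d where m': "m = (a, b, c, d)" by (cases m)
  define e where "e = gcd c d"
  have det: "a * d - b * c = int N" using m by (simp add: mats_def m')
  then have cd: "c \<noteq> 0 \<or> d \<noteq> 0" using assms by auto
  then have e: "e > 0" by (simp add: e_def)
  have "e dvd c" "e dvd d" by (simp_all add: e_def)
  then obtain c' d' where c: "c = c' * e" and d: "d = d' * e" by (metis dvdE mult.commute)
  obtain r s where bez: "r * c + s * d = e"
    using bezout_int[of c d] by (auto simp: e_def)
  then have "e * (r * c' + s * d') = e * 1" using bez by (simp add: c d algebra_simps)
  then have rs: "r * c' + s * d' = 1" using e by simp
  define k where "k = - ((a * r + b * s) div (a * d' - b * c'))"
  define g where "g = (d', r, - c', s) \<odot> (1, k, 0, 1)"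
  have g: "g \<in> mats 1" using rs by (simp add: g_def mats_def det2_mult algebra_simps)
  have "(a * d' - b * c') * e = int N" using det by (simp add: c d algebra_simps)
  moreover from this have pos: "a * d' - b * c' > 0" using e assms
    by (metis of_nat_0_less_iff zero_less_mult_pos2)
  moreover have "(a * r + b * s) + (a * d' - b * c') * k = (a * r + b * s) mod (a * d' - b * c')"
    by (simp add: k_def minus_mult_div_eq_mod)
  moreover have "m \<odot> g = (a * d' - b * c', (a * r + b * s) + (a * d' - b * c') * k, 0, e)"
  proof -
    have "c' * (e * r) + d' * (e * s) = e" using bez by (simp add: c d algebra_simps)
    then show ?thesis by (simp add: g_def m' c d algebra_simps)
  qed
  ultimately have "m \<odot> g \<in> hnf N" using e by (simp add: in_hnf_iff)
  moreover have "m = (m \<odot> g) \<odot> adj2 g" by (simp add: adj2_cancel g)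
  ultimately show "m \<in> (\<Union>h\<in>hnf N. (\<lambda>g. h \<odot> g) ` mats 1)"
    by (intro UN_I[of "m \<odot> g"] image_eqI[where x = "adj2 g"]) (simp_all add: g)
next
  fix m assume "m \<in> (\<Union>h\<in>hnf N. (\<lambda>g. h \<odot> g) ` mats 1)"
  then obtain h g where "h \<in> hnf N" "g \<in> mats 1" "m = h \<odot> g" by blast
  then show "m \<in> mats (int N)"
    by (cases h) (auto simp: mats_def det2_mult in_hnf_iff simp del: mat2_mult.simps)
qed

lemma hnf_unique:
  assumes "h \<in> hnf N" "h' \<in> hnf N" "h \<odot> g = h' \<odot> g'" "g \<in> mats 1" "g' \<in> mats 1"
  shows "h = h'"
proof -
  obtain a b c d a' b' c' d' where h: "h = (a, b, c, d)" "h' = (a', b', c', d')" by (cases h; cases h')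
  have c: "c = 0" "c' = 0" and pos: "a > 0" "d > 0" "a' > 0" "d' > 0" and b: "0 \<le> b" "b < a" "0 \<le> b'" "b' < a'"
    and N: "a * d = int N" "a' * d' = int N"
    using assms(1,2) by (auto simp: h in_hnf_iff)
  define k where "k = g' \<odot> adj2 g"
  have k: "k \<in> mats 1" using assms by (simp add: k_def mult_in_mats)
  have eq: "h = h' \<odot> k"
    using assms by (metis k_def mat2_mult_assoc adj2_cancel(4))
  obtain p q r s where k': "k = (p, q, r, s)" by (cases k)
  have "r = 0" "d = d' * s" using eq pos by (auto simp: h k' c)
  moreover have "p * s = 1" using k \<open>r = 0\<close> by (simp add: mats_def k')
  moreover have "s > 0" using \<open>d = d' * s\<close> pos by (simp add: zero_less_mult_iff)
  ultimately have "s = 1 \<and> p = 1" by (simp add: pos_zmult_eq_1_iff mult.commute[of p])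
  then have ad: "d = d'" "a = a'" "b = a' * q + b'" using eq \<open>r = 0\<close> \<open>s = 1 \<and> p = 1\<close> by (auto simp: h k' c)
  have "q = 0"
  proof (rule ccontr)
    assume "q \<noteq> 0"
    then have "q \<ge> 1 \<or> q \<le> -1" by linarith
    then have "a' * q \<ge> a' \<or> a' * q \<le> - a'"
      using pos mult_left_mono[of 1 q a'] mult_left_mono[of q "-1" a'] by auto
    then show False using ad b by linarith
  qed
  then show ?thesis using ad by (simp add: h c)
qed

text \<open>On each coset h SL2(Z) these are the weights of one positive definite form under all of
  SL2(Z), which add up to 6, and there are sigma(N) cosets.\<close>

lemma infsum_wt2:
  assumes "N > 0"
  shows "fin_supp (int N) wt2" "infsum wt2 (mats (int N)) = 6 * (\<Sum>(a, d)\<in>factor_pairs N. real a)"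
proof -
  have coset: "finite {g \<in> mats 1. wt2 (h \<odot> g) \<noteq> 0}" "infsum (\<lambda>g. wt2 (h \<odot> g)) (mats 1) = 6"
    if "h \<in> hnf N" for h
  proof -
    have "det2 h \<noteq> 0" using that assms by (cases h) (auto simp: in_hnf_iff)
    then have "pos_def (form_mult (1, -1, 1) h)"
      by (intro pos_def_form_mult) (simp_all add: pos_def_def)
    from red_weight_partition[OF this]
    show "finite {g \<in> mats 1. wt2 (h \<odot> g) \<noteq> 0}" "infsum (\<lambda>g. wt2 (h \<odot> g)) (mats 1) = 6"
      by (simp_all add: wt2_eq_red_weight form_mult_mult)
  qed
  have inj: "inj_on (\<lambda>g. h \<odot> g) (mats 1)" if "h \<in> hnf N" for h
  proof (rule inj_onI)
    fix g g' :: mat2 assume eq: "h \<odot> g = h \<odot> g'"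
    obtain a b c d where h: "h = (a, b, c, d)" by (cases h)
    have "a \<noteq> 0" "d \<noteq> 0" "c = 0" using that by (auto simp: h in_hnf_iff)
    then show "g = g'" using eq by (cases g; cases g') (auto simp: h)
  qed
  have sub: "{m \<in> mats (int N). wt2 m \<noteq> 0} =
      (\<Union>h\<in>hnf N. (\<lambda>g. h \<odot> g) ` {g \<in> mats 1. wt2 (h \<odot> g) \<noteq> 0})"
    unfolding mats_eq_Union_hnf[OF assms] by blast
  show "fin_supp (int N) wt2"
    unfolding fin_supp_def sub using coset finite_hnf[OF assms] by blast
  have summable: "wt2 summable_on ((\<lambda>g. h \<odot> g) ` mats 1)" if "h \<in> hnf N" for h
    by (subst summable_on_reindex[OF inj[OF that]])
       (auto simp: o_def coset[OF that] intro!: finite_nonzero_values_imp_summable_on)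
  have "infsum wt2 (mats (int N)) = (\<Sum>h\<in>hnf N. infsum wt2 ((\<lambda>g. h \<odot> g) ` mats 1))"
    unfolding mats_eq_Union_hnf[OF assms]
    by (rule sum_infsum[symmetric]) (use finite_hnf[OF assms] summable hnf_unique in blast)+
  also have "\<dots> = (\<Sum>h\<in>hnf N. 6)"
    by (rule sum.cong) (simp_all add: infsum_reindex inj o_def coset)
  finally show "infsum wt2 (mats (int N)) = 6 * (\<Sum>(a, d)\<in>factor_pairs N. real a)"
    by (simp add: card_hnf[OF assms])
qed

section \<open>Coboundaries for conjugation\<close>

lemma bij_betw_conjU: "bij_betw conjU (mats n) (mats n)"
  unfolding conjU_def
  by (rule bij_betw_trans[OF bij_betw_mult_left[of "adj2 U2"] bij_betw_mult_right[of U2], unfolded o_def]) simp_all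

lemma fin_supp_reindex:
  assumes "fin_supp n f" "bij_betw h (mats n) (mats n)"
  shows "fin_supp n (\<lambda>m. f (h m))"
proof -
  have "h ` {m \<in> mats n. f (h m) \<noteq> 0} \<subseteq> {m \<in> mats n. f m \<noteq> 0}"
    using assms(2) by (auto simp: bij_betw_def)
  moreover have "inj_on h {m \<in> mats n. f (h m) \<noteq> 0}"
    using assms(2) by (auto simp: bij_betw_def intro: inj_on_subset)
  ultimately show ?thesis
    using assms(1) unfolding fin_supp_def by (meson finite_imageD finite_subset)
qed

lemma fin_supp_add:
  assumes "fin_supp n f" "fin_supp n g"
  shows "fin_supp n (\<lambda>m. f m + g m)"
  using finite_UnI[OF assms[unfolded fin_supp_def]] unfolding fin_supp_def
  by (rule finite_subset[rotated]) auto

lemma fin_supp_mult: "fin_supp n f \<Longrightarrow> fin_supp n (\<lambda>m. f m * k m)"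
  unfolding fin_supp_def by (erule finite_subset[rotated]) auto

lemma fin_supp_diff:
  assumes "fin_supp n f" "fin_supp n g"
  shows "fin_supp n (\<lambda>m. f m - g m)"
  using fin_supp_add[OF assms(1) fin_supp_mult[OF assms(2), of "\<lambda>_. -1"]] by simp

lemma fin_supp_summable: "fin_supp n f \<Longrightarrow> f summable_on mats n"
  unfolding fin_supp_def by (rule finite_nonzero_values_imp_summable_on) simp

lemma conjU_eq_wt_u: "wt_u (conjU m) = wt_u (m \<odot> U2)"
  by (cases m) (simp add: conjU_def U2_def algebra_simps)

lemma wt_u_conjU_conjU: "wt_u (conjU (conjU m)) = wt_u (m \<odot> U2 \<odot> U2)"
  by (cases m) (simp add: conjU_def U2_def algebra_simps)

definition wt_diff :: "mat2 \<Rightarrow> real"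
  where "wt_diff m = wt_u m - wt_side m"

text \<open>\<open>conjU m\<close> differs from m U2 by a left factor that fixes \<rho>. Hence
  \<open>wt2\<close> is a sum of \<open>wt_u\<close> over conjugates of m, comparable with
  \<open>wt_fix\<close> term by term.\<close>

lemma wt2_eq_wt_fix:
  "wt2 m = wt_diff m + wt_diff (conjU m) + wt_diff (conjU (conjU m)) + wt_fix m"
  using conjU_eq_wt_u[of m] wt_u_conjU_conjU[of m] by (simp add: wt2_def wt_diff_def wt_fix_def)

lemma wt1_eq_wt_diff:
  assumes "det2 m > 0"
  shows "wt1 m = wt_diff m + wt_diff (adj2 S2 \<odot> m \<odot> S2)"
proof -
  have "wt_u (adj2 S2 \<odot> m) = wt_u (S2 \<odot> m)"
    by (cases m) (simp add: S2_def)
  then show ?thesis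
    by (simp add: wt1_def wt_diff_def wt_side_S2[OF assms] wt_u_mult_S2)
qed

lemma fin_supp_wt_fix:
  assumes "N > 0"
  shows "fin_supp (int N) wt_fix"
proof -
  have *: "wt_fix m = wt2 m - (wt_diff m + wt_diff (conjU m) + wt_diff (conjU (conjU m)))" for m
    by (simp add: wt2_eq_wt_fix)
  have "fin_supp (int N) wt_diff" using fin_supp_wt_side[of "int N"] assms by (simp add: wt_diff_def[abs_def])
  then show ?thesis
    unfolding * [abs_def]
    by (intro fin_supp_diff fin_supp_add infsum_wt2(1)[OF assms])
       (auto intro: fin_supp_reindex[OF _ bij_betw_conjU] fin_supp_reindex[OF fin_supp_reindex[OF _ bij_betw_conjU] bij_betw_conjU])
qed

section \<open>The projective line modulo M\<close>

definition wedge :: "int \<times> int \<Rightarrow> int \<times> int \<Rightarrow> int"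
  where "wedge v w = fst v * snd w - snd v * fst w"

text \<open>Only common factors with M are excluded, so that matrices of determinant N, which is
  coprime to M, act on these integer vectors without normalization.\<close>

definition prim :: "nat \<Rightarrow> int \<times> int \<Rightarrow> bool"
  where "prim M v \<longleftrightarrow> coprime (gcd (fst v) (snd v)) (int M)"

definition eqv :: "nat \<Rightarrow> int \<times> int \<Rightarrow> int \<times> int \<Rightarrow> bool"
  where "eqv M v w \<longleftrightarrow> int M dvd wedge v w"

lemma eqv_refl [simp]: "eqv M v v"
  by (simp add: eqv_def wedge_def)

lemma eqv_sym: "eqv M v w \<Longrightarrow> eqv M w v"
  unfolding eqv_def wedge_def by (subst dvd_minus_iff[symmetric]) (simp add: mult.commute)

lemma eqv_commute: "eqv M v w = eqv M w v"
  using eqv_sym by blast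

lemma prim_dvd_cancel:
  assumes "prim M w" "int M dvd k * fst w" "int M dvd k * snd w"
  shows "int M dvd k"
proof -
  have "int M dvd gcd (k * fst w) (k * snd w)" using assms by simp
  then have "int M dvd \<bar>k\<bar> * gcd (fst w) (snd w)" by (simp add: gcd_mult_distrib_int)
  then have "int M dvd \<bar>k\<bar>" using assms(1)
    by (simp add: prim_def coprime_dvd_mult_left_iff coprime_commute)
  then show ?thesis by simp
qed

lemma eqv_trans:
  assumes "eqv M u v" "eqv M v w" "prim M v"
  shows "eqv M u w"
  unfolding eqv_def
proof (rule prim_dvd_cancel[OF assms(3)])
  have "wedge u w * fst v = wedge v w * fst u + wedge u v * fst w"
    "wedge u w * snd v = wedge v w * snd u + wedge u v * snd w"
    by (simp_all add: wedge_def algebra_simps)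
  then show "int M dvd wedge u w * fst v" "int M dvd wedge u w * snd v"
    using assms(1,2) by (simp_all add: eqv_def)
qed

lemma wedge_app: "wedge (m \<cdot> v) (m \<cdot> w) = det2 m * wedge v w"
  by (cases m; cases v; cases w) (simp add: wedge_def algebra_simps)

lemma eqv_app: "eqv M v w \<Longrightarrow> eqv M (m \<cdot> v) (m \<cdot> w)"
  by (simp add: eqv_def wedge_app)

lemma eqv_app_iff: "coprime (det2 m) (int M) \<Longrightarrow> eqv M (m \<cdot> v) (m \<cdot> w) \<longleftrightarrow> eqv M v w"
  by (simp add: eqv_def wedge_app coprime_dvd_mult_right_iff coprime_commute)

lemma prim_app:
  assumes "coprime (det2 m) (int M)" "prim M v"
  shows "prim M (m \<cdot> v)"
proof -
  obtain a b c d x y where m: "m = (a, b, c, d)" and v: "v = (x, y)" by (cases m; cases v)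
  show ?thesis unfolding prim_def
  proof (rule coprimeI)
    fix e assume e: "e dvd gcd (fst (m \<cdot> v)) (snd (m \<cdot> v))" "e dvd int M"
    have "det2 m * x = d * (a * x + b * y) - b * (c * x + d * y)"
      "det2 m * y = a * (c * x + d * y) - c * (a * x + b * y)"
      by (simp_all add: m algebra_simps)
    then have "e dvd det2 m * x" "e dvd det2 m * y"
      using e(1) by (simp_all add: m v)
    moreover have "coprime e (det2 m)"
      using assms(1) e(2) by (metis coprime_commute coprime_divisors dvd_refl)
    ultimately have "e dvd gcd x y" by (simp add: coprime_dvd_mult_right_iff)
    then show "is_unit e" using assms(2) e(2) by (auto simp: prim_def v dest: coprime_common_divisor)
  qed
qed

lemma prim_SL: "m \<in> mats 1 \<Longrightarrow> prim M v \<Longrightarrow> prim M (m \<cdot> v)"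
  by (rule prim_app) (simp_all add: mats_def)

lemma eqv_S2: "eqv M (S2 \<cdot> S2 \<cdot> v) v"
  and eqv_adj_S2: "eqv M (adj2 S2 \<cdot> v) (S2 \<cdot> v)"
  and eqv_U2: "eqv M (U2 \<cdot> U2 \<cdot> U2 \<cdot> v) v"
  and eqv_UUS: "eqv M (U2 \<cdot> U2 \<cdot> S2 \<cdot> v) (T2 \<cdot> v)"
  and eqv_SU: "eqv M (S2 \<cdot> U2 \<cdot> v) (adj2 T2 \<cdot> v)"
  by (cases v; simp add: eqv_def wedge_def S2_def U2_def T2_def algebra_simps)+

lemma mat2_app_one [simp]: "(1, 0, 0, 1) \<cdot> v = v"
  by (cases v) simp

lemma shear_in [simp]: "(1, k, 0, 1) \<in> mats 1"
  by (simp add: mats_def)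

text \<open>The Euclidean algorithm: a shear reduces x modulo y and \<open>S2\<close> exchanges the
  coordinates up to sign. Shears are available because, on lines, U2 U2 S2 acts like
  \<open>T2\<close> and S2 U2 like its inverse.\<close>

lemma prim_induct:
  assumes "prim M v"
    and base: "Q (1, 0)"
    and S: "\<And>v. prim M v \<Longrightarrow> Q v \<Longrightarrow> Q (S2 \<cdot> v)"
    and U: "\<And>v. prim M v \<Longrightarrow> Q v \<Longrightarrow> Q (U2 \<cdot> v)"
    and eqv: "\<And>v w. prim M v \<Longrightarrow> prim M w \<Longrightarrow> eqv M v w \<Longrightarrow> Q v \<Longrightarrow> Q w"
  shows "Q v"
proof -
  have T: "Q (T2 \<cdot> v)" if "prim M v" "Q v" for v
    by (rule eqv[OF _ _ eqv_UUS]) (use that S U in \<open>simp_all add: prim_SL\<close>)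
  have T': "Q (adj2 T2 \<cdot> v)" if "prim M v" "Q v" for v
    by (rule eqv[OF _ _ eqv_SU]) (use that S U in \<open>simp_all add: prim_SL\<close>)
  have shear: "Q ((1, k, 0, 1) \<cdot> v)" if v: "prim M v" "Q v" for v k
  proof (induction k rule: int_induct[where k = 0])
    case base
    then show ?case using v by (cases v) simp
  next
    case (step1 i)
    have "T2 \<cdot> (1, i, 0, 1) \<cdot> v = (1, i + 1, 0, 1) \<cdot> v"
      by (cases v) (simp add: T2_def algebra_simps)
    then show ?case using T[OF prim_SL step1(2)] v by simp
  next
    case (step2 i)
    have "adj2 T2 \<cdot> (1, i, 0, 1) \<cdot> v = (1, i - 1, 0, 1) \<cdot> v"
      by (cases v) (simp add: T2_def algebra_simps)
    then show ?case using T'[OF prim_SL step2(2)] v by simp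
  qed
  from assms(1) show ?thesis
  proof (induction "nat \<bar>snd v\<bar>" arbitrary: v rule: less_induct)
    case less
    obtain x y where v: "v = (x, y)" by (cases v)
    show ?case
    proof (cases "y = 0")
      case True
      then have "eqv M (1, 0) v" by (simp add: v eqv_def wedge_def)
      from eqv[OF _ less.prems this base] show ?thesis by (simp add: prim_def)
    next
      case False
      define w where "w = (y, - (x mod y))"
      have vw: "v = (1, x div y, 0, 1) \<cdot> S2 \<cdot> w" by (simp add: v w_def S2_def mult.commute)
      have w: "w = adj2 S2 \<cdot> adj2 (1, x div y, 0, 1) \<cdot> v"
        by (simp add: vw adj2_app_cancel del: adj2.simps)
      have pw: "prim M w" unfolding w using less.prems by (intro prim_SL) (simp_all del: adj2.simps)
      moreover have "\<bar>x mod y\<bar> < \<bar>y\<bar>" using False by (rule abs_mod_less)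
      ultimately have "Q w" by (intro less.hyps) (simp_all add: v w_def)
      then show ?thesis unfolding vw using pw by (intro shear S) (simp_all add: prim_SL)
    qed
  qed
qed

text \<open>This is how connectedness of the surface enters. It will identify 2-cycles, and also
  boundaries of paths, up to a constant.\<close>

lemma prim_const:
  assumes "prim M v" "prim M w"
    and "\<And>v. prim M v \<Longrightarrow> f (S2 \<cdot> v) = f v" "\<And>v. prim M v \<Longrightarrow> f (U2 \<cdot> v) = f v"
    and "\<And>v w. prim M v \<Longrightarrow> prim M w \<Longrightarrow> eqv M v w \<Longrightarrow> f v = f w"
  shows "f v = f w"
proof -
  have "f v = f (1, 0)" if "prim M v" for v
    using that by (rule prim_induct[where Q = "\<lambda>v. f v = f (1, 0)"]) (use assms(3-5) in metis)+
  then show ?thesis using assms(1,2) by metis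
qed

definition proj_fun :: "nat \<Rightarrow> (int \<times> int \<Rightarrow> 'a) \<Rightarrow> bool"
  where "proj_fun M f \<longleftrightarrow> (\<forall>v w. prim M v \<and> prim M w \<and> eqv M v w \<longrightarrow> f v = f w)"

definition proj_ker :: "nat \<Rightarrow> (int \<times> int \<Rightarrow> int \<times> int \<Rightarrow> 'a) \<Rightarrow> bool"
  where "proj_ker M k \<longleftrightarrow> (\<forall>v v' w w'. prim M v \<and> prim M v' \<and> prim M w \<and> prim M w' \<and>
    eqv M v v' \<and> eqv M w w' \<longrightarrow> k v w = k v' w')"

lemma proj_funD: "proj_fun M f \<Longrightarrow> prim M v \<Longrightarrow> prim M w \<Longrightarrow> eqv M v w \<Longrightarrow> f v = f w"
  unfolding proj_fun_def by blast

lemma proj_kerD: "proj_ker M k \<Longrightarrow> prim M v \<Longrightarrow> prim M v' \<Longrightarrow> prim M w \<Longrightarrow> prim M w' \<Longrightarrow>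
    eqv M v v' \<Longrightarrow> eqv M w w' \<Longrightarrow> k v w = k v' w'"
  unfolding proj_ker_def by blast

lemma proj_ker_diag:
  assumes "proj_ker M k" "coprime (det2 g) (int M)" "coprime (det2 h) (int M)"
  shows "proj_fun M (\<lambda>p. k (g \<cdot> p) (h \<cdot> p))"
  unfolding proj_fun_def using assms by (blast intro: proj_kerD prim_app eqv_app)

definition delta :: "nat \<Rightarrow> int \<times> int \<Rightarrow> int \<times> int \<Rightarrow> real"
  where "delta M v w = of_bool (eqv M v w)"

lemma eqv_cong:
  assumes "prim M v" "prim M v'" "prim M w" "prim M w'" "eqv M v v'" "eqv M w w'"
  shows "eqv M v w \<longleftrightarrow> eqv M v' w'"
proof
  assume "eqv M v w"
  then show "eqv M v' w'"
    by (rule eqv_trans[OF eqv_trans[OF eqv_sym[OF assms(5)] _ assms(1)] assms(6,3)])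
next
  assume "eqv M v' w'"
  then show "eqv M v w"
    by (rule eqv_trans[OF eqv_trans[OF assms(5) _ assms(2)] eqv_sym[OF assms(6)] assms(4)])
qed

lemma proj_ker_delta: "proj_ker M (delta M)"
  unfolding proj_ker_def delta_def
  by (intro allI impI, elim conjE, rule arg_cong[where f = of_bool], rule eqv_cong)

section \<open>Sums over the projective line and the trace pairing\<close>

locale proj_line =
  fixes M N :: nat and P :: "(int \<times> int) set"
  assumes M_pos: "M > 0" and N_pos: "N > 0" and coprime_NM: "coprime N M"
    and finite_P: "finite P" and P_prim: "\<And>p. p \<in> P \<Longrightarrow> prim M p"
    and P_unique: "\<And>p q. p \<in> P \<Longrightarrow> q \<in> P \<Longrightarrow> eqv M p q \<Longrightarrow> p = q"
    and P_ex: "\<And>v. prim M v \<Longrightarrow> \<exists>p\<in>P. eqv M v p"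
begin

lemma coprime_det:
  "m \<in> mats (int N) \<Longrightarrow> coprime (det2 m) (int M)" "g \<in> mats 1 \<Longrightarrow> coprime (det2 g) (int M)"
  using coprime_NM by (simp_all add: mats_def)

lemma prim_app_N: "m \<in> mats (int N) \<Longrightarrow> prim M v \<Longrightarrow> prim M (m \<cdot> v)"
  by (rule prim_app) (simp_all add: coprime_det)

lemma sum_reindex_proj:
  assumes "coprime (det2 m) (int M)" "proj_fun M f"
  shows "(\<Sum>p\<in>P. f (m \<cdot> p)) = (\<Sum>p\<in>P. f p)"
proof -
  define h where "h p = (SOME q. q \<in> P \<and> eqv M (m \<cdot> p) q)" for p
  have h: "h p \<in> P" "eqv M (m \<cdot> p) (h p)" if "p \<in> P" for p
    using someI_ex[of "\<lambda>q. q \<in> P \<and> eqv M (m \<cdot> p) q"] P_ex[OF prim_app[OF assms(1) P_prim[OF that]]]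
    by (auto simp: h_def)
  have "inj_on h P"
  proof (rule inj_onI)
    fix p q assume pq: "p \<in> P" "q \<in> P" "h p = h q"
    then have "eqv M (m \<cdot> p) (m \<cdot> q)"
      using h[of p] h[of q] P_prim by (metis eqv_sym eqv_trans)
    then show "p = q" using pq P_unique assms(1) by (simp add: eqv_app_iff)
  qed
  moreover have "h ` P \<subseteq> P" using h by blast
  ultimately have bij: "bij_betw h P P"
    by (simp add: bij_betw_def endo_inj_surj finite_P)
  have "(\<Sum>p\<in>P. f (m \<cdot> p)) = (\<Sum>p\<in>P. f (h p))"
  proof (rule sum.cong[OF refl])
    fix p assume p: "p \<in> P"
    show "f (m \<cdot> p) = f (h p)"
      by (rule proj_funD[OF assms(2) prim_app[OF assms(1) P_prim[OF p]] P_prim[OF h(1)[OF p]] h(2)[OF p]])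
  qed
  also have "\<dots> = (\<Sum>p\<in>P. f p)" by (rule sum.reindex_bij_betw[OF bij])
  finally show ?thesis .
qed

lemma sum_delta:
  assumes "prim M v"
  shows "(\<Sum>p\<in>P. delta M p v) = 1"
proof -
  obtain q where q: "q \<in> P" "eqv M v q" using P_ex[OF assms] by blast
  have "eqv M p v \<longleftrightarrow> p = q" if "p \<in> P" for p
    using q P_unique[OF that q(1)] assms P_prim[OF that] P_prim[OF q(1)]
    by (metis eqv_sym eqv_trans)
  then have "(\<Sum>p\<in>P. delta M p v) = (\<Sum>p\<in>P. of_bool (p = q))"
    by (intro sum.cong) (auto simp: delta_def)
  also have "\<dots> = 1" using q finite_P by (simp add: of_bool_def)
  finally show ?thesis .
qed

text \<open>The trace of the operator with kernel k combined with the correspondence that weights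
  each m by c. \<open>infsum\<close> is 0 on families that are not summable, so additivity is stated
  for finitely supported c.\<close>

definition pair :: "(mat2 \<Rightarrow> real) \<Rightarrow> (int \<times> int \<Rightarrow> int \<times> int \<Rightarrow> real) \<Rightarrow> real"
  where "pair c k = infsum (\<lambda>m. c m * (\<Sum>p\<in>P. k p (m \<cdot> p))) (mats (int N))"

abbreviation fs :: "(mat2 \<Rightarrow> real) \<Rightarrow> bool"
  where "fs \<equiv> fin_supp (int N)"

lemma pair_cong:
  assumes "\<And>m. m \<in> mats (int N) \<Longrightarrow> c m = c' m" "\<And>p q. prim M p \<Longrightarrow> prim M q \<Longrightarrow> k p q = k' p q"
  shows "pair c k = pair c' k'"
  unfolding pair_def by (intro infsum_cong arg_cong2[of _ _ _ _ "(*)"] sum.cong assms refl P_prim prim_app_N)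

lemma pair_add: "fs c \<Longrightarrow> fs c' \<Longrightarrow> pair (\<lambda>m. c m + c' m) k = pair c k + pair c' k"
  unfolding pair_def distrib_right
  by (intro infsum_add fin_supp_summable fin_supp_mult)

lemma pair_scale: "pair (\<lambda>m. r * c m) k = r * pair c k"
  unfolding pair_def mult.assoc by (rule infsum_cmult_right')

lemma pair_minus: "pair (\<lambda>m. - c m) k = - pair c k"
  using pair_scale[of "-1" c k] by simp

lemma pair_diff: "fs c \<Longrightarrow> fs c' \<Longrightarrow> pair (\<lambda>m. c m - c' m) k = pair c k - pair c' k"
  using pair_add[of c "\<lambda>m. - c' m" k] fin_supp_mult[of "int N" c' "\<lambda>_. -1"] by (simp add: pair_minus)

lemma pair_ker_add: "fs c \<Longrightarrow> pair c (\<lambda>p q. k p q + k' p q) = pair c k + pair c k'"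
  unfolding pair_def sum.distrib distrib_left
  by (intro infsum_add fin_supp_summable fin_supp_mult)

lemma pair_ker_minus: "pair c (\<lambda>p q. - k p q) = - pair c k"
  unfolding pair_def by (simp add: sum_negf infsum_uminus)

lemma pair_ker_diff: "fs c \<Longrightarrow> pair c (\<lambda>p q. k p q - k' p q) = pair c k - pair c k'"
  using pair_ker_add[of c k "\<lambda>p q. - k' p q"] by (simp add: pair_ker_minus)

lemma pair_left:
  assumes "g \<in> mats 1"
  shows "pair (\<lambda>m. c (g \<odot> m)) k = pair c (\<lambda>p q. k p (adj2 g \<cdot> q))"
  unfolding pair_def
  by (subst infsum_reindex_bij_betw[OF bij_betw_mult_left[OF assms], symmetric])
     (simp add: mat2_app_mult adj2_app_cancel assms)

text \<open>Besides m, the point p has to be replaced by g p. This permutes the classes of the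
  projective line, so k must depend on classes only.\<close>

lemma pair_right:
  assumes "g \<in> mats 1" "proj_ker M k"
  shows "pair (\<lambda>m. c (m \<odot> g)) k = pair c (\<lambda>p q. k (g \<cdot> p) q)"
proof -
  have "(\<Sum>p\<in>P. k p (m \<cdot> p)) = (\<Sum>p\<in>P. k (g \<cdot> p) ((m \<odot> g) \<cdot> p))" if "m \<in> mats (int N)" for m
    unfolding mat2_app_mult
    by (rule sum_reindex_proj[where f = "\<lambda>p. k p (m \<cdot> p)", symmetric])
       (use that assms proj_ker_diag[OF assms(2), of "(1, 0, 0, 1)" m] in \<open>simp_all add: coprime_det\<close>)
  then show ?thesis
    unfolding pair_def
    by (subst infsum_reindex_bij_betw[OF bij_betw_mult_right[OF assms(1)], symmetric])
       (simp cong: infsum_cong)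
qed

end

section \<open>The trace computation in genus zero\<close>

lemma adj2_adj2 [simp]: "adj2 (adj2 g) = g"
  by (cases g) simp

lemma proj_ker_app:
  assumes "proj_ker M k" "g \<in> mats 1" "h \<in> mats 1"
  shows "proj_ker M (\<lambda>p q. k (g \<cdot> p) (h \<cdot> q))"
  unfolding proj_ker_def
  by (intro allI impI, elim conjE, rule proj_kerD[OF assms(1)]) (use assms in \<open>simp_all add: prim_SL eqv_app\<close>)

lemma delta_app: "coprime (det2 g) (int M) \<Longrightarrow> delta M (g \<cdot> p) (g \<cdot> q) = delta M p q"
  by (simp add: delta_def eqv_app_iff)

lemma sum_factor_pairs_swap: "(\<Sum>(a, d)\<in>factor_pairs N. f a d) = (\<Sum>(a, d)\<in>factor_pairs N. f d a)"
  by (rule sum.reindex_bij_witness[of _ prod.swap prod.swap]) (auto simp: factor_pairs_def mult.commute)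

text \<open>The factor 2 accounts for m and -m: up to this sign, an upper triangular matrix of
  determinant N is given by a pair in \<open>factor_pairs N\<close> and the entry b.\<close>

lemma infsum_upper:
  fixes F :: "mat2 \<Rightarrow> real"
  assumes N: "N > 0"
    and even: "\<And>a b c d. (a, b, c, d) \<in> mats (int N) \<Longrightarrow> F (- a, - b, - c, - d) = F (a, b, c, d)"
    and upper: "\<And>a b c d. c \<noteq> 0 \<Longrightarrow> F (a, b, c, d) = 0"
    and fin: "\<And>a d. finite (B a d)"
    and supp: "\<And>a d b. (a, d) \<in> factor_pairs N \<Longrightarrow> F (int a, b, 0, int d) \<noteq> 0 \<Longrightarrow> b \<in> B a d"
  shows "fin_supp (int N) F"
    and "infsum F (mats (int N)) = 2 * (\<Sum>(a, d)\<in>factor_pairs N. \<Sum>b\<in>B a d. F (int a, b, 0, int d))"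
proof -
  define I where "I = (SIGMA (a, d):factor_pairs N. B a d \<times> {-1, 1::int})"
  define h where "h = (\<lambda>((a, d), b, s). (s * int a, s * b, 0::int, s * int d))"
  have finI: "finite I" unfolding I_def by (auto intro!: finite_SigmaI finite_factor_pairs N fin)
  have sub: "h ` I \<subseteq> mats (int N)" by (auto simp: h_def I_def mats_def factor_pairs_def)
  have inj: "inj_on h I" by (auto simp: inj_on_def h_def I_def factor_pairs_def)
  have Fh: "F (h ((a, d), b, s)) = F (int a, b, 0, int d)"
    if "(a, d) \<in> factor_pairs N" "s \<in> {-1, 1}" for a d b s
    using that even[of "int a" b 0 "int d"] by (auto simp: h_def mats_def factor_pairs_def)
  have mem: "m \<in> h ` I" if m: "m \<in> mats (int N)" "F m \<noteq> 0" for m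
  proof -
    obtain a b c d where m': "m = (a, b, c, d)" by (cases m)
    then have "c = 0" using upper m(2) by blast
    then have ad: "a * d = int N" using m(1) by (simp add: m' mats_def)
    then consider "a > 0" "d > 0" | "- a > 0" "- d > 0" using N zero_less_mult_iff[of a d] by auto
    then obtain a' d' b' s where *: "(a', d') \<in> factor_pairs N" "s \<in> {-1, 1}" "m = h ((a', d'), b', s)"
    proof cases
      case 1
      then show thesis using that[of "nat a" "nat d" 1 b] ad
        by (auto simp: m' \<open>c = 0\<close> h_def factor_pairs_def simp flip: nat_mult_distrib)
    next
      case 2
      then show thesis using that[of "nat (- a)" "nat (- d)" "-1" "- b"] ad
        by (auto simp: m' \<open>c = 0\<close> h_def factor_pairs_def simp flip: nat_mult_distrib)
    qed
    moreover have "b' \<in> B a' d'" using supp[OF *(1), of b'] Fh[OF *(1,2)] m(2) *(3) by simp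
    ultimately show ?thesis by (auto simp: I_def)
  qed
  show "fin_supp (int N) F"
    unfolding fin_supp_def by (rule finite_subset[OF _ finite_imageI[OF finI]]) (use mem in auto)
  have "infsum F (mats (int N)) = infsum F (h ` I)"
    by (rule infsum_cong_neutral) (use mem sub in auto)
  also have "\<dots> = (\<Sum>(x, y)\<in>I. F (h (x, y)))" by (simp add: finI sum.reindex[OF inj] split_def)
  also have "\<dots> = (\<Sum>x\<in>factor_pairs N. \<Sum>y\<in>(case x of (a, d) \<Rightarrow> B a d \<times> {-1, 1}). F (h (x, y)))"
    unfolding I_def by (rule sum.Sigma[symmetric]) (auto simp: finite_factor_pairs N fin)
  also have "\<dots> = (\<Sum>(a, d)\<in>factor_pairs N. 2 * (\<Sum>b\<in>B a d. F (int a, b, 0, int d)))"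
  proof (rule sum.cong[OF refl])
    fix x assume x: "x \<in> factor_pairs N"
    obtain a d where x': "x = (a, d)" by (cases x)
    have "(\<Sum>y\<in>B a d \<times> {-1, 1}. F (h ((a, d), y))) = (\<Sum>(b, s)\<in>B a d \<times> {-1, 1::int}. F (int a, b, 0, int d))"
      by (rule sum.cong) (use Fh x in \<open>auto simp: x'\<close>)
    then show "(\<Sum>y\<in>(case x of (a, d) \<Rightarrow> B a d \<times> {-1, 1}). F (h (x, y))) =
        (case x of (a, d) \<Rightarrow> 2 * (\<Sum>b\<in>B a d. F (int a, b, 0, int d)))"
      by (simp add: x' sum.cartesian_product[symmetric] sum_distrib_left)
  qed
  finally show "infsum F (mats (int N)) = 2 * (\<Sum>(a, d)\<in>factor_pairs N. \<Sum>b\<in>B a d. F (int a, b, 0, int d))"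
    by (simp add: sum_distrib_left split_def)
qed

lemma wt_upper_window:
  assumes "(a, d) \<in> factor_pairs N"
  shows "wt_upper (int a, b, 0, int d) = hs (- b) - hs (- b - int d)"
proof -
  have "int a > 0" using assms by (simp add: factor_pairs_def)
  then have "hs (int a * x) = hs x" for x
    by (intro hs_cong) (auto simp: zero_less_mult_iff)
  from this[of "- b"] this[of "- b - int d"] show ?thesis by (simp add: algebra_simps)
qed

lemma wt_upper_support:
  assumes "(a, d) \<in> factor_pairs N" "wt_upper (int a, b, 0, int d) \<noteq> 0"
  shows "b \<in> {- int d..0}"
  using assms(2) unfolding wt_upper_window[OF assms(1)] by (auto simp: hs_def split: if_splits)

lemma fin_supp_wt_upper:
  assumes "N > 0"
  shows "fin_supp (int N) wt_upper"
proof (rule infsum_upper(1)[where B = "\<lambda>a d. {- int d..0}", OF assms])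
  show "wt_upper (- a, - b, - c, - d) = wt_upper (a, b, c, d)" for a b c d
    by (simp add: algebra_simps)
qed (simp_all add: wt_upper_support del: atLeastAtMost_iff wt_upper.simps, simp)

section \<open>Conjugation, shears and cusps\<close>

context proj_line
begin

lemma pair_conj:
  assumes "g \<in> mats 1"
  shows "pair (\<lambda>m. c (adj2 g \<odot> m \<odot> g)) (delta M) = pair c (delta M)"
proof -
  have "pair (\<lambda>m. c (adj2 g \<odot> m \<odot> g)) (delta M) = pair (\<lambda>m. c (m \<odot> g)) (\<lambda>p q. delta M p (g \<cdot> q))"
    using pair_left[of "adj2 g" "\<lambda>m. c (m \<odot> g)" "delta M"] assms by simp
  also have "\<dots> = pair c (\<lambda>p q. delta M (g \<cdot> p) (g \<cdot> q))"
    by (rule pair_right) (use proj_ker_app[OF proj_ker_delta, of "(1, 0, 0, 1)" g] assms in simp_all)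
  also have "\<dots> = pair c (delta M)"
    using assms by (simp add: delta_app coprime_det)
  finally show ?thesis .
qed

lemma pair_conjU: "pair (\<lambda>m. c (conjU m)) (delta M) = pair c (delta M)"
  unfolding conjU_def by (rule pair_conj) simp

text \<open>Pairing with \<open>delta M\<close> is invariant under conjugation, so the three terms
  \<open>wt_diff\<close> in \<open>wt2\<close> contribute equally, and so do the two in
  \<open>wt1\<close>. Divided by 6, the relation weighs triangles by 1/3 and edges by 1/2, the
  inverse orders of \<open>U2\<close> and \<open>S2\<close> up to sign.\<close>

lemma pair_wt_fix: "2 * pair wt_fix (delta M) = 2 * pair wt2 (delta M) - 3 * pair wt1 (delta M)"
proof -
  have fd: "fs wt_diff" using fin_supp_wt_side[of "int N"] N_pos by (simp add: wt_diff_def[abs_def])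
  have fd1: "fs (\<lambda>m. wt_diff (conjU m))" by (rule fin_supp_reindex[OF fd bij_betw_conjU])
  have fd2: "fs (\<lambda>m. wt_diff (conjU (conjU m)))" by (rule fin_supp_reindex[OF fd1 bij_betw_conjU])
  have "pair wt2 (delta M) = pair (\<lambda>m. wt_diff m + wt_diff (conjU m) + wt_diff (conjU (conjU m)) + wt_fix m) (delta M)"
    by (rule pair_cong) (simp_all add: wt2_eq_wt_fix)
  also have "\<dots> = 3 * pair wt_diff (delta M) + pair wt_fix (delta M)"
    by (simp add: pair_add fin_supp_add fd fd1 fd2 fin_supp_wt_fix N_pos pair_conjU
        pair_conjU[of "\<lambda>m. wt_diff (conjU m)"])
  finally have 2: "pair wt2 (delta M) = 3 * pair wt_diff (delta M) + pair wt_fix (delta M)" .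
  have "bij_betw (\<lambda>m. adj2 S2 \<odot> m \<odot> S2) (mats (int N)) (mats (int N))"
    by (rule bij_betw_trans[OF bij_betw_mult_left[of "adj2 S2"] bij_betw_mult_right[of S2], unfolded o_def]) simp_all
  then have fd3: "fs (\<lambda>m. wt_diff (adj2 S2 \<odot> m \<odot> S2))" by (rule fin_supp_reindex[OF fd])
  have "pair wt1 (delta M) = pair (\<lambda>m. wt_diff m + wt_diff (adj2 S2 \<odot> m \<odot> S2)) (delta M)"
    by (rule pair_cong) (use N_pos wt1_eq_wt_diff in \<open>simp_all add: mats_def\<close>)
  also have "\<dots> = 2 * pair wt_diff (delta M)"
    by (simp add: pair_add fd fd3 pair_conj)
  finally show ?thesis using 2 by simp
qed

text \<open>Modulo M the entry d is invertible, and k = b/d.\<close>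

lemma shear_exists:
  assumes "a * d = int N"
  shows "\<exists>k. \<forall>p. eqv M ((a, b, 0, d) \<cdot> p) ((1, k, 0, 1) \<cdot> (a, 0, 0, d) \<cdot> p)"
proof -
  have "coprime d (int M)" using coprime_NM assms
    by (metis coprime_int_iff coprime_mult_left_iff)
  then obtain e where e: "[d * e = 1] (mod int M)" using cong_solve_coprime_int by blast
  have M: "int M dvd b - e * b * d"
  proof -
    have "b - e * b * d = - b * (d * e - 1)" by (simp add: algebra_simps)
    then show ?thesis using e by (simp add: cong_iff_dvd_diff)
  qed
  have "eqv M ((a, b, 0, d) \<cdot> p) ((1, e * b, 0, 1) \<cdot> (a, 0, 0, d) \<cdot> p)" for p
  proof -
    obtain x y where p: "p = (x, y)" by (cases p)
    have "wedge ((a, b, 0, d) \<cdot> p) ((1, e * b, 0, 1) \<cdot> (a, 0, 0, d) \<cdot> p) = d * y * y * (b - e * b * d)"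
      by (simp add: p wedge_def algebra_simps)
    then show ?thesis using M by (simp add: eqv_def)
  qed
  then show ?thesis by blast
qed

definition cusp_count :: "int \<times> int \<Rightarrow> int \<times> int \<Rightarrow> real"
  where "cusp_count p q = (\<Sum>k<M. delta M ((1, int k, 0, 1) \<cdot> p) q)"

text \<open>The inner sum vanishes unless \<open>diag(a, d)\<close> fixes the cusp of \<open>p\<close>, and the \<open>h\<close> elements of a
  fixed cusp of width \<open>h\<close> contribute \<open>M/h\<close> each.\<close>

definition fixed_cusps :: "nat \<Rightarrow> nat \<Rightarrow> real"
  where "fixed_cusps a d = (\<Sum>p\<in>P. cusp_count p ((int a, 0, 0, int d) \<cdot> p)) / real M"

lemma sum_cusp_count: "prim M q \<Longrightarrow> (\<Sum>p\<in>P. cusp_count p q) = real M"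
proof -
  assume q: "prim M q"
  have "(\<Sum>p\<in>P. cusp_count p q) = (\<Sum>k<M. \<Sum>p\<in>P. delta M ((1, int k, 0, 1) \<cdot> p) q)"
    unfolding cusp_count_def by (rule sum.swap)
  also have "\<dots> = (\<Sum>k<M. 1)"
  proof (rule sum.cong[OF refl])
    fix k
    have "(\<Sum>p\<in>P. delta M ((1, int k, 0, 1) \<cdot> p) q) = (\<Sum>p\<in>P. delta M p q)"
      by (rule sum_reindex_proj[where f = "\<lambda>p. delta M p q"])
         (auto simp: proj_fun_def intro!: proj_kerD[OF proj_ker_delta] q)
    then show "(\<Sum>p\<in>P. delta M ((1, int k, 0, 1) \<cdot> p) q) = 1" using sum_delta[OF q] by simp
  qed
  finally show ?thesis by simp
qed

end

text \<open>The edges and triangles of the Farey tessellation modulo \<open>\<Gamma>\<^sub>0(M)\<close> are the orbits of \<open>S2\<close> and \<open>U2\<close>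
  on \<open>P\<close>.  On a sphere each edge \<open>q\<close> is the sum of the difference of the paths \<open>X _ q\<close> to its end
  points, which depend only on the cusps, and the boundary of a chain \<open>Y _ q\<close> of triangles.\<close>

locale genus_zero = proj_line +
  fixes X Y :: "int \<times> int \<Rightarrow> int \<times> int \<Rightarrow> real" and p0 q0 :: "int \<times> int"
  assumes X_ker: "proj_ker M X" and Y_ker: "proj_ker M Y"
    and X_T2: "\<And>p q. prim M p \<Longrightarrow> prim M q \<Longrightarrow> X p (T2 \<cdot> q) = X p q"
    and X_S2: "\<And>p q. prim M p \<Longrightarrow> prim M q \<Longrightarrow> X (S2 \<cdot> p) q = - X p q"
    and Y_U2: "\<And>p q. prim M p \<Longrightarrow> prim M q \<Longrightarrow> Y (U2 \<cdot> p) q = Y p q"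
    and Y_S2: "\<And>p q. prim M p \<Longrightarrow> prim M q \<Longrightarrow> Y p (S2 \<cdot> q) = - Y p q"
    and delta_decomp: "\<And>p q. prim M p \<Longrightarrow> prim M q \<Longrightarrow>
      delta M p q - delta M (S2 \<cdot> p) q = X p q - X p (S2 \<cdot> q) + (Y p q - Y (S2 \<cdot> p) q)"
    and p0: "prim M p0" "\<And>q. prim M q \<Longrightarrow> Y p0 q = 0"
    and q0: "prim M q0" "\<And>p. prim M p \<Longrightarrow> X p q0 = 0"
begin

lemma X_shear:
  assumes "prim M p" "prim M q"
  shows "X p ((1, k, 0, 1) \<cdot> q) = X p q"
proof (induction k rule: int_induct[where k = 0])
  case base
  then show ?case by simp
next
  case (step1 i)
  have "T2 \<cdot> (1, i, 0, 1) \<cdot> q = (1, i + 1, 0, 1) \<cdot> q"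
    by (cases q) (simp add: T2_def algebra_simps)
  then show ?case using X_T2[of p "(1, i, 0, 1) \<cdot> q"] assms step1(2) by (simp add: prim_SL)
next
  case (step2 i)
  have "T2 \<cdot> (1, i - 1, 0, 1) \<cdot> q = (1, i, 0, 1) \<cdot> q"
    by (cases q) (simp add: T2_def algebra_simps)
  then show ?case using X_T2[of p "(1, i - 1, 0, 1) \<cdot> q"] assms step2(2) by (simp add: prim_SL)
qed

text \<open>Modulo M the entry b only contributes a shear, which does not change the cusp of the
  second argument.\<close>

lemma X_upper:
  assumes "prim M p" "prim M q" "a * d = int N"
  shows "X p ((a, b, 0, d) \<cdot> q) = X p ((a, 0, 0, d) \<cdot> q)"
proof -
  obtain k where k: "eqv M ((a, b, 0, d) \<cdot> q) ((1, k, 0, 1) \<cdot> (a, 0, 0, d) \<cdot> q)"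
    using shear_exists[OF assms(3)] by blast
  have m: "(a, b, 0, d) \<in> mats (int N)" "(a, 0, 0, d) \<in> mats (int N)" using assms(3) by (simp_all add: mats_def)
  have pr: "prim M ((a, b, 0, d) \<cdot> q)" "prim M ((a, 0, 0, d) \<cdot> q)"
    using m assms(2) by (auto intro: prim_app_N simp del: mat2_app.simps)
  have "X p ((a, b, 0, d) \<cdot> q) = X p ((1, k, 0, 1) \<cdot> (a, 0, 0, d) \<cdot> q)"
    by (rule proj_kerD[OF X_ker assms(1,1) pr(1) prim_SL[OF shear_in pr(2)] eqv_refl k])
  also have "\<dots> = X p ((a, 0, 0, d) \<cdot> q)" by (rule X_shear[OF assms(1) pr(2)])
  finally show ?thesis .
qed

lemma cong_X: "prim M p \<Longrightarrow> prim M p' \<Longrightarrow> prim M q \<Longrightarrow> prim M q' \<Longrightarrow> eqv M p p' \<Longrightarrow> eqv M q q' \<Longrightarrow> X p q = X p' q'"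
  and cong_Y: "prim M p \<Longrightarrow> prim M p' \<Longrightarrow> prim M q \<Longrightarrow> prim M q' \<Longrightarrow> eqv M p p' \<Longrightarrow> eqv M q q' \<Longrightarrow> Y p q = Y p' q'"
  and cong_delta: "prim M p \<Longrightarrow> prim M p' \<Longrightarrow> prim M q \<Longrightarrow> prim M q' \<Longrightarrow> eqv M p p' \<Longrightarrow> eqv M q q' \<Longrightarrow> delta M p q = delta M p' q'"
  using proj_kerD[OF X_ker] proj_kerD[OF Y_ker] proj_kerD[OF proj_ker_delta] by blast+

lemma Y_adj_S2: "prim M p \<Longrightarrow> prim M q \<Longrightarrow> Y p (adj2 S2 \<cdot> q) = - Y p q"
  using cong_Y[OF _ _ _ _ eqv_refl eqv_adj_S2, of p q] Y_S2[of p q] by (simp add: prim_SL)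

lemma X_adj_T2: "prim M p \<Longrightarrow> prim M q \<Longrightarrow> X p (adj2 T2 \<cdot> q) = X p q"
  using X_T2[of p "adj2 T2 \<cdot> q"] by (simp add: prim_SL adj2_app_cancel)

text \<open>\<open>wt1\<close> is odd under \<open>S2\<close> on either side, so pairing it with the
  antisymmetrized identity \<open>delta_decomp\<close> doubles each of the three terms.\<close>

lemma pair_wt1_split: "pair wt1 (delta M) = pair wt1 X + pair wt1 Y"
proof -
  have fs: "fs wt1" using fin_supp_wt1[of "int N"] N_pos by simp
  have S: "pair wt1 (\<lambda>p q. k (S2 \<cdot> p) q) = - pair wt1 k" if "proj_ker M k" for k
    using pair_right[OF S2_in that, of wt1] by (simp add: wt1_mult_S2 pair_minus)
  have "2 * pair wt1 (delta M) = pair wt1 (\<lambda>p q. delta M p q - delta M (S2 \<cdot> p) q)"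
    using S[OF proj_ker_delta] by (simp add: pair_ker_diff fs)
  also have "\<dots> = pair wt1 (\<lambda>p q. X p q - X p (S2 \<cdot> q) + (Y p q - Y (S2 \<cdot> p) q))"
    by (rule pair_cong) (simp_all add: delta_decomp)
  also have "\<dots> = pair wt1 X - pair wt1 (\<lambda>p q. X p (S2 \<cdot> q)) + 2 * pair wt1 Y"
    using S[OF Y_ker] by (simp add: pair_ker_add pair_ker_diff fs)
  also have "pair wt1 (\<lambda>p q. X p (S2 \<cdot> q)) = pair (\<lambda>m. wt1 (adj2 S2 \<odot> m)) X"
    using pair_left[of "adj2 S2" wt1 X] by simp
  also have "\<dots> = - pair wt1 X"
  proof -
    have "wt1 (adj2 S2 \<odot> m) = - wt1 m" for m
      using wt1_S2[of "adj2 S2 \<odot> m"] by (simp add: adj2_cancel)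
    then show ?thesis by (simp add: pair_minus)
  qed
  finally show ?thesis by simp
qed

lemma pair_U2_invariant:
  assumes "proj_ker M k" "\<And>p q. prim M p \<Longrightarrow> prim M q \<Longrightarrow> k (U2 \<cdot> p) q = k p q"
  shows "pair (\<lambda>m. c (m \<odot> U2)) k = pair c k" "pair (\<lambda>m. c (m \<odot> U2 \<odot> U2)) k = pair c k"
proof -
  have *: "pair (\<lambda>m. c (m \<odot> U2)) k = pair c k" for c
    unfolding pair_right[OF U2_in assms(1)] by (rule pair_cong) (simp_all add: assms)
  show "pair (\<lambda>m. c (m \<odot> U2)) k = pair c k" by (rule *)
  show "pair (\<lambda>m. c (m \<odot> U2 \<odot> U2)) k = pair c k"
    using *[of "\<lambda>m. c (m \<odot> U2)"] *[of c] by simp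
qed

lemma fs_mult_right: "fs c \<Longrightarrow> g \<in> mats 1 \<Longrightarrow> fs (\<lambda>m. c (m \<odot> g))"
  by (rule fin_supp_reindex[OF _ bij_betw_mult_right])

lemma fs_mult_left: "fs c \<Longrightarrow> g \<in> mats 1 \<Longrightarrow> fs (\<lambda>m. c (g \<odot> m))"
  by (rule fin_supp_reindex[OF _ bij_betw_mult_left])

text \<open>Invariance of Y under \<open>U2\<close> replaces \<open>wt1\<close> by its sum over the
  edges of a triangle, the chain map property turns this into a difference of \<open>wt2\<close>,
  and oddness of Y under \<open>S2\<close> doubles it.\<close>

lemma pair_wt1_Y: "3 * pair wt1 Y = 2 * pair wt2 Y"
proof -
  have fs1: "fs wt1" using fin_supp_wt1[of "int N"] N_pos by simp
  have fs2: "fs wt2" using infsum_wt2(1)[OF N_pos] .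
  have "3 * pair wt1 Y = pair (\<lambda>m. wt1 m + wt1 (m \<odot> U2) + wt1 (m \<odot> U2 \<odot> U2)) Y"
    using fs1 fs_mult_right[OF fs_mult_right[OF fs1 U2_in] U2_in]
    by (simp add: pair_add fin_supp_add fs_mult_right pair_U2_invariant[OF Y_ker Y_U2])
  also have "\<dots> = pair wt2 Y - pair (\<lambda>m. wt2 (S2 \<odot> m)) Y"
    unfolding wt2_diff_S2[symmetric] by (simp add: pair_diff fs2 fs_mult_left)
  also have "pair (\<lambda>m. wt2 (S2 \<odot> m)) Y = - pair wt2 Y"
    unfolding pair_left[OF S2_in] pair_ker_minus[symmetric]
    by (rule pair_cong) (simp_all add: Y_adj_S2)
  finally show ?thesis by simp
qed

text \<open>As a function of q, the indicator of the triangle of p0, with multiplicity 3 if that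
  triangle is folded by \<open>U2\<close>.\<close>

definition beta :: "int \<times> int \<Rightarrow> real"
  where "beta q = delta M p0 q + delta M p0 (U2 \<cdot> q) + delta M p0 (U2 \<cdot> U2 \<cdot> q)"

text \<open>Around the triangle of q the paths X cancel, so the triangle minus the chain Y has no
  boundary. Such a 2-cycle is constant, and the constant is read off at p0, where Y
  vanishes.\<close>

lemma Y_sum_U2:
  assumes "prim M p" "prim M q"
  shows "Y p q + Y p (U2 \<cdot> q) + Y p (U2 \<cdot> U2 \<cdot> q) =
    delta M p q + delta M p (U2 \<cdot> q) + delta M p (U2 \<cdot> U2 \<cdot> q) - beta q"
proof -
  let ?q1 = "U2 \<cdot> q" and ?q2 = "U2 \<cdot> U2 \<cdot> q"
  have pr: "prim M ?q1" "prim M ?q2" using assms by (simp_all add: prim_SL)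
  define f where "f p = (delta M p q + delta M p ?q1 + delta M p ?q2) - (Y p q + Y p ?q1 + Y p ?q2)" for p
  have XSU: "X v (S2 \<cdot> U2 \<cdot> w) = X v w" if "prim M v" "prim M w" for v w
    using cong_X[OF _ _ _ _ eqv_refl eqv_SU, of v w] X_adj_T2 that by (simp add: prim_SL)
  have XS: "X v (S2 \<cdot> q) = X v ?q2" if "prim M v" for v
  proof -
    have "X v (S2 \<cdot> U2 \<cdot> ?q2) = X v (S2 \<cdot> q)"
      by (rule cong_X) (use that pr assms in \<open>simp_all add: prim_SL eqv_app eqv_U2\<close>)
    then show ?thesis using XSU[OF that pr(2)] by simp
  qed
  have "f p = f p0"
  proof (rule prim_const[OF assms(1) p0(1)])
    fix v assume v: "prim M v"
    show "f (S2 \<cdot> v) = f v"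
      using delta_decomp[OF v assms(2)] delta_decomp[OF v pr(1)] delta_decomp[OF v pr(2)]
        XS[OF v] XSU[OF v assms(2)] XSU[OF v pr(1)]
      by (simp add: f_def)
    have U: "delta M (U2 \<cdot> v) (U2 \<cdot> w) = delta M v w" for w
      by (rule delta_app) (simp add: U2_def)
    have "delta M (U2 \<cdot> v) q = delta M v ?q2"
      unfolding U[of ?q2, symmetric]
      by (rule cong_delta) (use v pr assms in \<open>simp_all add: prim_SL eqv_U2 eqv_sym\<close>)
    then show "f (U2 \<cdot> v) = f v"
      using U[of q] U[of ?q1] v pr assms by (simp add: f_def Y_U2)
  next
    fix v w assume vw: "prim M v" "prim M w" "eqv M v w"
    have "delta M v z = delta M w z" "Y v z = Y w z" if "prim M z" for z
      using cong_delta[OF vw(1,2) that that vw(3) eqv_refl] cong_Y[OF vw(1,2) that that vw(3) eqv_refl]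
      by simp_all
    then show "f v = f w" using pr assms by (simp add: f_def)
  qed
  also have "f p0 = beta q" using p0 pr assms by (simp add: f_def beta_def)
  finally show ?thesis by (simp add: f_def)
qed

lemma sum_beta:
  assumes "m \<in> mats (int N)"
  shows "(\<Sum>p\<in>P. beta (m \<cdot> p)) = 3"
proof -
  have *: "(\<Sum>p\<in>P. delta M p0 (h \<cdot> p)) = 1" if h: "coprime (det2 h) (int M)" for h
  proof -
    have "(\<Sum>p\<in>P. delta M p0 (h \<cdot> p)) = (\<Sum>p\<in>P. delta M p0 p)"
      by (rule sum_reindex_proj[OF h]) (auto simp: proj_fun_def intro!: proj_kerD[OF proj_ker_delta] p0)
    also have "\<dots> = (\<Sum>p\<in>P. delta M p p0)" by (simp add: delta_def eqv_commute)
    finally show ?thesis by (simp add: sum_delta p0)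
  qed
  have c: "coprime (det2 m) (int M)" "coprime (det2 (U2 \<odot> m)) (int M)" "coprime (det2 (U2 \<odot> U2 \<odot> m)) (int M)"
    using coprime_det(1)[OF assms] by (simp_all add: det2_mult) (simp_all add: U2_def)
  show ?thesis
    using *[OF c(1)] *[OF c(2)] *[OF c(3)] by (simp add: beta_def sum.distrib mat2_app_mult)
qed

text \<open>For every m the kernel \<open>beta\<close> sums to 3, so it contributes three times the
  total mass 6 sigma(N) of \<open>wt2\<close>. This is the trace on homology in degree 2.\<close>

lemma pair_wt2_Y: "3 * pair wt2 Y = 3 * pair wt2 (delta M) - 18 * (\<Sum>(a, d)\<in>factor_pairs N. real a)"
proof -
  have fs2: "fs wt2" using infsum_wt2(1)[OF N_pos] .
  have U: "pair wt2 (\<lambda>p q. k p (U2 \<cdot> q)) = pair wt2 k" for k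
    using pair_left[of "adj2 U2" wt2 k] wt2_U2[of "adj2 U2 \<odot> _"] by (simp add: adj2_cancel)
  have UU: "pair wt2 (\<lambda>p q. k p (U2 \<cdot> U2 \<cdot> q)) = pair wt2 k" for k
    using U[of "\<lambda>p q. k p (U2 \<cdot> q)"] U[of k] by simp
  have "3 * pair wt2 Y = pair wt2 (\<lambda>p q. Y p q + Y p (U2 \<cdot> q) + Y p (U2 \<cdot> U2 \<cdot> q))"
    by (simp add: pair_ker_add fs2 U UU)
  also have "\<dots> = pair wt2 (\<lambda>p q. (delta M p q + delta M p (U2 \<cdot> q) + delta M p (U2 \<cdot> U2 \<cdot> q)) - beta q)"
    by (rule pair_cong) (simp_all add: Y_sum_U2)
  also have "\<dots> = 3 * pair wt2 (delta M) - pair wt2 (\<lambda>p q. beta q)"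
    by (simp add: pair_ker_add pair_ker_diff fs2 U UU)
  also have "pair wt2 (\<lambda>p q. beta q) = infsum (\<lambda>m. wt2 m * 3) (mats (int N))"
    unfolding pair_def by (rule infsum_cong) (simp add: sum_beta)
  also have "\<dots> = 18 * (\<Sum>(a, d)\<in>factor_pairs N. real a)"
    by (simp add: infsum_cmult_left' infsum_wt2(2)[OF N_pos])
  finally show ?thesis .
qed

end

section \<open>The contribution of the cusps\<close>

lemma sum_lessThan_cyclic:
  fixes f :: "nat \<Rightarrow> 'a::ab_group_add"
  assumes "f n = f 0"
  shows "(\<Sum>k<n. f (Suc k)) = (\<Sum>k<n. f k)"
proof -
  have "(\<Sum>k<n. f (Suc k)) + f 0 = (\<Sum>k<n. f k) + f n"
    by (metis sum.lessThan_Suc sum.lessThan_Suc_shift add.commute)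
  then show ?thesis using assms by simp
qed

text \<open>Each end of the window counts 1/2 and each of the d - 1 interior points counts
  1.\<close>

lemma sum_hs_window:
  assumes "d > 0"
  shows "(\<Sum>b\<in>{- int d..0}. hs (- b) - hs (- b - int d)) = real d"
proof -
  have "{- int d..0} = insert 0 (insert (- int d) {- int d<..<0})" using assms by auto
  then have "(\<Sum>b\<in>{- int d..0}. hs (- b) - hs (- b - int d)) =
      1 + (\<Sum>b\<in>{- int d<..<0}. hs (- b) - hs (- b - int d))"
    using assms by (simp add: hs_def)
  also have "(\<Sum>b\<in>{- int d<..<0}. hs (- b) - hs (- b - int d)) = (\<Sum>b\<in>{- int d<..<0}. 1)"
    by (rule sum.cong) (auto simp: hs_def)
  finally show ?thesis using assms by (simp add: of_nat_diff)
qed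

context genus_zero
begin

text \<open>X does not change under a translation of its second argument, so the finitely supported
  part e cancels against its translate. The two remaining terms agree because X is odd under
  \<open>S2\<close>.\<close>

lemma pair_wt1_X: "pair wt1 X = 2 * pair wt_upper X"
proof -
  define e where "e m = wt_u m - wt_cusp m" for m
  have n: "int N > 0" using N_pos by simp
  have fe: "fs e" using fin_supp_wt_cusp[OF n] by (simp add: e_def[abs_def])
  have fu: "fs wt_upper" by (rule fin_supp_wt_upper[OF N_pos])
  have "wt1 m = (e m - e (T2 \<odot> m)) + (wt_upper m - wt_upper (m \<odot> S2))" if "m \<in> mats (int N)" for m
    using wt_cusp_diff[OF that n] by (simp add: wt1_def e_def wt_u_S2_T2)
  then have "pair wt1 X = pair (\<lambda>m. (e m - e (T2 \<odot> m)) + (wt_upper m - wt_upper (m \<odot> S2))) X"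
    by (rule pair_cong) simp_all
  also have "\<dots> = pair e X - pair (\<lambda>m. e (T2 \<odot> m)) X + (pair wt_upper X - pair (\<lambda>m. wt_upper (m \<odot> S2)) X)"
    by (simp add: pair_add pair_diff fin_supp_diff fe fu fs_mult_left fs_mult_right)
  also have "pair (\<lambda>m. e (T2 \<odot> m)) X = pair e X"
    unfolding pair_left[OF T2_in] by (rule pair_cong) (simp_all add: X_adj_T2)
  also have "pair (\<lambda>m. wt_upper (m \<odot> S2)) X = - pair wt_upper X"
    unfolding pair_right[OF S2_in X_ker] pair_ker_minus[symmetric]
    by (rule pair_cong) (simp_all add: X_S2)
  finally show ?thesis by simp
qed

lemma pair_wt_upper:
  "pair wt_upper X = 2 * (\<Sum>(a, d)\<in>factor_pairs N. real d * (\<Sum>p\<in>P. X p ((int a, 0, 0, int d) \<cdot> p)))"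
proof -
  define F where "F m = wt_upper m * (\<Sum>p\<in>P. X p (m \<cdot> p))" for m
  have even: "F (- a, - b, - c, - d) = F (a, b, c, d)" if m: "(a, b, c, d) \<in> mats (int N)" for a b c d
  proof -
    have m': "(- a, - b, - c, - d) \<in> mats (int N)" using m by (simp add: mats_def)
    have "X p ((- a, - b, - c, - d) \<cdot> p) = X p ((a, b, c, d) \<cdot> p)" if p: "p \<in> P" for p
      by (rule cong_X[OF P_prim[OF p] P_prim[OF p] prim_app_N[OF m' P_prim[OF p]] prim_app_N[OF m P_prim[OF p]] eqv_refl])
         (cases p, simp add: eqv_def wedge_def algebra_simps)
    then show ?thesis by (simp add: F_def algebra_simps)
  qed
  have supp: "b \<in> {- int d..0}" if "(a, d) \<in> factor_pairs N" "F (int a, b, 0, int d) \<noteq> 0" for a d b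
    by (rule wt_upper_support[OF that(1)]) (use that(2) in \<open>auto simp: F_def\<close>)
  have "pair wt_upper X = 2 * (\<Sum>(a, d)\<in>factor_pairs N. \<Sum>b\<in>{- int d..0}. F (int a, b, 0, int d))"
    unfolding pair_def F_def[symmetric]
    by (rule infsum_upper(2)[OF N_pos even]) (use supp in \<open>auto simp: F_def\<close>)
  also have "\<dots> = 2 * (\<Sum>(a, d)\<in>factor_pairs N. real d * (\<Sum>p\<in>P. X p ((int a, 0, 0, int d) \<cdot> p)))"
  proof (rule arg_cong[where f = "(*) 2"], rule sum.cong[OF refl], clarify)
    fix a d assume ad: "(a, d) \<in> factor_pairs N"
    let ?x = "\<Sum>p\<in>P. X p ((int a, 0, 0, int d) \<cdot> p)"
    have N: "int a * int d = int N" "d > 0" using ad by (auto simp: factor_pairs_def)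
    have "F (int a, b, 0, int d) = (hs (- b) - hs (- b - int d)) * ?x" for b
      unfolding F_def wt_upper_window[OF ad]
      by (intro arg_cong2[where f = "(*)"] sum.cong refl X_upper P_prim N(1))
    then show "(\<Sum>b\<in>{- int d..0}. F (int a, b, 0, int d)) = real d * ?x"
      by (simp only: sum_distrib_right[symmetric] sum_hs_window[OF N(2)])
  qed
  finally show ?thesis .
qed

lemma shear_Suc: "(1, int (Suc k), 0, 1) \<cdot> p = T2 \<cdot> (1, int k, 0, 1) \<cdot> p"
  by (cases p) (simp add: T2_def algebra_simps)

lemma eqv_shear_M: "eqv M ((1, int M, 0, 1) \<cdot> p) p"
  by (cases p) (simp add: eqv_def wedge_def algebra_simps)

text \<open>At the cusp of p, the chain X _ q has the boundary coefficient of a path from the cusp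
  of q0 to the cusp of q. The difference G, as a function of q, is invariant under \<open>S2\<close>
  and \<open>T2\<close>, hence constant, and q = q0 gives its value.\<close>

lemma sum_X_shear:
  assumes "prim M p" "prim M q"
  shows "(\<Sum>k<M. X ((1, int k, 0, 1) \<cdot> p) q) = cusp_count p q - cusp_count p q0"
proof -
  let ?T = "\<lambda>k. (1, int k, 0, 1) \<cdot> p"
  have pT: "prim M (?T k)" for k using assms by (simp add: prim_SL)
  define G where "G q = cusp_count p q - (\<Sum>k<M. X (?T k) q)" for q
  have GS: "G (S2 \<cdot> v) = G v" if v: "prim M v" for v
  proof -
    \<comment> \<open>Consecutive edges at a cusp bound a common triangle, so the triangle terms
      cancel around the cusp.\<close>
    have Y1: "Y (S2 \<cdot> ?T k) v = Y (?T (Suc k)) v" for k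
    proof -
      have "Y (S2 \<cdot> ?T k) v = Y (U2 \<cdot> ?T (Suc k)) v"
        by (rule cong_Y[OF _ _ v v _ eqv_refl], simp_all add: prim_SL pT del: of_nat_Suc)
           (cases p, simp add: eqv_def wedge_def S2_def U2_def algebra_simps)
      also have "\<dots> = Y (?T (Suc k)) v" by (rule Y_U2[OF pT v])
      finally show ?thesis .
    qed
    have d1: "delta M (S2 \<cdot> ?T k) v = delta M (?T k) (S2 \<cdot> v)" for k
    proof -
      have "delta M (S2 \<cdot> ?T k) v = delta M (S2 \<cdot> ?T k) (S2 \<cdot> S2 \<cdot> v)"
        by (rule cong_delta) (use v pT in \<open>simp_all add: prim_SL eqv_S2 eqv_sym\<close>)
      also have "\<dots> = delta M (?T k) (S2 \<cdot> v)" by (rule delta_app) (simp add: S2_def)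
      finally show ?thesis .
    qed
    have "(\<Sum>k<M. delta M (?T k) v - delta M (S2 \<cdot> ?T k) v) =
        (\<Sum>k<M. X (?T k) v - X (?T k) (S2 \<cdot> v) + (Y (?T k) v - Y (S2 \<cdot> ?T k) v))"
      by (rule sum.cong) (simp_all add: delta_decomp pT v)
    moreover have "(\<Sum>k<M. Y (?T (Suc k)) v) = (\<Sum>k<M. Y (?T k) v)"
      by (rule sum_lessThan_cyclic) (rule cong_Y, use pT v eqv_shear_M assms in simp_all)
    ultimately show ?thesis
      by (simp add: G_def cusp_count_def d1 Y1 sum.distrib sum_subtractf del: of_nat_Suc)
  qed
  have Geqv: "G v = G w" if "prim M v" "prim M w" "eqv M v w" for v w
    unfolding G_def cusp_count_def
    using cong_delta[OF pT pT that(1,2) eqv_refl that(3)] cong_X[OF pT pT that(1,2) eqv_refl that(3)] by simp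
  have GT: "G (T2 \<cdot> v) = G v" if v: "prim M v" for v
  proof -
    have "cusp_count p (T2 \<cdot> v) = (\<Sum>k<M. delta M (?T (Suc k)) (T2 \<cdot> v))"
      unfolding cusp_count_def
      by (rule sum_lessThan_cyclic[symmetric]) (rule cong_delta, use pT v eqv_shear_M assms in \<open>simp_all add: prim_SL\<close>)
    also have "\<dots> = cusp_count p v"
      unfolding cusp_count_def shear_Suc by (rule sum.cong) (simp_all add: delta_app T2_def)
    finally show ?thesis using X_T2[OF pT v] by (simp add: G_def)
  qed
  have "G q = G q0"
  proof (rule prim_const[OF assms(2) q0(1)])
    fix v assume v: "prim M v"
    show "G (S2 \<cdot> v) = G v" by (rule GS[OF v])
    have "G (U2 \<cdot> v) = G (S2 \<cdot> U2 \<cdot> v)" using GS[of "U2 \<cdot> v"] v by (simp add: prim_SL)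
    also have "\<dots> = G (adj2 T2 \<cdot> v)" by (rule Geqv[OF _ _ eqv_SU]) (use v in \<open>simp_all add: prim_SL\<close>)
    also have "\<dots> = G v" using GT[of "adj2 T2 \<cdot> v"] v by (simp add: prim_SL adj2_app_cancel)
    finally show "G (U2 \<cdot> v) = G v" .
  qed (rule Geqv)
  then show ?thesis using q0(2)[OF pT] by (simp add: G_def)
qed

text \<open>Averaging over shears of p is possible because they move the image under diag(a, d) only
  within its cusp. The 1 stems from the cusp of q0, where all paths start.\<close>

lemma sum_X_diag:
  assumes "(a, d) \<in> factor_pairs N"
  shows "(\<Sum>p\<in>P. X p ((int a, 0, 0, int d) \<cdot> p)) = fixed_cusps a d - 1"
proof -
  let ?D = "(int a, 0, 0, int d)"
  have ad: "int a * int d = int N" using assms by (auto simp: factor_pairs_def)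
  have D: "?D \<in> mats (int N)" using ad by (simp add: mats_def)
  have pf: "proj_fun M (\<lambda>p. X p (?D \<cdot> p))"
    using proj_ker_diag[OF X_ker, of "(1, 0, 0, 1)" ?D] coprime_det(1)[OF D] by simp
  have "(\<Sum>p\<in>P. X p (?D \<cdot> p)) = (\<Sum>p\<in>P. X ((1, int k, 0, 1) \<cdot> p) (?D \<cdot> p))" for k
  proof -
    have pf: "proj_fun M (\<lambda>p. X p (?D \<cdot> p))"
    using proj_ker_diag[OF X_ker, of "(1, 0, 0, 1)" ?D] coprime_det(1)[OF D] by simp
  have "(\<Sum>p\<in>P. X p (?D \<cdot> p)) = (\<Sum>p\<in>P. X ((1, int k, 0, 1) \<cdot> p) (?D \<cdot> (1, int k, 0, 1) \<cdot> p))"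
      by (rule sum_reindex_proj[where f = "\<lambda>p. X p (?D \<cdot> p)", symmetric])
         (simp_all add: coprime_det pf del: mat2_app.simps)
    also have "\<dots> = (\<Sum>p\<in>P. X ((1, int k, 0, 1) \<cdot> p) (?D \<cdot> p))"
    proof (rule sum.cong[OF refl])
      fix p assume "p \<in> P"
      then have p: "prim M p" by (rule P_prim)
      have "?D \<cdot> (1, int k, 0, 1) \<cdot> p = (int a, int a * int k, 0, int d) \<cdot> p"
        by (cases p) (simp add: algebra_simps)
      then show "X ((1, int k, 0, 1) \<cdot> p) (?D \<cdot> (1, int k, 0, 1) \<cdot> p) = X ((1, int k, 0, 1) \<cdot> p) (?D \<cdot> p)"
        using X_upper[OF prim_SL[OF shear_in p] p ad] by simp
    qed
    finally show ?thesis .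
  qed
  then have "real M * (\<Sum>p\<in>P. X p (?D \<cdot> p)) = (\<Sum>k<M. \<Sum>p\<in>P. X ((1, int k, 0, 1) \<cdot> p) (?D \<cdot> p))"
    by simp
  also have "\<dots> = (\<Sum>p\<in>P. cusp_count p (?D \<cdot> p) - cusp_count p q0)"
    by (subst sum.swap) (intro sum.cong refl sum_X_shear P_prim prim_app_N[OF D])
  also have "\<dots> = real M * (fixed_cusps a d - 1)"
    using M_pos by (simp add: sum_subtractf sum_cusp_count q0 fixed_cusps_def right_diff_distrib)
  finally show ?thesis using M_pos by simp
qed

text \<open>Of the coefficient 12, one half is the trace in degree 2 from \<open>pair_wt2_Y\<close>.
  The other half comes from the 1 in \<open>sum_X_diag\<close> and is the trace in degree 0.\<close>

theorem pair_wt_fix_eq: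
  "pair wt_fix (delta M) = 12 * (\<Sum>(a, d)\<in>factor_pairs N. real a) - 6 * (\<Sum>(a, d)\<in>factor_pairs N. real d * fixed_cusps a d)"
proof -
  have "pair wt1 X = 4 * (\<Sum>(a, d)\<in>factor_pairs N. real d * (fixed_cusps a d - 1))"
    unfolding pair_wt1_X pair_wt_upper by (simp add: sum_X_diag split_def cong: sum.cong)
  also have "\<dots> = 4 * (\<Sum>(a, d)\<in>factor_pairs N. real d * fixed_cusps a d) - 4 * (\<Sum>(a, d)\<in>factor_pairs N. real a)"
    unfolding sum_factor_pairs_swap[of "\<lambda>a d. real a"]
    by (simp add: right_diff_distrib sum_subtractf split_def)
  finally show ?thesis
    using pair_wt_fix pair_wt1_split pair_wt1_Y pair_wt2_Y by linarith
qed

end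

section \<open>The split part\<close>

lemma sum_periodic:
  fixes f :: "int \<Rightarrow> real"
  assumes "\<And>b. f (b + int n) = f b"
  shows "(\<Sum>b<n * k. f (int b)) = real k * (\<Sum>b<n. f (int b))"
proof (induction k)
  case (Suc k)
  have per: "f (b + int (n * k)) = f b" for b k
  proof (induction k)
    case (Suc k)
    have eq: "b + int (n * Suc k) = (b + int (n * k)) + int n" by (simp add: algebra_simps)
    show ?case unfolding eq assms by (rule Suc.IH)
  qed simp
  have "(\<Sum>b<n * Suc k. f (int b)) = (\<Sum>b<n * k + n. f (int b))" by (simp add: algebra_simps)
  also have "\<dots> = (\<Sum>b<n * k. f (int b)) + (\<Sum>b\<in>{n * k..<n * k + n}. f (int b))"
    by (simp add: lessThan_atLeast0 sum.atLeastLessThan_concat)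
  also have "(\<Sum>b\<in>{n * k..<n * k + n}. f (int b)) = (\<Sum>b<n. f (int b + int (n * k)))"
    using sum.shift_bounds_nat_ivl[of "\<lambda>b. f (int b)" 0 "n * k" n]
    by (simp add: lessThan_atLeast0 add.commute)
  finally show ?case using Suc per by (simp add: distrib_right)
qed simp

lemma sum_periodic_mult:
  fixes f :: "int \<Rightarrow> real"
  assumes per: "\<And>b. f (b + int n) = f b" and cop: "coprime d (int n)" and n: "n > 0"
  shows "(\<Sum>k<n. f (d * int k)) = (\<Sum>k<n. f (int k))"
proof -
  have mod: "f b = f (b mod int n)" for b
  proof -
    have *: "f (b + int n * k) = f b" for k b
    proof (induction k rule: int_induct[where k = 0])
      case (step1 i)
      then show ?case using per[of "b + int n * i"] by (simp add: algebra_simps)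
    next
      case (step2 i)
      then show ?case using per[of "b + int n * (i - 1)"] by (simp add: algebra_simps)
    qed simp
    show ?thesis using *[of "b mod int n" "b div int n"] by simp
  qed
  let ?h = "\<lambda>k. nat ((d * int k) mod int n)"
  have "inj_on ?h {..<n}"
  proof (rule inj_onI)
    fix k l assume kl: "k \<in> {..<n}" "l \<in> {..<n}" "?h k = ?h l"
    then have "[d * int k = d * int l] (mod int n)"
      using n by (simp add: cong_def nat_eq_iff2)
    then have "[int k = int l] (mod int n)" using cop by (simp add: cong_mult_lcancel)
    then show "k = l" using kl by (simp add: cong_def)
  qed
  moreover have "?h ` {..<n} \<subseteq> {..<n}" using n by (auto simp: nat_less_iff)
  ultimately have bij: "bij_betw ?h {..<n} {..<n}" by (simp add: bij_betw_def endo_inj_surj)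
  have "(\<Sum>k<n. f (d * int k)) = (\<Sum>k<n. f (int (?h k)))"
    by (rule sum.cong) (use n mod in auto)
  also have "\<dots> = (\<Sum>k<n. f (int k))" by (rule sum.reindex_bij_betw[OF bij])
  finally show ?thesis .
qed

lemma factor_pairs_neq: "\<not> is_square N \<Longrightarrow> (a, d) \<in> factor_pairs N \<Longrightarrow> a \<noteq> d"
  by (auto simp: factor_pairs_def is_nth_power_def power2_eq_square)

abbreviation desc_pairs :: "nat \<Rightarrow> (nat \<times> nat) set"
  where "desc_pairs N \<equiv> {(a, d) \<in> factor_pairs N. a > d}"

lemma sum_factor_pairs_split:
  assumes "\<not> is_square N" "N > 0"
  shows "(\<Sum>(a, d)\<in>factor_pairs N. f a d) =
    (\<Sum>(a, d)\<in>desc_pairs N. f a d + f d a :: real)"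
proof -
  let ?A = "desc_pairs N" and ?B = "{(a, d) \<in> factor_pairs N. a < d}"
  have "factor_pairs N = ?A \<union> ?B" using factor_pairs_neq[OF assms(1)] by (auto simp: linorder_neq_iff)
  moreover have "finite ?A" "finite ?B"
    by (rule finite_subset[OF _ finite_factor_pairs[OF assms(2)]]; auto)+
  ultimately have "(\<Sum>(a, d)\<in>factor_pairs N. f a d) = (\<Sum>(a, d)\<in>?A. f a d) + (\<Sum>(a, d)\<in>?B. f a d)"
    by (metis (no_types, lifting) sum.union_disjoint disjoint_iff case_prodE mem_Collect_eq case_prod_conv less_asym)
  also have "(\<Sum>(a, d)\<in>?B. f a d) = (\<Sum>(a, d)\<in>?A. f d a)"
    by (rule sum.reindex_bij_witness[of _ prod.swap prod.swap]) (auto simp: factor_pairs_def mult.commute)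
  finally show ?thesis by (simp add: sum.distrib split_def)
qed

section \<open>Fixed points of triangular matrices modulo M\<close>

context proj_line
begin

definition fix_count :: "mat2 \<Rightarrow> real"
  where "fix_count m = (\<Sum>p\<in>P. delta M p (m \<cdot> p))"

lemma fix_count_conj:
  assumes "g \<in> mats 1" "m \<in> mats (int N)"
  shows "fix_count (g \<odot> m \<odot> adj2 g) = fix_count m"
proof -
  have "fix_count (g \<odot> m \<odot> adj2 g) = (\<Sum>p\<in>P. delta M (g \<cdot> p) ((g \<odot> m \<odot> adj2 g) \<cdot> g \<cdot> p))"
    unfolding fix_count_def
  proof (rule sum_reindex_proj[where f = "\<lambda>p. delta M p ((g \<odot> m \<odot> adj2 g) \<cdot> p)", symmetric])
    have "coprime (det2 (g \<odot> m \<odot> adj2 g)) (int M)"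
      using assms coprime_det by (simp add: det2_mult mats_def)
    from proj_ker_diag[OF proj_ker_delta _ this, of "(1, 0, 0, 1)"]
    show "proj_fun M (\<lambda>p. delta M p ((g \<odot> m \<odot> adj2 g) \<cdot> p))" by simp
  qed (use assms coprime_det in simp)
  also have "\<dots> = fix_count m"
    using assms by (simp add: fix_count_def mat2_app_mult adj2_app_cancel delta_app coprime_det)
  finally show ?thesis .
qed

lemma fix_count_diag_swap:
  assumes "a * d = int N"
  shows "fix_count (a, 0, 0, d) = fix_count (d, 0, 0, a)"
  using fix_count_conj[of S2 "(a, 0, 0, d)"] assms by (simp add: S2_def mats_def)

lemma delta_shift:
  assumes "p \<in> P" "a * d = int N"
  shows "delta M p ((a, b + int M, 0, d) \<cdot> p) = delta M p ((a, b, 0, d) \<cdot> p)"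
proof (rule proj_kerD[OF proj_ker_delta])
  show "eqv M ((a, b + int M, 0, d) \<cdot> p) ((a, b, 0, d) \<cdot> p)"
    by (cases p) (simp add: eqv_def wedge_def algebra_simps)
qed (use P_prim prim_app_N assms in \<open>simp_all add: mats_def del: mat2_app.simps\<close>)

text \<open>Moving the shear by k to the other side of \<open>delta\<close> turns diag(a, d) into
  the matrix with upper right entry -dk, and multiplication by -d permutes the residues modulo
  M.\<close>

lemma sum_fix_count_M:
  assumes "(a, d) \<in> factor_pairs N"
  shows "(\<Sum>b<M. fix_count (int a, int b, 0, int d)) = real M * fixed_cusps a d"
proof -
  have ad: "int a * int d = int N" using assms by (auto simp: factor_pairs_def)
  then have cop: "coprime (- int d) (int M)" using coprime_NM
    by (metis coprime_int_iff coprime_minus_left_iff coprime_mult_left_iff of_nat_eq_iff of_nat_mult)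
  have "cusp_count p ((int a, 0, 0, int d) \<cdot> p) = (\<Sum>b<M. delta M p ((int a, int b, 0, int d) \<cdot> p))"
    if p: "p \<in> P" for p
  proof -
    let ?f = "\<lambda>b. delta M p ((int a, b, 0, int d) \<cdot> p)"
    have "cusp_count p ((int a, 0, 0, int d) \<cdot> p) = (\<Sum>k<M. ?f (- int d * int k))"
      unfolding cusp_count_def
    proof (rule sum.cong[OF refl])
      fix k
      have "delta M ((1, int k, 0, 1) \<cdot> p) ((int a, 0, 0, int d) \<cdot> p) =
          delta M ((1, int k, 0, 1) \<cdot> p) ((1, int k, 0, 1) \<cdot> (int a, - int d * int k, 0, int d) \<cdot> p)"
        by (cases p) (simp add: algebra_simps)
      then show "delta M ((1, int k, 0, 1) \<cdot> p) ((int a, 0, 0, int d) \<cdot> p) = ?f (- int d * int k)"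
        by (simp add: delta_app del: mat2_app.simps)
    qed
    also have "\<dots> = (\<Sum>b<M. ?f (int b))"
      by (rule sum_periodic_mult[where f = ?f, OF delta_shift[OF p ad] cop M_pos])
    finally show ?thesis .
  qed
  then have "real M * fixed_cusps a d = (\<Sum>p\<in>P. \<Sum>b<M. delta M p ((int a, int b, 0, int d) \<cdot> p))"
    using M_pos by (simp add: fixed_cusps_def)
  also have "\<dots> = (\<Sum>b<M. fix_count (int a, int b, 0, int d))"
    unfolding fix_count_def by (rule sum.swap)
  finally show ?thesis by simp
qed

text \<open>As a function of b, the number of fixed points has the period d - a, by conjugation with
  \<open>T2\<close>, and the period M. Summing over M(d - a) consecutive b in both ways shows that
  the mean values over the two periods agree.\<close>

lemma sum_fix_count:
  assumes "(a, d) \<in> factor_pairs N" "a < d"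
  shows "(\<Sum>b<d - a. fix_count (int a, int b, 0, int d)) = real (d - a) * fixed_cusps a d"
proof -
  let ?f = "\<lambda>b. fix_count (int a, b, 0, int d)"
  have ad: "int a * int d = int N" using assms by (auto simp: factor_pairs_def)
  have per1: "?f (b + int (d - a)) = ?f b" for b
  proof -
    have "T2 \<odot> (int a, b, 0, int d) \<odot> adj2 T2 = (int a, b + int (d - a), 0, int d)"
      using assms by (simp add: T2_def of_nat_diff algebra_simps)
    then show ?thesis using fix_count_conj[OF T2_in, of "(int a, b, 0, int d)"] ad by (simp add: mats_def)
  qed
  have per2: "?f (b + int M) = ?f b" for b
    unfolding fix_count_def by (intro sum.cong refl delta_shift ad)
  have "real M * (\<Sum>b<d - a. ?f (int b)) = real (d - a) * (\<Sum>b<M. ?f (int b))"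
    using sum_periodic[where f = ?f, OF per1, of M] sum_periodic[where f = ?f, OF per2, of "d - a"] by (simp add: mult.commute)
  also have "\<dots> = real (d - a) * (real M * fixed_cusps a d)"
    using sum_fix_count_M[OF assms(1)] by simp
  finally show ?thesis using M_pos by simp
qed

lemma pair_delta: "pair c (delta M) = infsum (\<lambda>m. c m * fix_count m) (mats (int N))"
  by (simp add: pair_def fix_count_def)

lemma fix_count_uminus: "fix_count (- a, - b, - c, - d) = fix_count (a, b, c, d)"
  unfolding fix_count_def
proof (rule sum.cong[OF refl])
  fix p
  have "wedge p ((- a, - b, - c, - d) \<cdot> p) = - wedge p ((a, b, c, d) \<cdot> p)"
    by (cases p) (simp add: wedge_def algebra_simps)
  then show "delta M p ((- a, - b, - c, - d) \<cdot> p) = delta M p ((a, b, c, d) \<cdot> p)"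
    by (simp add: delta_def eqv_def)
qed

lemma wt_split_window:
  assumes "(a, d) \<in> factor_pairs N"
  shows "wt_split (int a, b, 0, int d) =
    (if b = 0 then 1 / 2 else if b \<in> {0<..<int d - int a} then 1 else 0)"
proof -
  have "int a + int d > 0" using assms by (auto simp: factor_pairs_def)
  then show ?thesis by (auto simp: split3_def mult_less_0_iff zero_less_mult_iff)
qed

lemma wt_split_minus: "wt_split (- a, - b, - c, - d) = wt_split (a, b, c, d)"
proof -
  have "- c + - d - - a - - b = - (c + d - a - b)" "- a + - d = - (a + d)" by simp_all
  then show ?thesis by (simp only: wt_split.simps split3_minus)
qed

lemma split_sum:
  "fin_supp (int N) wt_split"
  "pair wt_split (delta M) = 2 * (\<Sum>(a, d)\<in>factor_pairs N. fix_count (int a, 0, 0, int d) / 2 +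
    (\<Sum>b\<in>{0<..<int d - int a}. fix_count (int a, b, 0, int d)))"
proof -
  let ?B = "\<lambda>a d. insert 0 {0<..<int d - int a}"
  have supp: "b \<in> ?B a d" if "(a, d) \<in> factor_pairs N" "wt_split (int a, b, 0, int d) \<noteq> 0" for a d b
    using that(2) unfolding wt_split_window[OF that(1)] by (auto split: if_splits)
  have c: "wt_split (a, b, c, d) = 0" if "c \<noteq> 0" for a b c d
    using that by (simp add: split3_def)
  show "fin_supp (int N) wt_split"
    by (rule infsum_upper(1)[where B = ?B, OF N_pos wt_split_minus c _ supp]) simp_all
  have "pair wt_split (delta M) = 2 * (\<Sum>(a, d)\<in>factor_pairs N.
      \<Sum>b\<in>?B a d. wt_split (int a, b, 0, int d) * fix_count (int a, b, 0, int d))"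
    unfolding pair_delta
    by (rule infsum_upper(2)[OF N_pos]) (use supp c in \<open>auto simp: wt_split_minus fix_count_uminus simp del: wt_split.simps\<close>)
  also have "(\<Sum>(a, d)\<in>factor_pairs N. \<Sum>b\<in>?B a d. wt_split (int a, b, 0, int d) * fix_count (int a, b, 0, int d)) =
      (\<Sum>(a, d)\<in>factor_pairs N. fix_count (int a, 0, 0, int d) / 2 +
        (\<Sum>b\<in>{0<..<int d - int a}. fix_count (int a, b, 0, int d)))"
    by (rule sum.cong[OF refl]) (auto simp: wt_split_window simp del: wt_split.simps)
  finally show "pair wt_split (delta M) = 2 * (\<Sum>(a, d)\<in>factor_pairs N. fix_count (int a, 0, 0, int d) / 2 +
    (\<Sum>b\<in>{0<..<int d - int a}. fix_count (int a, b, 0, int d)))" .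
qed

text \<open>The halves at b = 0 for (a, d) and (d, a) are equal, since \<open>S2\<close> conjugates
  one diagonal matrix into the other. Together they complete the open window to a full
  period.\<close>

lemma pair_wt_split:
  assumes "\<not> is_square N"
  shows "pair wt_split (delta M) =
    2 * (\<Sum>(a, d)\<in>desc_pairs N. real (a - d) * fixed_cusps d a)"
proof -
  let ?s = "\<lambda>a d. \<Sum>b\<in>{0<..<int d - int a}. fix_count (int a, b, 0, int d)"
  have "(fix_count (int a, 0, 0, int d) / 2 + ?s a d) + (fix_count (int d, 0, 0, int a) / 2 + ?s d a) =
      real (a - d) * fixed_cusps d a" if ad: "(a, d) \<in> factor_pairs N" "a > d" for a d
  proof -
    have da: "(d, a) \<in> factor_pairs N" "int a * int d = int N"
      using ad by (auto simp: factor_pairs_def mult.commute)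
    have "{0<..<int d - int a} = {}" using ad by auto
    then have "?s a d = 0" by simp
    moreover have "fix_count (int d, 0, 0, int a) + ?s d a = (\<Sum>b\<in>{0..<int (a - d)}. fix_count (int d, b, 0, int a))"
    proof -
      have "{0..<int (a - d)} = insert 0 {0<..<int a - int d}" using ad by auto
      then show ?thesis by simp
    qed
    moreover have "\<dots> = (\<Sum>b<a - d. fix_count (int d, int b, 0, int a))"
      by (rule sum.reindex_bij_witness[of _ int nat]) auto
    ultimately show ?thesis
      using sum_fix_count[OF da(1) ad(2)] fix_count_diag_swap[OF da(2)] by simp
  qed
  then show ?thesis
    unfolding split_sum(2) sum_factor_pairs_split[OF assms N_pos]
    by (intro arg_cong2[of _ _ _ _ "(*)"] refl sum.cong) auto
qed

end

definition wt_ell :: "nat \<Rightarrow> mat2 \<Rightarrow> real"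
  where "wt_ell N = (\<lambda>(a, b, c, d). if (a + d)\<^sup>2 < 4 * int N then wt_fix (a, b, c, d) else 0)"

lemma wt_ell_eq:
  assumes "\<not> is_square N" "N > 0" "m \<in> mats (int N)"
  shows "wt_ell N m = wt_fix m + (wt_split m + wt_split (conjU m) + wt_split (conjU (conjU m)))"
proof -
  obtain a b c d where m: "m = (a, b, c, d)" by (cases m)
  have det: "a * d - b * c = int N" using assms by (simp add: m mats_def)
  \<comment> \<open>A parabolic matrix would make N a square.\<close>
  have "(a + d)\<^sup>2 \<noteq> 4 * int N"
  proof
    assume eq: "(a + d)\<^sup>2 = 4 * int N"
    then have "even (a + d)" by (metis even_power even_mult_iff even_numeral zero_less_numeral pos2)
    then obtain k where "a + d = 2 * k" by blast
    then have "k\<^sup>2 = int N" using eq by simp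
    then have "N = (nat \<bar>k\<bar>)\<^sup>2" by (simp add: nat_power_eq[symmetric] flip: of_nat_eq_iff)
    then show False using assms(1) by (auto simp: is_nth_power_def)
  qed
  then consider "(a + d)\<^sup>2 < 4 * int N" | "(a + d)\<^sup>2 > 4 * int N" by linarith
  then show ?thesis
  proof cases
    case 1
    have disc: "x\<^sup>2 + y\<^sup>2 + z\<^sup>2 < 2 * (x * y + y * z + z * x)"
      if "x = c" "y = - b" "z = c + d - a - b" for x y z
      using 1 det unfolding that by (simp add: power2_eq_square algebra_simps)
    have s0: "split3 x y z t = 0" if "x\<^sup>2 + y\<^sup>2 + z\<^sup>2 < 2 * (x * y + y * z + z * x)" for x y z t :: int
    proof -
      have "x \<noteq> 0"
      proof
        assume "x = 0"
        then have "(y - z)\<^sup>2 < 0" using that by (simp add: power2_eq_square algebra_simps)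
        then show False by simp
      qed
      then show ?thesis by (simp add: split3_def)
    qed
    have "wt_split m = 0" "wt_split (conjU m) = 0" "wt_split (conjU (conjU m)) = 0"
      unfolding m wt_split_conjU wt_split.simps
      by (rule s0, use disc[OF refl refl refl] in \<open>simp add: algebra_simps\<close>)+
    then show ?thesis using 1 by (simp add: wt_ell_def m)
  next
    case 2
    then show ?thesis
      using wt_fix_hyperbolic[OF 2] assms by (simp add: wt_ell_def m)
  qed
qed

context genus_zero
begin

text \<open>For a > d the cusps fixed by diag(d, a) enter \<open>pair_wt_fix_eq\<close> with the
  factor a. The hyperbolic matrices give back a - d, so that in the end every fixed cusp counts
  min(a, d).\<close>

theorem pair_wt_ell:
  assumes "\<not> is_square N"
  shows "pair (wt_ell N) (delta M) = 6 * (\<Sum>(a, d)\<in>desc_pairs N.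
    2 * real (a + d) - real d * (fixed_cusps a d + fixed_cusps d a))"
proof -
  have f1: "fs (\<lambda>m. wt_split (conjU m))" by (rule fin_supp_reindex[OF split_sum(1) bij_betw_conjU])
  have f2: "fs (\<lambda>m. wt_split (conjU (conjU m)))" by (rule fin_supp_reindex[OF f1 bij_betw_conjU])
  have "pair (wt_ell N) (delta M) =
      pair (\<lambda>m. wt_fix m + (wt_split m + wt_split (conjU m) + wt_split (conjU (conjU m)))) (delta M)"
    by (rule pair_cong) (simp_all add: wt_ell_eq[OF assms N_pos])
  also have "\<dots> = pair wt_fix (delta M) + 3 * pair wt_split (delta M)"
    by (simp add: pair_add fin_supp_add f1 f2 split_sum(1) fin_supp_wt_fix N_pos pair_conjU
        pair_conjU[of "\<lambda>m. wt_split (conjU m)"])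
  also have "\<dots> = (\<Sum>(a, d)\<in>desc_pairs N. 12 * (real a + real d)
      - 6 * (real d * fixed_cusps a d + real a * fixed_cusps d a) + 6 * (real (a - d) * fixed_cusps d a))"
    unfolding pair_wt_fix_eq pair_wt_split[OF assms] sum_factor_pairs_split[OF assms N_pos]
    by (simp add: sum_distrib_left sum.distrib sum_subtractf split_def)
  also have "\<dots> = 6 * (\<Sum>(a, d)\<in>desc_pairs N.
    2 * real (a + d) - real d * (fixed_cusps a d + fixed_cusps d a))"
    unfolding sum_distrib_left by (rule sum.cong) (auto simp: of_nat_diff algebra_simps)
  finally show ?thesis .
qed

end

section \<open>Class numbers as sums over reduced forms\<close>

definition forms :: "int \<Rightarrow> bqf set"
  where "forms D = {Q. pos_def Q \<and> discr Q = - D}"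

text \<open>In terms of the Selling parameters x, y, z of a reduced form, D = xy + yz + zx. They are
  nonnegative and no two of them vanish, so each is at most D.\<close>

lemma finite_reduced_forms:
  "finite {Q \<in> forms D. red_weight Q \<noteq> 0}"
proof (rule finite_subset)
  show "finite ({0..D} \<times> {- D..0} \<times> {0..D})" by simp
  show "{Q \<in> forms D. red_weight Q \<noteq> 0} \<subseteq> {0..D} \<times> {- D..0} \<times> {0..D}"
  proof
    fix Q assume Q: "Q \<in> {Q \<in> forms D. red_weight Q \<noteq> 0}"
    obtain A B C where Q': "Q = (A, B, C)" by (cases Q)
    have pd: "pos_def (A, B, C)" and disc: "B\<^sup>2 - 4 * A * C = - D" using Q by (auto simp: forms_def Q')
    have "reduced (A, B, C)" using red_weight_nonzero_imp_reduced[OF pd] Q by (simp add: Q')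
    then have nn: "2 * A + B \<ge> 0" "2 * C + B \<ge> 0" "- B \<ge> 0" by auto
    have A: "A > 0" "D > 0" using pd disc by (auto simp: pos_def_def)
    have C: "C > 0" using pos_def_eval[OF pd, of 0 1] by simp
    define x y z where "x = 2 * A + B" and "y = 2 * C + B" and "z = - B"
    have xyz: "x * y + y * z + z * x = D"
      using disc by (simp add: x_def y_def z_def power2_eq_square algebra_simps)
    have le: "u \<le> D" if "u * v + v * w + w * u = D" "u \<ge> 0" "v \<ge> 0" "w \<ge> 0" "v + w > 0" for u v w
    proof -
      have "u * 1 \<le> u * (v + w)" using that by (intro mult_left_mono) auto
      moreover have "v * w \<ge> 0" using that by simp
      ultimately show ?thesis using that(1) by (simp add: algebra_simps)
    qed
    have "x + z = 2 * A" "y + z = 2 * C" by (simp_all add: x_def y_def z_def)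
    have nn': "x \<ge> 0" "y \<ge> 0" "z \<ge> 0" using nn by (simp_all add: x_def y_def z_def)
    have xy: "x + y > 0"
    proof (rule ccontr)
      assume "\<not> ?thesis"
      then have "x = 0" "y = 0" using nn' by auto
      then show False using xyz A by simp
    qed
    have "x \<le> D" "y \<le> D" "z \<le> D"
      by (rule le[of x y z] le[of y z x] le[of z x y]; use xyz nn' xy \<open>x + z = _\<close> \<open>y + z = _\<close> A C in \<open>simp add: algebra_simps\<close>)+
    then show "Q \<in> {0..D} \<times> {- D..0} \<times> {0..D}"
      using A C nn' \<open>x + z = _\<close> \<open>y + z = _\<close> by (auto simp: Q' z_def)
  qed
qed

lemma forms_mult: "Q \<in> forms D \<Longrightarrow> g \<in> mats 1 \<Longrightarrow> form_mult Q g \<in> forms D"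
  by (simp add: forms_def mats_def pos_def_form_mult discr_form_mult del: discr.simps)

text \<open>Modulo M, the value at w times any of x^2, xy, y^2 is a multiple of the value at v = (x,
  y). Primitivity of v then cancels the coordinates, one degree at a time.\<close>

lemma eval_form_eqv_dvd:
  assumes "prim M v" "eqv M v w" "int M dvd eval_form Q (fst v) (snd v)"
  shows "int M dvd eval_form Q (fst w) (snd w)"
proof -
  obtain a b c where Q: "Q = (a, b, c)" by (cases Q)
  obtain x y where v: "v = (x, y)" by (cases v)
  obtain z t where w: "w = (z, t)" by (cases w)
  define V W where "V = eval_form Q x y" and "W = eval_form Q z t"
  have wd: "int M dvd x * t - y * z" using assms(2) by (simp add: eqv_def wedge_def v w)
  have V: "int M dvd V" using assms(3) by (simp add: V_def v)
  have "W * x * x = z * z * V + (x * t - y * z) * (b * x * z + c * (x * t + y * z))"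
    "W * x * y = z * t * V + (x * t - y * z) * (c * y * t - a * x * z)"
    "W * y * y = t * t * V - (x * t - y * z) * (a * (x * t + y * z) + b * t * y)"
    by (simp_all add: V_def W_def Q power2_eq_square algebra_simps)
  then have "int M dvd W * x * x" "int M dvd W * x * y" "int M dvd W * y * y"
    using V wd by simp_all
  then have "int M dvd W * x" "int M dvd W * y"
    using prim_dvd_cancel[OF assms(1), of "W * x"] prim_dvd_cancel[OF assms(1), of "W * y"]
    by (simp_all add: v mult_ac)
  then have "int M dvd W" using prim_dvd_cancel[OF assms(1), of W] by (simp add: v)
  then show ?thesis by (simp add: w W_def)
qed

section \<open>The group Gamma0(M) and its orbits of forms\<close>

definition of_mat :: "int^2^2 \<Rightarrow> mat2"
  where "of_mat A = (A $ 1 $ 1, A $ 1 $ 2, A $ 2 $ 1, A $ 2 $ 2)"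

lemma act_form_of_mat: "act_form Q A = form_mult Q (of_mat A)"
  by (cases Q) (simp add: act_form.simps of_mat_def Let_def)

lemma inj_of_mat: "inj of_mat"
  by (auto simp: inj_def of_mat_def vec_eq_iff forall_2)

definition Gam0 :: "nat \<Rightarrow> mat2 set"
  where "Gam0 M = {g \<in> mats 1. eqv M (g \<cdot> (1, 0)) (1, 0)}"

lemma of_mat_Gamma0: "of_mat ` Gamma0 M = Gam0 M"
proof (intro equalityI subsetI)
  fix g assume "g \<in> of_mat ` Gamma0 M"
  then show "g \<in> Gam0 M"
    by (auto simp: Gamma0_def SL2Z_def Gam0_def mats_def of_mat_def det_2 eqv_def wedge_def cong_0_iff algebra_simps)
next
  fix g assume g: "g \<in> Gam0 M"
  obtain a b c d where g': "g = (a, b, c, d)" by (cases g)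
  define A :: "int^2^2" where
    "A = (\<chi> i j. if i = 1 then (if j = 1 then a else b) else (if j = 1 then c else d))"
  have "of_mat A = g" by (simp add: of_mat_def A_def g')
  moreover have "A \<in> Gamma0 M"
    using g by (simp add: Gamma0_def SL2Z_def Gam0_def mats_def A_def det_2 eqv_def wedge_def cong_0_iff g' algebra_simps)
  ultimately show "g \<in> of_mat ` Gamma0 M" by blast
qed

lemma Gam0_mult: "g \<in> Gam0 M \<Longrightarrow> h \<in> Gam0 M \<Longrightarrow> g \<odot> h \<in> Gam0 M"
  using mult_in_Gamma0 unfolding of_mat_Gamma0[symmetric]
proof -
  assume "g \<in> of_mat ` Gamma0 M" "h \<in> of_mat ` Gamma0 M"
  then obtain A B where "A \<in> Gamma0 M" "B \<in> Gamma0 M" "g = of_mat A" "h = of_mat B" by blast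
  moreover have "of_mat A \<odot> of_mat B = of_mat (A ** B)"
    by (simp add: of_mat_def matrix_mult_2_nth)
  ultimately show "g \<odot> h \<in> of_mat ` Gamma0 M" using mult_in_Gamma0 by blast
qed

lemma Gam0_adj: "g \<in> Gam0 M \<Longrightarrow> adj2 g \<in> Gam0 M"
  by (cases g) (simp add: Gam0_def mats_def eqv_def wedge_def mult.commute)

lemma Gam0_mats: "g \<in> Gam0 M \<Longrightarrow> g \<in> mats 1"
  by (simp add: Gam0_def)

definition stab :: "nat \<Rightarrow> bqf \<Rightarrow> mat2 set"
  where "stab M Q = {g \<in> Gam0 M. form_mult Q g = Q}"

lemma card_stab_form: "card (stab_form M Q) = card (stab M Q)"
proof -
  have "stab M Q = of_mat ` stab_form M Q"
    by (auto simp: stab_def stab_form_def act_form_of_mat simp flip: of_mat_Gamma0)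
  then show ?thesis using card_image[OF inj_on_subset[OF inj_of_mat]] by auto
qed

lemma pos_forms_eq:
  assumes "M > 0" "D > 0"
  shows "pos_forms M D = {Q \<in> forms D. int M dvd fst Q}"
  using assms by (auto simp: pos_forms_def forms_def pos_def_def zero_less_mult_iff mult_less_0_iff elim!: dvdE)

text \<open>The fibres of the orbit map are cosets of the stabilizer, and those on which F does not
  vanish are finite by assumption.\<close>

lemma orbit_sum:
  fixes F :: "bqf \<Rightarrow> real"
  assumes fin: "finite {h \<in> Gam0 M. F (form_mult Q h) \<noteq> 0}"
  shows "infsum (\<lambda>h. F (form_mult Q h)) (Gam0 M) =
    real (card (stab M Q)) * infsum F ((\<lambda>h. form_mult Q h) ` Gam0 M)"
proof -
  let ?Fin = "{h \<in> Gam0 M. F (form_mult Q h) \<noteq> 0}" and ?f = "\<lambda>h. form_mult Q h"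
  have "infsum (\<lambda>h. F (?f h)) (Gam0 M) = infsum (\<lambda>h. F (?f h)) ?Fin"
    by (rule infsum_cong_neutral) auto
  also have "\<dots> = (\<Sum>h\<in>?Fin. F (?f h))" using fin by simp
  also have "\<dots> = (\<Sum>R\<in>?f ` ?Fin. \<Sum>h\<in>{h \<in> ?Fin. ?f h = R}. F (?f h))"
    by (rule sum.image_gen[OF fin])
  also have "\<dots> = (\<Sum>R\<in>?f ` ?Fin. real (card (stab M Q)) * F R)"
  proof (rule sum.cong[OF refl])
    fix R assume "R \<in> ?f ` ?Fin"
    then obtain h where h: "h \<in> Gam0 M" "R = ?f h" "F R \<noteq> 0" by auto
    have "h \<odot> adj2 h = (1, 0, 0, 1)"
      using adj2_mult(2)[of h] Gam0_mats[OF h(1)] by (simp add: mats_def)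
    then have hh: "form_mult (form_mult Q h) (adj2 h) = Q" by (simp flip: form_mult_mult)
    have "bij_betw (\<lambda>s. s \<odot> h) (stab M Q) {h \<in> ?Fin. ?f h = R}"
    proof (rule bij_betw_byWitness[where f' = "\<lambda>k. k \<odot> adj2 h"])
      show "(\<lambda>s. s \<odot> h) ` stab M Q \<subseteq> {h \<in> ?Fin. ?f h = R}"
        using h by (auto simp: stab_def form_mult_mult intro: Gam0_mult)
      show "(\<lambda>k. k \<odot> adj2 h) ` {h \<in> ?Fin. ?f h = R} \<subseteq> stab M Q"
        by (rule image_subsetI) (use h hh in \<open>simp add: stab_def form_mult_mult Gam0_mult Gam0_adj\<close>)
    qed (simp_all add: adj2_cancel Gam0_mats[OF h(1)])
    then have card: "card {h \<in> ?Fin. ?f h = R} = card (stab M Q)" by (rule bij_betw_same_card[symmetric])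
    have "(\<Sum>h\<in>{h \<in> ?Fin. ?f h = R}. F (?f h)) = (\<Sum>h\<in>{h \<in> ?Fin. ?f h = R}. F R)"
      by (rule sum.cong) auto
    then show "(\<Sum>h\<in>{h \<in> ?Fin. ?f h = R}. F (?f h)) = real (card (stab M Q)) * F R"
      using card by simp
  qed
  also have "\<dots> = real (card (stab M Q)) * (\<Sum>R\<in>?f ` ?Fin. F R)" by (rule sum_distrib_left[symmetric])
  also have "(\<Sum>R\<in>?f ` ?Fin. F R) = infsum F (?f ` ?Fin)" using fin by simp
  also have "\<dots> = infsum F (?f ` Gam0 M)" by (rule infsum_cong_neutral) auto
  finally show ?thesis .
qed

section \<open>Cosets of Gamma0(M) and weights of orbits\<close>

context proj_line
begin

lemma transversal_ex: "\<exists>g. \<forall>p. prim M p \<longrightarrow> g p \<in> mats 1 \<and> eqv M (g p \<cdot> (1, 0)) p"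
proof -
  have "\<exists>g. g \<in> mats 1 \<and> eqv M (g \<cdot> (1, 0)) p" if "prim M p" for p
    using that
  proof (rule prim_induct)
    show "\<exists>g. g \<in> mats 1 \<and> eqv M (g \<cdot> (1, 0)) (1, 0)"
      by (rule exI[of _ "(1, 0, 0, 1)"]) (simp add: mats_def)
  next
    fix v assume "\<exists>g. g \<in> mats 1 \<and> eqv M (g \<cdot> (1, 0)) v"
    then obtain g where g: "g \<in> mats 1" "eqv M (g \<cdot> (1, 0)) v" by blast
    have "eqv M ((h \<odot> g) \<cdot> (1, 0)) (h \<cdot> v)" for h
      unfolding mat2_app_mult by (rule eqv_app[OF g(2)])
    then show "\<exists>g. g \<in> mats 1 \<and> eqv M (g \<cdot> (1, 0)) (S2 \<cdot> v)" "\<exists>g. g \<in> mats 1 \<and> eqv M (g \<cdot> (1, 0)) (U2 \<cdot> v)"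
      using mult_in_mats(1) g(1) S2_in U2_in by blast+
  next
    fix v w assume "prim M v" "eqv M v w" "\<exists>g. g \<in> mats 1 \<and> eqv M (g \<cdot> (1, 0)) v"
    then show "\<exists>g. g \<in> mats 1 \<and> eqv M (g \<cdot> (1, 0)) w" using eqv_trans by blast
  qed
  then show ?thesis by metis
qed

definition transv :: "int \<times> int \<Rightarrow> mat2"
  where "transv = (SOME g. \<forall>p. prim M p \<longrightarrow> g p \<in> mats 1 \<and> eqv M (g p \<cdot> (1, 0)) p)"

lemma transv: "prim M p \<Longrightarrow> transv p \<in> mats 1" "prim M p \<Longrightarrow> eqv M (transv p \<cdot> (1, 0)) p"
  using someI_ex[OF transversal_ex] unfolding transv_def by blast+

lemma prim_10: "prim M (1, 0)"
  by (simp add: prim_def)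

lemma mats_eq_Union_transv: "mats 1 = (\<Union>p\<in>P. (\<lambda>h. h \<odot> adj2 (transv p)) ` Gam0 M)"
proof (intro equalityI subsetI)
  fix g :: mat2 assume g: "g \<in> mats 1"
  have pr: "prim M (adj2 g \<cdot> (1, 0))" using g prim_10 by (simp add: prim_SL)
  obtain p where p: "p \<in> P" "eqv M (adj2 g \<cdot> (1, 0)) p" using P_ex[OF pr] by blast
  note pp = P_prim[OF p(1)]
  have "eqv M (transv p \<cdot> (1, 0)) (adj2 g \<cdot> (1, 0))"
    by (rule eqv_trans[OF transv(2)[OF pp] eqv_sym[OF p(2)] pp])
  from eqv_app[OF this, of g] have "eqv M ((g \<odot> transv p) \<cdot> (1, 0)) (1, 0)"
    using g by (simp add: mat2_app_mult adj2_app_cancel)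
  then have "g \<odot> transv p \<in> Gam0 M" using g transv(1)[OF pp] by (simp add: Gam0_def mult_in_mats)
  moreover have "g = (g \<odot> transv p) \<odot> adj2 (transv p)" using transv(1)[OF pp] by (simp add: adj2_cancel)
  ultimately have "g \<in> (\<lambda>h. h \<odot> adj2 (transv p)) ` Gam0 M" by (rule rev_image_eqI)
  with p(1) show "g \<in> (\<Union>p\<in>P. (\<lambda>h. h \<odot> adj2 (transv p)) ` Gam0 M)" by blast
next
  fix g assume "g \<in> (\<Union>p\<in>P. (\<lambda>h. h \<odot> adj2 (transv p)) ` Gam0 M)"
  then obtain p h where "p \<in> P" "h \<in> Gam0 M" "g = h \<odot> adj2 (transv p)" by blast
  then show "g \<in> mats 1" using P_prim transv(1) by (simp add: mult_in_mats Gam0_mats)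
qed

lemma transv_disjoint:
  assumes "p \<in> P" "q \<in> P" "p \<noteq> q"
  shows "(\<lambda>h. h \<odot> adj2 (transv p)) ` Gam0 M \<inter> (\<lambda>h. h \<odot> adj2 (transv q)) ` Gam0 M = {}"
proof (rule ccontr)
  note pr = P_prim[OF assms(1)] P_prim[OF assms(2)]
  assume "\<not> ?thesis"
  then obtain h k where h: "h \<in> Gam0 M" and k: "k \<in> Gam0 M"
    and eq: "h \<odot> adj2 (transv p) = k \<odot> adj2 (transv q)" by blast
  have "h = (k \<odot> adj2 (transv q)) \<odot> transv p"
    using transv(1)[OF pr(1)] by (simp add: adj2_cancel flip: eq)
  then have "adj2 k \<odot> h = adj2 (transv q) \<odot> transv p"
    using Gam0_mats[OF k] by (simp add: mat2_mult_assoc adj2_cancel)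
  then have "transv p = transv q \<odot> (adj2 k \<odot> h)"
    using transv(1)[OF pr(2)] by (simp add: adj2_cancel)
  moreover have "eqv M ((adj2 k \<odot> h) \<cdot> (1, 0)) (1, 0)"
    using Gam0_mult[OF Gam0_adj[OF k] h] by (simp add: Gam0_def)
  ultimately have "eqv M (transv p \<cdot> (1, 0)) (transv q \<cdot> (1, 0))"
    by (simp add: mat2_app_mult eqv_app)
  then have "eqv M p q"
    using eqv_cong[OF prim_SL[OF transv(1)[OF pr(1)] prim_10] pr(1) prim_SL[OF transv(1)[OF pr(2)] prim_10] pr(2)
      transv(2)[OF pr(1)] transv(2)[OF pr(2)]] by simp
  then show False using P_unique assms by blast
qed

lemma inj_transv: "p \<in> P \<Longrightarrow> inj_on (\<lambda>h. h \<odot> adj2 (transv p)) (Gam0 M)"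
  using bij_betw_mult_right[of "adj2 (transv p)" 1] transv(1)[OF P_prim]
  by (auto simp: bij_betw_def Gam0_def intro: inj_on_subset)

lemma sum_transversal:
  assumes "fin_supp 1 f"
  shows "infsum f (mats 1) = (\<Sum>p\<in>P. infsum (\<lambda>h. f (h \<odot> adj2 (transv p))) (Gam0 M))"
proof -
  have sub: "(\<lambda>h. h \<odot> adj2 (transv p)) ` Gam0 M \<subseteq> mats 1" if "p \<in> P" for p
    using mats_eq_Union_transv that by blast
  have "infsum f (mats 1) = (\<Sum>p\<in>P. infsum f ((\<lambda>h. h \<odot> adj2 (transv p)) ` Gam0 M))"
    unfolding mats_eq_Union_transv
    by (rule sum_infsum[symmetric, OF finite_P])
       (use summable_on_subset[OF fin_supp_summable[OF assms] sub] transv_disjoint in blast)+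
  also have "\<dots> = (\<Sum>p\<in>P. infsum (\<lambda>h. f (h \<odot> adj2 (transv p))) (Gam0 M))"
    by (rule sum.cong) (simp_all add: infsum_reindex inj_transv o_def)
  finally show ?thesis .
qed

lemma infsum_sum_swap:
  fixes f :: "'b \<Rightarrow> 'c \<Rightarrow> real"
  assumes "finite I" "\<And>i. i \<in> I \<Longrightarrow> finite {x \<in> A. f i x \<noteq> 0}"
  shows "infsum (\<lambda>x. \<Sum>i\<in>I. f i x) A = (\<Sum>i\<in>I. infsum (f i) A)"
proof -
  define F where "F = (\<Union>i\<in>I. {x \<in> A. f i x \<noteq> 0})"
  have F: "finite F" using assms by (simp add: F_def)
  have "infsum (\<lambda>x. \<Sum>i\<in>I. f i x) A = infsum (\<lambda>x. \<Sum>i\<in>I. f i x) F"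
    by (rule infsum_cong_neutral) (auto simp: F_def intro!: sum.neutral)
  also have "\<dots> = (\<Sum>i\<in>I. \<Sum>x\<in>F. f i x)" using F by (simp add: sum.swap[of _ F])
  also have "\<dots> = (\<Sum>i\<in>I. infsum (f i) A)"
  proof (rule sum.cong[OF refl])
    fix i assume i: "i \<in> I"
    have "(\<Sum>x\<in>F. f i x) = infsum (f i) F" using F by simp
    also have "\<dots> = infsum (f i) A" by (rule infsum_cong_neutral) (use i in \<open>auto simp: F_def\<close>)
    finally show "(\<Sum>x\<in>F. f i x) = infsum (f i) A" .
  qed
  finally show ?thesis .
qed

text \<open>SL2(Z) is the disjoint union of the cosets of Gamma0(M) through
  \<open>adj2 (transv p)\<close>. So the sum of this over all h in Gamma0(M), applied to Q, is the
  sum of \<open>red_weight\<close> over all of SL2(Z).\<close>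

definition weight_sum :: "bqf \<Rightarrow> real"
  where "weight_sum Q = (\<Sum>p\<in>P. red_weight (form_mult Q (adj2 (transv p))))"

text \<open>The right-hand side is nonzero, so this also shows that the stabilizer is finite, as
  \<open>card\<close> is 0 on infinite sets.\<close>

lemma orbit_weight:
  assumes "pos_def Q"
  shows "real (card (stab M Q)) * infsum weight_sum ((\<lambda>h. form_mult Q h) ` Gam0 M) = 6"
proof -
  have fs: "fin_supp 1 (\<lambda>g. red_weight (form_mult Q g))"
    unfolding fin_supp_def by (rule red_weight_partition(1)[OF assms])
  have fin: "finite {h \<in> Gam0 M. red_weight (form_mult (form_mult Q h) (adj2 (transv p))) \<noteq> 0}"
    if p: "p \<in> P" for p
  proof (rule finite_imageD)
    show "finite ((\<lambda>h. h \<odot> adj2 (transv p)) `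
        {h \<in> Gam0 M. red_weight (form_mult (form_mult Q h) (adj2 (transv p))) \<noteq> 0})"
      by (rule finite_subset[OF _ fs[unfolded fin_supp_def]], rule image_subsetI)
         (use transv(1)[OF P_prim[OF p]] in \<open>simp add: mult_in_mats Gam0_mats[of _ M] form_mult_mult\<close>)
    show "inj_on (\<lambda>h. h \<odot> adj2 (transv p))
        {h \<in> Gam0 M. red_weight (form_mult (form_mult Q h) (adj2 (transv p))) \<noteq> 0}"
      by (rule inj_on_subset[OF inj_transv[OF p]]) auto
  qed
  have "{h \<in> Gam0 M. weight_sum (form_mult Q h) \<noteq> 0} \<subseteq>
      (\<Union>p\<in>P. {h \<in> Gam0 M. red_weight (form_mult (form_mult Q h) (adj2 (transv p))) \<noteq> 0})"
    unfolding weight_sum_def by (auto elim!: sum.not_neutral_contains_not_neutral)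
  then have "finite {h \<in> Gam0 M. weight_sum (form_mult Q h) \<noteq> 0}"
    by (rule finite_subset) (use fin finite_P in blast)
  then have "real (card (stab M Q)) * infsum weight_sum ((\<lambda>h. form_mult Q h) ` Gam0 M) =
      infsum (\<lambda>h. weight_sum (form_mult Q h)) (Gam0 M)"
    by (rule orbit_sum[symmetric])
  also have "\<dots> = (\<Sum>p\<in>P. infsum (\<lambda>h. red_weight (form_mult (form_mult Q h) (adj2 (transv p)))) (Gam0 M))"
    unfolding weight_sum_def by (rule infsum_sum_swap[OF finite_P fin])
  also have "\<dots> = infsum (\<lambda>g. red_weight (form_mult Q g)) (mats 1)"
    by (simp add: sum_transversal[OF fs] form_mult_mult)
  also have "\<dots> = 6" by (rule red_weight_partition(2)[OF assms])
  finally show ?thesis .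
qed

lemma form_mult_adj:
  assumes "g \<in> mats 1"
  shows "form_mult (form_mult Q g) (adj2 g) = Q" "form_mult (form_mult Q (adj2 g)) g = Q"
  using adj2_mult[of g] assms by (simp_all add: mats_def flip: form_mult_mult)

lemma finite_weight_forms:
  assumes "p \<in> P"
  shows "finite {Q \<in> forms D. red_weight (form_mult Q (adj2 (transv p))) \<noteq> 0}"
proof (rule finite_subset)
  note g = transv(1)[OF P_prim[OF assms]]
  let ?S = "{Q \<in> forms D. red_weight Q \<noteq> 0}"
  show "finite ((\<lambda>Q. form_mult Q (transv p)) ` ?S)" using finite_reduced_forms by blast
  show "{Q \<in> forms D. red_weight (form_mult Q (adj2 (transv p))) \<noteq> 0} \<subseteq> (\<lambda>Q. form_mult Q (transv p)) ` ?S"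
  proof
    fix Q assume "Q \<in> {Q \<in> forms D. red_weight (form_mult Q (adj2 (transv p))) \<noteq> 0}"
    then have "form_mult Q (adj2 (transv p)) \<in> ?S" using g by (simp add: forms_mult)
    then show "Q \<in> (\<lambda>Q. form_mult Q (transv p)) ` ?S"
      by (rule rev_image_eqI) (simp add: form_mult_adj[OF g])
  qed
qed

definition root_count :: "bqf \<Rightarrow> real"
  where "root_count Q = (\<Sum>p\<in>P. of_bool (int M dvd eval_form Q (fst p) (snd p)))"

text \<open>By \<open>orbit_weight\<close>, the summand 2 / card of a class is one third of the
  total weight of that class.\<close>

lemma hurwitz_eq_weight_sum:
  assumes D: "D > 0"
  shows "hurwitz_class_number M D = infsum weight_sum (pos_forms M D) / 3"
proof -
  let ?X = "pos_forms M D" and ?E = "form_equiv M D"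
  have X: "?X \<subseteq> forms D" using pos_forms_eq[OF M_pos D] by auto
  have eq: "equiv ?X ?E" by (rule equiv_form_equiv)
  have orbit: "?E `` {Q} = (\<lambda>h. form_mult Q h) ` Gam0 M" if "Q \<in> ?X" for Q
    using that act_form_in_pos_forms[OF M_pos D that]
    by (auto simp: form_equiv_def act_form_of_mat simp flip: of_mat_Gamma0)
  have weight: "real (card (stab M Q)) * infsum weight_sum (?E `` {Q}) = 6" if "Q \<in> ?X" for Q
    unfolding orbit[OF that] by (rule orbit_weight) (use that X in \<open>auto simp: forms_def\<close>)
  define V where "V = {Q \<in> ?X. weight_sum Q \<noteq> 0}"
  have "V \<subseteq> (\<Union>p\<in>P. {Q \<in> forms D. red_weight (form_mult Q (adj2 (transv p))) \<noteq> 0})"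
    using X unfolding V_def weight_sum_def by (auto elim!: sum.not_neutral_contains_not_neutral)
  then have V: "finite V" by (rule finite_subset) (use finite_weight_forms finite_P in blast)
  have summable: "weight_sum summable_on C" if "C \<subseteq> ?X" for C
    by (rule finite_nonzero_values_imp_summable_on, rule finite_subset[OF _ V])
       (use that in \<open>auto simp: V_def\<close>)
  \<comment> \<open>Every class has nonzero total weight and hence meets the finite set V, which
    makes the quotient finite.\<close>
  have "?X // ?E \<subseteq> (\<lambda>Q. ?E `` {Q}) ` V"
  proof
    fix C assume C: "C \<in> ?X // ?E"
    then obtain Q where Q: "Q \<in> ?X" "C = ?E `` {Q}" by (rule quotientE)
    have "infsum weight_sum C \<noteq> 0" using weight[OF Q(1)] Q(2) by auto
    then obtain R where R: "R \<in> C" "weight_sum R \<noteq> 0" by (metis infsum_0)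
    have "R \<in> ?X" using R Q eq by (auto simp: form_equiv_def)
    moreover have "C = ?E `` {R}" using R Q eq by (metis Image_singleton_iff equiv_class_eq)
    ultimately show "C \<in> (\<lambda>Q. ?E `` {Q}) ` V" using R by (auto simp: V_def)
  qed
  then have fin: "finite (?X // ?E)" using V by (meson finite_imageI finite_subset)
  have "hurwitz_class_number M D = (\<Sum>C\<in>?X // ?E. infsum weight_sum C / 3)"
    unfolding hurwitz_class_number_def
  proof (rule sum.cong[OF refl])
    fix C assume C: "C \<in> ?X // ?E"
    define Q where "Q = (SOME Q. Q \<in> C)"
    have "Q \<in> C" using in_quotient_imp_non_empty[OF eq C] by (auto simp: Q_def some_in_eq)
    moreover obtain R where R: "R \<in> ?X" "C = ?E `` {R}" using C by (rule quotientE)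
    ultimately have Q: "Q \<in> ?X" "C = ?E `` {Q}"
      using equiv_class_eq[OF eq, of R Q] by (auto simp: form_equiv_def)
    have "real (card (stab M Q)) \<noteq> 0" using weight[OF Q(1)] by (metis mult_zero_left zero_neq_numeral)
    then have "2 / real (card (stab M Q)) = infsum weight_sum C / 3"
      using weight[OF Q(1)] Q(2) by (simp add: field_simps)
    then show "2 / real (card (stab_form M (SOME Q. Q \<in> C))) = infsum weight_sum C / 3"
      by (simp add: card_stab_form Q_def)
  qed
  also have "\<dots> = (\<Sum>C\<in>?X // ?E. infsum weight_sum C) / 3" by (rule sum_divide_distrib[symmetric])
  also have "(\<Sum>C\<in>?X // ?E. infsum weight_sum C) = infsum weight_sum (\<Union>C\<in>?X // ?E. C)"
    by (rule sum_infsum[OF fin])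
       (use summable quotient_disj[OF eq] Union_quotient[OF eq] in blast)+
  also have "(\<Union>C\<in>?X // ?E. C) = ?X" using Union_quotient[OF eq] by simp
  finally show ?thesis .
qed

text \<open>Composition with \<open>transv p\<close> turns the value at p into the leading
  coefficient modulo M, up to a unit. So forms of level M become arbitrary forms with a root p
  modulo M.\<close>

lemma weight_sum_forms:
  assumes D: "D > 0"
  shows "infsum weight_sum (pos_forms M D) = infsum (\<lambda>Q. red_weight Q * root_count Q) (forms D)"
proof -
  have "infsum weight_sum (pos_forms M D) =
      (\<Sum>p\<in>P. infsum (\<lambda>Q. red_weight (form_mult Q (adj2 (transv p)))) (pos_forms M D))"
    unfolding weight_sum_def
    by (rule infsum_sum_swap[OF finite_P], rule finite_subset[OF _ finite_weight_forms])
       (use pos_forms_eq[OF M_pos D] in auto)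
  also have "\<dots> = (\<Sum>p\<in>P. infsum (\<lambda>Q. red_weight Q * of_bool (int M dvd eval_form Q (fst p) (snd p))) (forms D))"
  proof (rule sum.cong[OF refl])
    fix p assume p: "p \<in> P"
    note g = transv[OF P_prim[OF p]]
    let ?g = "transv p"
    let ?R = "{Q \<in> forms D. int M dvd eval_form Q (fst p) (snd p)}"
    have lead: "fst (form_mult Q ?g) = eval_form Q (fst (?g \<cdot> (1, 0))) (snd (?g \<cdot> (1, 0)))" for Q
      by (cases Q; cases ?g) (simp add: power2_eq_square)
    have iff: "int M dvd fst (form_mult Q ?g) \<longleftrightarrow> int M dvd eval_form Q (fst p) (snd p)" for Q
      unfolding lead
      using eval_form_eqv_dvd[OF prim_SL[OF g(1) prim_10] g(2)]
        eval_form_eqv_dvd[OF P_prim[OF p] eqv_sym[OF g(2)]] by blast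
    have bij: "bij_betw (\<lambda>Q. form_mult Q (adj2 ?g)) (pos_forms M D) ?R"
    proof (rule bij_betw_byWitness[where f' = "\<lambda>Q. form_mult Q ?g"])
      show "(\<lambda>Q. form_mult Q (adj2 ?g)) ` pos_forms M D \<subseteq> ?R"
        by (rule image_subsetI)
           (use g(1) in \<open>simp add: pos_forms_eq[OF M_pos D] forms_mult iff[symmetric] form_mult_adj\<close>)
      show "(\<lambda>Q. form_mult Q ?g) ` ?R \<subseteq> pos_forms M D"
        by (rule image_subsetI) (use g(1) in \<open>simp add: pos_forms_eq[OF M_pos D] forms_mult iff\<close>)
    qed (simp_all add: form_mult_adj g(1))
    have "infsum (\<lambda>Q. red_weight (form_mult Q (adj2 ?g))) (pos_forms M D) = infsum red_weight ?R"
      by (rule infsum_reindex_bij_betw[OF bij])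
    also have "\<dots> = infsum (\<lambda>Q. red_weight Q * of_bool (int M dvd eval_form Q (fst p) (snd p))) (forms D)"
      by (rule infsum_cong_neutral) auto
    finally show "infsum (\<lambda>Q. red_weight (form_mult Q (adj2 ?g))) (pos_forms M D) =
        infsum (\<lambda>Q. red_weight Q * of_bool (int M dvd eval_form Q (fst p) (snd p))) (forms D)" .
  qed
  also have "\<dots> = infsum (\<lambda>Q. \<Sum>p\<in>P. red_weight Q * of_bool (int M dvd eval_form Q (fst p) (snd p))) (forms D)"
    by (rule infsum_sum_swap[symmetric, OF finite_P], rule finite_subset[OF _ finite_reduced_forms[of D]]) auto
  finally show ?thesis by (simp add: root_count_def sum_distrib_left)
qed

section \<open>Elliptic matrices of given trace\<close>

definition ell :: "int \<Rightarrow> mat2 set"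
  where "ell x = {(a, b, c, d). (a, b, c, d) \<in> mats (int N) \<and> a + d = x \<and> c > 0}"

text \<open>The form (c, d - a, -b) of the fixed point determines m once the trace is known. Its
  value at p is the wedge of p and m p, so fixed points modulo M are roots of the form.\<close>

lemma infsum_ell:
  assumes "x\<^sup>2 < 4 * int N"
  shows "infsum (\<lambda>m. wt_ell N m * fix_count m) (ell x) = 3 * hurwitz_class_number M (4 * int N - x\<^sup>2)"
proof -
  let ?D = "4 * int N - x\<^sup>2"
  let ?f = "\<lambda>(a, b, c, d). (c, d - a, - b)" and ?g = "\<lambda>(A, B, C). ((x - B) div 2, - C, A, (x + B) div 2)"
  have par: "even (x - B) \<and> even (x + B) \<and> (x - B) div 2 * ((x + B) div 2) + A * C = int N"
    if "B\<^sup>2 - 4 * A * C = - ?D" for A B C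
  proof -
    have eq: "(x - B) * (x + B) = 4 * (int N - A * C)" using that by (simp add: power2_eq_square algebra_simps)
    then have "even ((x - B) * (x + B))" by simp
    then have ev: "even (x - B)" "even (x + B)" by auto
    then obtain k l where "x - B = 2 * k" "x + B = 2 * l" by (meson evenE)
    then show ?thesis using eq ev by simp
  qed
  have bij: "bij_betw ?f (ell x) (forms ?D)"
  proof (rule bij_betw_byWitness[where f' = ?g])
    show "\<forall>m\<in>ell x. ?g (?f m) = m" by (auto simp: ell_def)
    show "\<forall>Q\<in>forms ?D. ?f (?g Q) = Q"
    proof
      fix Q assume Q: "Q \<in> forms ?D"
      obtain A B C where Q': "Q = (A, B, C)" by (cases Q)
      have "B\<^sup>2 - 4 * A * C = - ?D" using Q by (simp add: forms_def Q')
      from par[OF this] obtain k l where "x - B = 2 * k" "x + B = 2 * l" by (meson evenE)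
      then show "?f (?g Q) = Q" by (simp add: Q')
    qed
    show "?f ` ell x \<subseteq> forms ?D"
    proof (rule image_subsetI)
      fix m assume "m \<in> ell x"
      then obtain a b c d where m: "m = (a, b, c, d)" "a * d - b * c = int N" "a + d = x" "c > 0"
        by (auto simp: ell_def mats_def)
      have "discr (c, d - a, - b) = - ?D"
        unfolding m(3)[symmetric] m(2)[symmetric] by (simp add: power2_eq_square algebra_simps)
      then show "?f m \<in> forms ?D" using assms m by (simp add: forms_def pos_def_def)
    qed
    show "?g ` forms ?D \<subseteq> ell x"
    proof (rule image_subsetI)
      fix Q assume Q: "Q \<in> forms ?D"
      obtain A B C where Q': "Q = (A, B, C)" by (cases Q)
      have "B\<^sup>2 - 4 * A * C = - ?D" "A > 0" using Q by (auto simp: forms_def pos_def_def Q')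
      note p = par[OF this(1)]
      then obtain k l where "x - B = 2 * k" "x + B = 2 * l" by (meson evenE)
      then show "?g Q \<in> ell x" using p \<open>A > 0\<close> by (simp add: Q' ell_def mats_def algebra_simps)
    qed
  qed
  have "infsum (\<lambda>m. wt_ell N m * fix_count m) (ell x) =
      infsum (\<lambda>m. red_weight (?f m) * root_count (?f m)) (ell x)"
  proof (rule infsum_cong)
    fix m assume "m \<in> ell x"
    then obtain a b c d where m: "m = (a, b, c, d)" "(a, b, c, d) \<in> mats (int N)" "a + d = x" "c > 0"
      by (auto simp: ell_def)
    have "wt_ell N m = red_weight (?f m)"
      using wt_fix_elliptic(2)[OF _ m(2,4)] assms m(3) by (simp add: wt_ell_def m(1))
    moreover have "fix_count m = root_count (?f m)"
    proof -
      have "wedge p (m \<cdot> p) = eval_form (?f m) (fst p) (snd p)" for p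
        by (cases p) (simp add: m(1) wedge_def power2_eq_square algebra_simps)
      then show ?thesis by (simp add: fix_count_def root_count_def delta_def eqv_def)
    qed
    ultimately show "wt_ell N m * fix_count m = red_weight (?f m) * root_count (?f m)" by simp
  qed
  also have "\<dots> = infsum (\<lambda>Q. red_weight Q * root_count Q) (forms ?D)"
    by (rule infsum_reindex_bij_betw[OF bij])
  also have "\<dots> = 3 * hurwitz_class_number M ?D"
    using hurwitz_eq_weight_sum[of ?D] weight_sum_forms[of ?D] assms by simp
  finally show ?thesis .
qed

lemma finite_traces: "finite {x. x\<^sup>2 < 4 * int N}"
proof (rule finite_subset)
  show "{x. x\<^sup>2 < 4 * int N} \<subseteq> {- 4 * int N..4 * int N}"
  proof
    fix x assume "x \<in> {x. x\<^sup>2 < 4 * int N}"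
    moreover have "\<bar>x\<bar> \<le> x\<^sup>2" using self_le_power[of "\<bar>x\<bar>" 2] by (cases "x = 0") auto
    ultimately show "x \<in> {- 4 * int N..4 * int N}" by auto
  qed
qed simp

lemma fin_supp_wt_ell: "fin_supp (int N) (wt_ell N)"
  using fin_supp_wt_fix[OF N_pos] unfolding fin_supp_def
  by (rule finite_subset[rotated]) (auto simp: wt_ell_def split: if_splits)

text \<open>The 6 is the 3 of \<open>infsum_ell\<close> times 2 for the sign of c, since m and -m
  both count. An elliptic m cannot have c = 0.\<close>

theorem sum_hurwitz:
  "(\<Sum>x | x\<^sup>2 < 4 * int N. hurwitz_class_number M (4 * int N - x\<^sup>2)) = pair (wt_ell N) (delta M) / 6"
proof -
  let ?F = "\<lambda>m. wt_ell N m * fix_count m"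
  define E where "E = (\<Union>x\<in>{x. x\<^sup>2 < 4 * int N}. ell x)"
  define E' where "E' = (\<lambda>(a, b, c, d). (- a, - b, - c, - d)) ` E"
  have EN: "E \<subseteq> mats (int N)" by (auto simp: E_def ell_def)
  have E'N: "E' \<subseteq> mats (int N)" using EN by (auto simp: E'_def mats_def)
  have inE: "(a, b, c, d) \<in> E \<longleftrightarrow> (a, b, c, d) \<in> mats (int N) \<and> (a + d)\<^sup>2 < 4 * int N \<and> c > 0" for a b c d
    by (auto simp: E_def ell_def)
  have inE': "(a, b, c, d) \<in> E' \<longleftrightarrow> (a, b, c, d) \<in> mats (int N) \<and> (a + d)\<^sup>2 < 4 * int N \<and> c < 0" for a b c d
  proof -
    have "(a, b, c, d) \<in> E' \<longleftrightarrow> (- a, - b, - c, - d) \<in> E"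
      by (force simp: E'_def image_iff)
    also have "\<dots> \<longleftrightarrow> (a, b, c, d) \<in> mats (int N) \<and> (a + d)\<^sup>2 < 4 * int N \<and> c < 0"
      using power2_minus[of "a + d"] by (simp add: inE mats_def)
    finally show ?thesis .
  qed
  have summ: "?F summable_on A" if "A \<subseteq> mats (int N)" for A
    using fin_supp_summable[OF fin_supp_mult[OF fin_supp_wt_ell]] that by (rule summable_on_subset)
  have "pair (wt_ell N) (delta M) = infsum ?F (E \<union> E')"
    unfolding pair_delta
  proof (rule infsum_cong_neutral)
    fix m assume m: "m \<in> mats (int N) - (E \<union> E')"
    obtain a b c d where m': "m = (a, b, c, d)" by (cases m)
    have "\<not> (a + d)\<^sup>2 < 4 * int N"
    proof
      assume t: "(a + d)\<^sup>2 < 4 * int N"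
      then have "c = 0" using m inE inE' by (auto simp: m' linorder_neq_iff)
      then have "a * d = int N" using m by (simp add: m' mats_def)
      then have "(a - d)\<^sup>2 < 0" using t by (simp add: power2_eq_square algebra_simps)
      then show False by simp
    qed
    then show "?F m = 0" by (simp add: wt_ell_def m')
  qed (use EN E'N in auto)
  also have "\<dots> = infsum ?F E + infsum ?F E'"
    by (rule infsum_Un_disjoint[OF summ[OF EN] summ[OF E'N]]) (auto simp: inE inE')
  also have "infsum ?F E' = infsum ?F E"
  proof -
    have "infsum ?F E' = infsum (?F \<circ> (\<lambda>(a, b, c, d). (- a, - b, - c, - d))) E"
      unfolding E'_def by (rule infsum_reindex) (auto simp: inj_on_def)
    also have "\<dots> = infsum ?F E"
    proof (rule infsum_cong)
      fix m assume "m \<in> E"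
      obtain a b c d where m': "m = (a, b, c, d)" by (cases m)
      have "(- a + - d)\<^sup>2 = (a + d)\<^sup>2" by (simp add: power2_eq_square algebra_simps)
      then have "wt_ell N (- a, - b, - c, - d) = wt_ell N (a, b, c, d)"
        by (simp only: wt_ell_def prod.case wt_fix_minus)
      then show "(?F \<circ> (\<lambda>(a, b, c, d). (- a, - b, - c, - d))) m = ?F m"
        by (simp add: m' fix_count_uminus)
    qed
    finally show ?thesis .
  qed
  also have "infsum ?F E = (\<Sum>x | x\<^sup>2 < 4 * int N. infsum ?F (ell x))"
    unfolding E_def
    by (rule sum_infsum[OF finite_traces, symmetric]) (rule summ, auto simp: ell_def)
  also have "\<dots> = (\<Sum>x | x\<^sup>2 < 4 * int N. 3 * hurwitz_class_number M (4 * int N - x\<^sup>2))"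
    by (rule sum.cong) (simp_all add: infsum_ell)
  finally show ?thesis by (simp add: sum_distrib_left[symmetric])
qed

end

section \<open>Certificates for genus zero\<close>

fun known_order :: "nat \<Rightarrow> (int \<times> int) list \<Rightarrow> (int \<times> int) list \<Rightarrow> (int \<times> int) list \<Rightarrow> bool"
  where
    "known_order M C K [] = True"
  | "known_order M C K (q # qs) =
      ((q \<in> set C \<or> eqv M (S2 \<cdot> q) q \<or> eqv M (U2 \<cdot> q) q \<or> list_ex (eqv M (S2 \<cdot> q)) K \<or>
        list_ex (eqv M (U2 \<cdot> q)) K \<and> list_ex (eqv M (U2 \<cdot> U2 \<cdot> q)) K)
      \<and> known_order M C (q # K) qs)"

fun distinct_classes :: "nat \<Rightarrow> (int \<times> int) list \<Rightarrow> bool"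
  where
    "distinct_classes M [] = True"
  | "distinct_classes M (p # ps) = (\<not> list_ex (eqv M p) ps \<and> distinct_classes M ps)"

text \<open>As \<open>S2\<close> and \<open>U2\<close> generate SL2(Z), a list that contains (1, 0)
  and is closed under both, up to equivalence, meets every class.\<close>

definition closed_classes :: "nat \<Rightarrow> (int \<times> int) list \<Rightarrow> bool"
  where "closed_classes M L \<longleftrightarrow> list_ex (eqv M (1, 0)) L \<and>
    list_all (\<lambda>q. coprime (gcd (fst q) (snd q)) (int M) \<and>
      list_ex (eqv M (S2 \<cdot> q)) L \<and> list_ex (eqv M (U2 \<cdot> q)) L) L"

text \<open>The first coordinate of c is coprime to M, so the edge c leads to the cusp of 0; the
  second is not, so c itself belongs to another cusp. The tree is thus a star. The test over k
  checks that distinct c have distinct cusps.\<close>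

definition cusp_reps :: "nat \<Rightarrow> (int \<times> int) list \<Rightarrow> bool"
  where "cusp_reps M C \<longleftrightarrow>
    list_all (\<lambda>c. coprime (fst c) (int M) \<and> \<not> coprime (snd c) (int M) \<and>
      list_all (\<lambda>c'. c = c' \<or> list_all (\<lambda>k. \<not> eqv M ((1, int k, 0, 1) \<cdot> c) c') [0..<M]) C) C"

definition genus_zero_cert :: "nat \<Rightarrow> (int \<times> int) list \<Rightarrow> (int \<times> int) list \<Rightarrow> bool"
  where "genus_zero_cert M C L \<longleftrightarrow> M > 0 \<and> cusp_reps M C \<and> known_order M C [] L \<and>
    distinct_classes M L \<and> closed_classes M L"

lemma distinct_classes_eq:
  "distinct_classes M L \<Longrightarrow> p \<in> set L \<Longrightarrow> q \<in> set L \<Longrightarrow> eqv M p q \<Longrightarrow> p = q"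
  by (induction L) (auto simp: list_ex_iff dest: eqv_sym)

lemma proj_line_cert:
  assumes "genus_zero_cert M C L" "N > 0" "coprime N M"
  shows "proj_line M N (set L)"
proof -
  have c: "closed_classes M L" and d: "distinct_classes M L" and M: "M > 0"
    using assms(1) by (simp_all add: genus_zero_cert_def)
  have pr: "prim M p" if "p \<in> set L" for p
    using c that by (auto simp: closed_classes_def list_all_iff prim_def)
  have ex: "\<exists>p\<in>set L. eqv M v p" if "prim M v" for v
    using that
  proof (rule prim_induct)
    show "\<exists>p\<in>set L. eqv M (1, 0) p" using c by (auto simp: closed_classes_def list_ex_iff)
  next
    fix v assume v: "prim M v" "\<exists>p\<in>set L. eqv M v p"
    then obtain p where p: "p \<in> set L" "eqv M v p" by blast
    have "\<exists>q\<in>set L. eqv M (S2 \<cdot> p) q" "\<exists>q\<in>set L. eqv M (U2 \<cdot> p) q"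
      using c p(1) by (auto simp: closed_classes_def list_all_iff list_ex_iff)
    then show "\<exists>p\<in>set L. eqv M (S2 \<cdot> v) p" "\<exists>p\<in>set L. eqv M (U2 \<cdot> v) p"
      using eqv_app[OF p(2)] prim_SL[OF _ pr[OF p(1)]] by (meson S2_in U2_in eqv_trans)+
  next
    fix v w assume "prim M v" "eqv M v w" "\<exists>p\<in>set L. eqv M v p"
    then show "\<exists>p\<in>set L. eqv M w p" using eqv_sym eqv_trans by blast
  qed
  show ?thesis
    by unfold_locales (use M assms(2,3) pr ex distinct_classes_eq[OF d] in auto)
qed

definition same_cusp :: "nat \<Rightarrow> int \<times> int \<Rightarrow> int \<times> int \<Rightarrow> bool"
  where "same_cusp M c q \<longleftrightarrow> (\<exists>k. eqv M ((1, k, 0, 1) \<cdot> c) q)"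

lemma same_cusp_nat:
  assumes "M > 0" "same_cusp M c q"
  shows "\<exists>k<M. eqv M ((1, int k, 0, 1) \<cdot> c) q"
proof -
  obtain k where k: "eqv M ((1, k, 0, 1) \<cdot> c) q" using assms(2) by (auto simp: same_cusp_def)
  obtain x y z t where c: "c = (x, y)" "q = (z, t)" by (cases c; cases q)
  let ?k = "k mod int M"
  have "wedge ((1, k, 0, 1) \<cdot> c) q - wedge ((1, ?k, 0, 1) \<cdot> c) q = (k - ?k) * (y * t)"
    by (simp add: c wedge_def algebra_simps)
  moreover have "int M dvd k - ?k" by (simp add: mod_eq_dvd_iff[symmetric])
  ultimately have "eqv M ((1, ?k, 0, 1) \<cdot> c) q"
    using k unfolding eqv_def by (metis dvd_diffD dvd_diff_commute dvd_mult2 dvd_diff_left_iff)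
  moreover have "?k = int (nat ?k)" "nat ?k < M" using assms(1) by (auto simp: nat_less_iff)
  ultimately show ?thesis by metis
qed

lemma same_cusp_T2: "same_cusp M c (T2 \<cdot> q) \<longleftrightarrow> same_cusp M c q"
proof -
  have 1: "T2 \<cdot> (1, k, 0, 1) \<cdot> c = (1, k + 1, 0, 1) \<cdot> c" for k
    by (cases c) (simp add: T2_def algebra_simps)
  have iff: "eqv M (T2 \<cdot> v) (T2 \<cdot> w) \<longleftrightarrow> eqv M v w" for v w
    by (rule eqv_app_iff) (simp add: T2_def)
  show ?thesis
    unfolding same_cusp_def using 1 iff by (metis diff_add_cancel)
qed

lemma coprime_snd_eqv:
  assumes "prim M w" "eqv M v w" "coprime (snd v) (int M)"
  shows "coprime (snd w) (int M)"
proof (rule coprimeI)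
  fix e assume e: "e dvd snd w" "e dvd int M"
  have "e dvd fst v * snd w - snd v * fst w"
    using assms(2) e(2) by (auto simp: eqv_def wedge_def intro: dvd_trans)
  then have "e dvd snd v * fst w" using e(1) by (metis dvd_diff_right_iff dvd_mult)
  moreover have "coprime e (snd v)"
    using assms(3) e(2) by (metis coprime_commute coprime_divisors dvd_refl)
  ultimately have "e dvd fst w" by (simp add: coprime_dvd_mult_right_iff)
  then show "is_unit e"
    using assms(1) e unfolding prim_def by (meson coprime_common_divisor gcd_greatest)
qed

definition edge :: "nat \<Rightarrow> int \<times> int \<Rightarrow> int \<times> int \<Rightarrow> real"
  where "edge M p q = delta M p q - delta M (S2 \<cdot> p) q"

text \<open>For \<open>c \<in> C\<close> the edge \<open>c\<close> joins its cusp to the cusp of \<open>0\<close>; these edges form a spanning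
  tree of the cusps, and \<open>cusp_path\<close> is the path in that tree from the cusp of \<open>0\<close> to the cusp of \<open>q\<close>.\<close>

definition cusp_path :: "nat \<Rightarrow> (int \<times> int) list \<Rightarrow> int \<times> int \<Rightarrow> int \<times> int \<Rightarrow> real"
  where "cusp_path M C p q = (\<Sum>c\<in>set C. of_bool (same_cusp M c q) * edge M p c)"

text \<open>\<open>y\<close> is a chain of triangles whose boundary is the edge \<open>q\<close> closed up by tree paths.\<close>

definition fills :: "nat \<Rightarrow> (int \<times> int) list \<Rightarrow> int \<times> int \<Rightarrow> (int \<times> int \<Rightarrow> real) \<Rightarrow> bool"
  where "fills M C q y \<longleftrightarrow> proj_fun M y \<and> (\<forall>p. prim M p \<longrightarrow> y (U2 \<cdot> p) = y p \<and>
    edge M p q = cusp_path M C p q - cusp_path M C p (S2 \<cdot> q) + (y p - y (S2 \<cdot> p)))"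

lemma fillsD:
  assumes "fills M C q y" "prim M p"
  shows "y (U2 \<cdot> p) = y p"
    "edge M p q = cusp_path M C p q - cusp_path M C p (S2 \<cdot> q) + (y p - y (S2 \<cdot> p))"
  using assms unfolding fills_def by blast+

lemma proj_ker_edge: "proj_ker M (edge M)"
  unfolding proj_ker_def edge_def
proof (intro allI impI, elim conjE)
  fix v v' w w' assume *: "prim M v" "prim M v'" "prim M w" "prim M w'" "eqv M v v'" "eqv M w w'"
  have "delta M v w = delta M v' w'" by (rule proj_kerD[OF proj_ker_delta *])
  moreover have "delta M (S2 \<cdot> v) w = delta M (S2 \<cdot> v') w'"
    by (rule proj_kerD[OF proj_ker_delta]) (simp_all add: * prim_SL eqv_app)
  ultimately show "delta M v w - delta M (S2 \<cdot> v) w = delta M v' w' - delta M (S2 \<cdot> v') w'" by simp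
qed

lemma same_cusp_eqv: "prim M q \<Longrightarrow> prim M q' \<Longrightarrow> eqv M q q' \<Longrightarrow> same_cusp M c q \<longleftrightarrow> same_cusp M c q'"
  unfolding same_cusp_def using eqv_trans eqv_sym by blast

lemma proj_ker_cusp_path:
  assumes "\<And>c. c \<in> set C \<Longrightarrow> prim M c"
  shows "proj_ker M (cusp_path M C)"
  unfolding proj_ker_def cusp_path_def
proof (intro allI impI sum.cong refl, elim conjE)
  fix v v' w w' c
  assume c: "c \<in> set C" and *: "prim M v" "prim M v'" "prim M w" "prim M w'" "eqv M v v'" "eqv M w w'"
  have "edge M v c = edge M v' c"
    by (rule proj_kerD[OF proj_ker_edge *(1,2) _ _ *(5) eqv_refl]) (simp_all add: assms c)
  then show "of_bool (same_cusp M c w) * edge M v c = of_bool (same_cusp M c w') * edge M v' c"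
    using same_cusp_eqv[OF *(3,4,6)] by simp
qed

lemma edge_S2:
  assumes "prim M p" "prim M q"
  shows "edge M (S2 \<cdot> p) q = - edge M p q" "edge M p (S2 \<cdot> q) = - edge M p q"
proof -
  have 1: "delta M (S2 \<cdot> S2 \<cdot> p) q = delta M p q"
    by (rule proj_kerD[OF proj_ker_delta]) (use assms in \<open>simp_all add: prim_SL eqv_S2\<close>)
  have 2: "delta M (S2 \<cdot> p) (S2 \<cdot> v) = delta M p v" for v
    by (rule delta_app) (simp add: S2_def)
  have "delta M p (S2 \<cdot> q) = delta M (S2 \<cdot> p) (S2 \<cdot> S2 \<cdot> q)" by (rule 2[symmetric])
  also have "\<dots> = delta M (S2 \<cdot> p) q"
    by (rule proj_kerD[OF proj_ker_delta]) (use assms in \<open>simp_all add: prim_SL eqv_S2\<close>)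
  finally have 3: "delta M p (S2 \<cdot> q) = delta M (S2 \<cdot> p) q" .
  show "edge M (S2 \<cdot> p) q = - edge M p q" "edge M p (S2 \<cdot> q) = - edge M p q"
    using 1 2 3 by (simp_all add: edge_def)
qed

lemma cusp_path_T2: "cusp_path M C p (T2 \<cdot> q) = cusp_path M C p q"
  by (simp add: cusp_path_def same_cusp_T2)

lemma proj_fun_add: "proj_fun M f \<Longrightarrow> proj_fun M g \<Longrightarrow> proj_fun M (\<lambda>p. f p + g p :: real)"
  and proj_fun_diff: "proj_fun M f \<Longrightarrow> proj_fun M g \<Longrightarrow> proj_fun M (\<lambda>p. f p - g p :: real)"
  unfolding proj_fun_def
  by (intro allI impI arg_cong2[of _ _ _ _ "(+)"]; blast) (intro allI impI arg_cong2[of _ _ _ _ "(-)"]; blast)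

section \<open>Filling edges by triangles\<close>

locale cusp_tree =
  fixes M :: nat and C :: "(int \<times> int) list"
  assumes M_pos: "M > 0" and reps: "cusp_reps M C"
begin

abbreviation "path \<equiv> cusp_path M C"

lemma coprime_C: "c \<in> set C \<Longrightarrow> coprime (fst c) (int M)" "c \<in> set C \<Longrightarrow> \<not> coprime (snd c) (int M)"
  using reps by (auto simp: cusp_reps_def list_all_iff)

lemma prim_C: "c \<in> set C \<Longrightarrow> prim M c"
  using coprime_C(1)[of c] unfolding prim_def
  by (meson coprime_divisors dvd_refl gcd_dvd1)

lemma cong_path:
  "prim M p \<Longrightarrow> prim M p' \<Longrightarrow> prim M q \<Longrightarrow> prim M q' \<Longrightarrow> eqv M p p' \<Longrightarrow> eqv M q q' \<Longrightarrow>
    path p q = path p' q'"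
  by (rule proj_kerD[OF proj_ker_cusp_path[OF prim_C]])

lemma path_SU:
  assumes "prim M p" "prim M q"
  shows "path p (S2 \<cdot> U2 \<cdot> q) = path p q"
proof -
  have "path p (S2 \<cdot> U2 \<cdot> q) = path p (adj2 T2 \<cdot> q)"
    by (rule cong_path) (use assms in \<open>simp_all add: prim_SL eqv_SU\<close>)
  also have "\<dots> = path p (T2 \<cdot> adj2 T2 \<cdot> q)" by (rule cusp_path_T2[symmetric])
  also have "\<dots> = path p q" by (simp add: adj2_app_cancel)
  finally show ?thesis .
qed

lemma path_S:
  assumes "prim M p" "prim M q"
  shows "path p (S2 \<cdot> q) = path p (U2 \<cdot> U2 \<cdot> q)"
proof -
  have "path p (S2 \<cdot> q) = path p (S2 \<cdot> U2 \<cdot> U2 \<cdot> U2 \<cdot> q)"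
    by (rule cong_path) (use assms in \<open>simp_all add: prim_SL eqv_app eqv_U2 eqv_sym\<close>)
  then show ?thesis using assms by (simp add: path_SU prim_SL)
qed

text \<open>Vectors whose second coordinate is coprime to M form the cusp of 0, the root of the
  tree, and no c in C belongs to it.\<close>

lemma path_base:
  assumes "prim M q" "coprime (snd q) (int M)"
  shows "path p q = 0"
proof -
  have "\<not> same_cusp M c q" if c: "c \<in> set C" for c
  proof
    assume "same_cusp M c q"
    then obtain k where k: "eqv M ((1, k, 0, 1) \<cdot> c) q" by (auto simp: same_cusp_def)
    have "coprime (snd ((1, k, 0, 1) \<cdot> c)) (int M)"
      by (rule coprime_snd_eqv[OF prim_SL[OF shear_in prim_C[OF c]] eqv_sym[OF k] assms(2)])
    then show False using coprime_C(2)[OF c] by (cases c) simp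
  qed
  then show ?thesis by (simp add: cusp_path_def)
qed

lemma path_C:
  assumes "q \<in> set C"
  shows "path p q = edge M p q"
proof -
  have "same_cusp M c q \<longleftrightarrow> c = q" if c: "c \<in> set C" for c
  proof
    assume "same_cusp M c q"
    then obtain k where "k < M" "eqv M ((1, int k, 0, 1) \<cdot> c) q" using same_cusp_nat[OF M_pos] by blast
    moreover have "c = q \<or> (\<forall>k\<in>set [0..<M]. \<not> eqv M ((1, int k, 0, 1) \<cdot> c) q)"
      using reps c assms unfolding cusp_reps_def list_all_iff by blast
    ultimately show "c = q" by auto
  next
    assume "c = q"
    then show "same_cusp M c q" unfolding same_cusp_def by (intro exI[of _ 0]) simp
  qed
  then have "path p q = (\<Sum>c\<in>set C. of_bool (c = q) * edge M p c)"
    unfolding cusp_path_def by (intro sum.cong) auto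
  also have "\<dots> = edge M p q" using assms by (simp add: of_bool_def if_distrib[of "\<lambda>x. x * _"] cong: if_cong)
  finally show ?thesis .
qed

lemma fills_eqv:
  assumes "prim M q" "prim M q'" "eqv M q q'"
  shows "fills M C q y \<longleftrightarrow> fills M C q' y"
proof -
  have "edge M p q = edge M p q'" "path p q = path p q'"
    "path p (S2 \<cdot> q) = path p (S2 \<cdot> q')" if "prim M p" for p
    using that assms
    by (auto intro!: proj_kerD[OF proj_ker_edge] cong_path prim_SL eqv_app)
  then show ?thesis by (simp add: fills_def cong: conj_cong imp_cong)
qed

lemma fills_C:
  assumes "q \<in> set C"
  shows "fills M C q (\<lambda>_. 0)"
proof -
  have "coprime (snd (S2 \<cdot> q)) (int M)" using coprime_C(1)[OF assms] by (cases q) (simp add: S2_def)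
  then have "path p (S2 \<cdot> q) = 0" for p
    using prim_C[OF assms] by (intro path_base) (simp_all add: prim_SL)
  then show ?thesis using path_C[OF assms] by (simp add: fills_def proj_fun_def)
qed

lemma fills_S2:
  assumes "prim M q" "fills M C (S2 \<cdot> q) y"
  shows "fills M C q (\<lambda>p. - y p)"
proof -
  have "path p (S2 \<cdot> S2 \<cdot> q) = path p q" if "prim M p" for p
    by (rule cong_path) (use that assms in \<open>simp_all add: prim_SL eqv_S2\<close>)
  then show ?thesis
    using assms unfolding fills_def by (auto simp: proj_fun_def edge_S2 algebra_simps)
qed

text \<open>Such an edge equals its own negative, hence is 0, and both its ends lie in the same
  cusp, so the paths cancel.\<close>

lemma fills_S2_fixed:
  assumes "prim M q" "eqv M (S2 \<cdot> q) q"
  shows "fills M C q (\<lambda>_. 0)"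
proof -
  have "edge M p (S2 \<cdot> q) = edge M p q" "path p (S2 \<cdot> q) = path p q" if "prim M p" for p
    using that assms by (auto intro!: proj_kerD[OF proj_ker_edge] cong_path prim_SL)
  then show ?thesis using edge_S2(2)[OF _ assms(1)] by (simp add: fills_def proj_fun_def)
qed

lemma delta_U2:
  assumes "prim M p" "prim M q"
  shows "delta M (U2 \<cdot> p) (U2 \<cdot> q) = delta M p q" "delta M (U2 \<cdot> p) q = delta M p (U2 \<cdot> U2 \<cdot> q)"
proof -
  show *: "delta M (U2 \<cdot> p) (U2 \<cdot> q) = delta M p q" for q by (rule delta_app) (simp add: U2_def)
  have "delta M (U2 \<cdot> p) q = delta M (U2 \<cdot> p) (U2 \<cdot> U2 \<cdot> U2 \<cdot> q)"
    by (rule proj_kerD[OF proj_ker_delta]) (use assms in \<open>simp_all add: prim_SL eqv_U2 eqv_sym\<close>)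
  then show "delta M (U2 \<cdot> p) q = delta M p (U2 \<cdot> U2 \<cdot> q)" by (simp add: *)
qed

lemma proj_fun_delta: "prim M q \<Longrightarrow> proj_fun M (\<lambda>p. delta M p q)"
  unfolding proj_fun_def by (auto intro!: proj_kerD[OF proj_ker_delta])

text \<open>The three edges of the triangle coincide, so the folded triangle has this single edge as
  its boundary; both ends lie in the same cusp and the paths cancel.\<close>

lemma fills_U2_fixed:
  assumes "prim M q" "eqv M (U2 \<cdot> q) q"
  shows "fills M C q (\<lambda>p. delta M p q)"
proof -
  have "path p (S2 \<cdot> q) = path p q" if "prim M p" for p
  proof -
    have "path p (S2 \<cdot> U2 \<cdot> q) = path p (S2 \<cdot> q)"
      by (rule cong_path) (use that assms in \<open>simp_all add: prim_SL eqv_app\<close>)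
    then show ?thesis using path_SU[OF that assms(1)] by simp
  qed
  moreover have "delta M (U2 \<cdot> p) q = delta M p q" if p: "prim M p" for p
  proof -
    have "delta M (U2 \<cdot> p) (U2 \<cdot> q) = delta M (U2 \<cdot> p) q"
      by (rule proj_kerD[OF proj_ker_delta]) (use p assms in \<open>simp_all add: prim_SL\<close>)
    then show ?thesis using delta_U2(1)[OF p assms(1)] by simp
  qed
  ultimately show ?thesis using proj_fun_delta[OF assms(1)] by (simp add: fills_def edge_def)
qed

text \<open>The edge is the boundary of the triangle minus the other two edges, and the paths
  telescope around the triangle.\<close>

lemma fills_triangle:
  assumes q: "prim M q" and y: "fills M C (U2 \<cdot> q) y" "fills M C (U2 \<cdot> U2 \<cdot> q) y'"
  shows "fills M C q (\<lambda>p. delta M p q + delta M p (U2 \<cdot> q) + delta M p (U2 \<cdot> U2 \<cdot> q) - y p - y' p)"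
proof -
  have pr: "prim M (U2 \<cdot> q)" "prim M (U2 \<cdot> U2 \<cdot> q)" using q by (simp_all add: prim_SL)
  have pf: "proj_fun M (\<lambda>p. delta M p q + delta M p (U2 \<cdot> q) + delta M p (U2 \<cdot> U2 \<cdot> q) - y p - y' p)"
    using y by (intro proj_fun_diff proj_fun_add proj_fun_delta q pr) (simp_all add: fills_def)
  have e: "edge M p (U2 \<cdot> q) = path p (U2 \<cdot> q) - path p q + (y p - y (S2 \<cdot> p))"
    "edge M p (U2 \<cdot> U2 \<cdot> q) = path p (S2 \<cdot> q) - path p (U2 \<cdot> q) + (y' p - y' (S2 \<cdot> p))"
    "y (U2 \<cdot> p) = y p" "y' (U2 \<cdot> p) = y' p" if "prim M p" for p
    using fillsD[OF y(1) that] fillsD[OF y(2) that] path_SU[OF that q] path_SU[OF that pr(1)] path_S[OF that q]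
    by simp_all
  show ?thesis
    unfolding fills_def
  proof (intro conjI allI impI pf)
    fix p assume p: "prim M p"
    show "delta M (U2 \<cdot> p) q + delta M (U2 \<cdot> p) (U2 \<cdot> q) + delta M (U2 \<cdot> p) (U2 \<cdot> U2 \<cdot> q) - y (U2 \<cdot> p) - y' (U2 \<cdot> p) =
        delta M p q + delta M p (U2 \<cdot> q) + delta M p (U2 \<cdot> U2 \<cdot> q) - y p - y' p"
      using delta_U2[OF p q] delta_U2(1)[OF p pr(1)] e[OF p] by simp
    show "edge M p q = path p q - path p (S2 \<cdot> q) +
        (delta M p q + delta M p (U2 \<cdot> q) + delta M p (U2 \<cdot> U2 \<cdot> q) - y p - y' p -
        (delta M (S2 \<cdot> p) q + delta M (S2 \<cdot> p) (U2 \<cdot> q) + delta M (S2 \<cdot> p) (U2 \<cdot> U2 \<cdot> q) - y (S2 \<cdot> p) - y' (S2 \<cdot> p)))"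
      using e(1,2)[OF p] by (simp add: edge_def)
  qed
qed

lemma known_order_fills:
  assumes "known_order M C K qs" "\<And>q. q \<in> set K \<union> set qs \<Longrightarrow> prim M q" "\<And>q. q \<in> set K \<Longrightarrow> \<exists>y. fills M C q y"
    "q \<in> set qs"
  shows "\<exists>y. fills M C q y"
  using assms
proof (induction qs arbitrary: K)
  case (Cons r qs)
  have r: "prim M r" using Cons.prems(2) by simp
  have ex: "\<exists>y. fills M C w y" if "list_ex (eqv M w) K" "prim M w" for w
    using that Cons.prems(2,3) fills_eqv by (metis UnI1 list_ex_iff)
  consider "r \<in> set C" | "eqv M (S2 \<cdot> r) r" | "eqv M (U2 \<cdot> r) r" | "list_ex (eqv M (S2 \<cdot> r)) K"
    | "list_ex (eqv M (U2 \<cdot> r)) K" "list_ex (eqv M (U2 \<cdot> U2 \<cdot> r)) K"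
    using Cons.prems(1) by auto
  then have fr: "\<exists>y. fills M C r y"
  proof cases
    case 1 then show ?thesis using fills_C by blast
  next
    case 2 then show ?thesis using fills_S2_fixed[OF r] by blast
  next
    case 3 then show ?thesis using fills_U2_fixed[OF r] by blast
  next
    case 4 then show ?thesis using ex fills_S2[OF r] r by (metis S2_in prim_SL)
  next
    case 5 then show ?thesis using ex fills_triangle[OF r] r by (metis U2_in prim_SL)
  qed
  show ?case
  proof (cases "q = r")
    case False
    show ?thesis
    proof (rule Cons.IH[of "r # K"])
      show "known_order M C (r # K) qs" using Cons.prems(1) by simp
      show "q \<in> set qs" using False Cons.prems(4) by simp
      show "prim M w" if "w \<in> set (r # K) \<union> set qs" for w
        by (rule Cons.prems(2)) (use that in simp)
      show "\<exists>y. fills M C w y" if "w \<in> set (r # K)" for w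
        using that fr Cons.prems(3)[of w] by (cases "w = r") simp_all
    qed
  qed (simp add: fr)
qed simp

end

theorem genus_zero_exists:
  assumes cert: "genus_zero_cert M C L" and N: "N > 0" "coprime N M"
  shows "\<exists>X Y. genus_zero M N (set L) X Y (1, 0) (0, 1)"
proof -
  interpret proj_line M N "set L" by (rule proj_line_cert[OF cert N])
  interpret cusp_tree M C by unfold_locales (use cert in \<open>auto simp: genus_zero_cert_def\<close>)
  \<comment> \<open>The choice depends on q only through the predicate \<open>fills M C q\<close>,
    so equivalent q receive the same chain.\<close>
  define y where "y q = (SOME y. fills M C q y)" for q
  have ex: "\<exists>y. fills M C q y" if q: "prim M q" for q
  proof -
    obtain p where p: "p \<in> set L" "eqv M q p" using P_ex[OF q] by blast
    have "\<exists>y. fills M C p y"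
      by (rule known_order_fills[of "[]" L]) (use cert p P_prim in \<open>auto simp: genus_zero_cert_def\<close>)
    then show ?thesis using fills_eqv[OF q P_prim[OF p(1)] p(2)] by blast
  qed
  have y: "fills M C q (y q)" if "prim M q" for q
    unfolding y_def by (rule someI_ex[OF ex[OF that]])
  have y_eqv: "y q = y q'" if "prim M q" "prim M q'" "eqv M q q'" for q q'
  proof -
    have "fills M C q = fills M C q'" by (rule ext) (rule fills_eqv[OF that])
    then show ?thesis by (simp add: y_def)
  qed
  \<comment> \<open>Antisymmetrizing makes the filling odd under \<open>S2\<close>. Subtracting the
    value at (1, 0) changes it by a 2-cycle only and makes Y vanish there.\<close>
  define D where "D p q = (y q p - y (S2 \<cdot> q) p) / 2" for p q
  define Y where "Y p q = D p q - D (1, 0) q" for p q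
  have y_cong: "y q p = y q' p'" if "prim M p" "prim M p'" "prim M q" "prim M q'" "eqv M p p'" "eqv M q q'" for p p' q q'
  proof -
    have "y q p = y q p'" using y[OF that(3)] that unfolding fills_def proj_fun_def by blast
    also have "\<dots> = y q' p'" by (simp only: y_eqv[OF that(3,4,6)])
    finally show ?thesis .
  qed
  have D_cong: "D p q = D p' q'" if "prim M p" "prim M p'" "prim M q" "prim M q'" "eqv M p p'" "eqv M q q'" for p p' q q'
    using y_cong[OF that] y_cong[OF that(1,2) _ _ that(5), of "S2 \<cdot> q" "S2 \<cdot> q'"] that
    by (simp add: D_def prim_SL eqv_app)
  have D_S2: "D p (S2 \<cdot> q) = - D p q" if "prim M p" "prim M q" for p q
    using y_cong[of p p "S2 \<cdot> S2 \<cdot> q" q] that by (simp add: D_def prim_SL eqv_S2 field_simps)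
  have y_U2: "y q (U2 \<cdot> p) = y q p" if "prim M p" "prim M q" for p q
    using y[OF that(2)] that unfolding fills_def by blast
  have path_SS: "path p (S2 \<cdot> S2 \<cdot> q) = path p q" if "prim M p" "prim M q" for p q
    by (rule cong_path) (use that in \<open>simp_all add: prim_SL eqv_S2\<close>)
  have "genus_zero M N (set L) (path) Y (1, 0) (0, 1)"
  proof unfold_locales
    show "proj_ker M (path)" by (rule proj_ker_cusp_path[OF prim_C])
    show "proj_ker M Y" unfolding proj_ker_def Y_def
    proof (intro allI impI, elim conjE)
      fix v v' w w' assume *: "prim M v" "prim M v'" "prim M w" "prim M w'" "eqv M v v'" "eqv M w w'"
      show "D v w - D (1, 0) w = D v' w' - D (1, 0) w'"
        using D_cong[OF *] D_cong[OF prim_10 prim_10 *(3,4) eqv_refl *(6)] by simp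
    qed
    fix p q assume p: "prim M p" and q: "prim M q"
    have Sq: "prim M (S2 \<cdot> q)" using q by (simp add: prim_SL)
    show "path p (T2 \<cdot> q) = path p q" by (rule cusp_path_T2)
    show "path (S2 \<cdot> p) q = - path p q"
      unfolding cusp_path_def using p by (simp add: edge_S2 prim_C sum_negf)
    show "Y (U2 \<cdot> p) q = Y p q" using y_U2 p q Sq by (simp add: Y_def D_def)
    show "Y p (S2 \<cdot> q) = - Y p q" using D_S2[OF p q] D_S2[OF prim_10 q] by (simp add: Y_def)
    have "edge M p q = path p q - path p (S2 \<cdot> q) + (y q p - y q (S2 \<cdot> p))"
      "edge M p (S2 \<cdot> q) = path p (S2 \<cdot> q) - path p (S2 \<cdot> S2 \<cdot> q)
        + (y (S2 \<cdot> q) p - y (S2 \<cdot> q) (S2 \<cdot> p))"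
      using y[OF q] y[OF Sq] p unfolding fills_def by blast+
    then show "delta M p q - delta M (S2 \<cdot> p) q = path p q - path p (S2 \<cdot> q) + (Y p q - Y (S2 \<cdot> p) q)"
      using edge_S2(2)[OF p q] path_SS[OF p q] by (simp add: edge_def Y_def D_def field_simps)
  next
    show "prim M (1, 0)" by (rule prim_10)
    show "prim M (0, 1)" by (simp add: prim_def)
    show "Y (1, 0) q = 0" for q by (simp add: Y_def)
    show "path p (0, 1) = 0" for p by (rule path_base) (simp_all add: prim_def)
  qed
  then show ?thesis by blast
qed

section \<open>Fixed cusps and the class number relations\<close>

definition fixed_total :: "nat \<Rightarrow> (int \<times> int) list \<Rightarrow> int \<Rightarrow> nat"
  where "fixed_total M L r = sum_list (map (\<lambda>p. length
    (filter (\<lambda>k. eqv M ((1, int k, 0, 1) \<cdot> p) ((r, 0, 0, 1) \<cdot> p)) [0..<M])) L)"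

text \<open>On lines modulo M, diag(a, d) acts as diag(a/d, 1), so testing the units k modulo M
  covers all N at once. The factor M appears because every fixed cusp contributes M to the
  total.\<close>

definition fixed_cusps_cert :: "nat \<Rightarrow> (int \<times> int) list \<Rightarrow> nat \<Rightarrow> nat \<Rightarrow> nat \<Rightarrow> bool"
  where "fixed_cusps_cert M L q v w \<longleftrightarrow> q dvd M \<and>
    list_all (\<lambda>k. coprime (int k) (int M) \<longrightarrow>
      fixed_total M L (int k) = M * (if (int k - 1) mod int q = 0 then v else w)) [0..<M]"

lemma distinct_classes_distinct: "distinct_classes M L \<Longrightarrow> distinct L"
  by (induction L) (auto simp: list_ex_iff)

lemma fixed_cusps_value:
  assumes cert: "genus_zero_cert M C L" "fixed_cusps_cert M L q v w"
    and N: "N > 0" "coprime N M" and ad: "(a, d) \<in> factor_pairs N"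
  shows "proj_line.fixed_cusps M (set L) a d = real (if [a = d] (mod q) then v else w)"
proof -
  interpret proj_line M N "set L" by (rule proj_line_cert[OF cert(1) N])
  have "coprime (a * d) M" using ad N by (simp add: factor_pairs_def)
  then have cop: "coprime (int a) (int M)" "coprime (int d) (int M)" by simp_all
  obtain e where e: "[int d * e = 1] (mod int M)" using cong_solve_coprime_int[OF cop(2)] by blast
  define k where "k = nat ((int a * e) mod int M)"
  have k: "int k = (int a * e) mod int M" "k < M"
    using M_pos by (simp_all add: k_def nat_less_iff)
  have "[int d * int k = int d * (int a * e)] (mod int M)"
    unfolding k by (rule cong_scalar_left) (simp add: cong_def)
  also have "[int d * (int a * e) = int a * (int d * e)] (mod int M)" by (simp add: mult_ac)
  also have "[int a * (int d * e) = int a * 1] (mod int M)" by (rule cong_scalar_left[OF e])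
  finally have ka: "[int d * int k = int a] (mod int M)" by simp
  then have "coprime (int d * int k) (int M)" using cop(1) by (metis cong_imp_coprime cong_sym)
  then have kM: "coprime (int k) (int M)" by simp
  have eq: "eqv M ((1, int l, 0, 1) \<cdot> p) ((int a, 0, 0, int d) \<cdot> p) \<longleftrightarrow>
      eqv M ((1, int l, 0, 1) \<cdot> p) ((int k, 0, 0, 1) \<cdot> p)" if p: "p \<in> set L" for p l
  proof (rule eqv_cong)
    note pp = P_prim[OF p]
    show "prim M ((1, int l, 0, 1) \<cdot> p)" "prim M ((1, int l, 0, 1) \<cdot> p)"
      using pp by (simp_all add: prim_SL)
    show "prim M ((int a, 0, 0, int d) \<cdot> p)" "prim M ((int k, 0, 0, 1) \<cdot> p)"
      using cop kM pp by (auto intro!: prim_app)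
    obtain x y where xy: "p = (x, y)" by (cases p)
    have "wedge ((int a, 0, 0, int d) \<cdot> p) ((int k, 0, 0, 1) \<cdot> p) = - (x * y) * (int d * int k - int a)"
      by (simp add: xy wedge_def algebra_simps)
    then show "eqv M ((int a, 0, 0, int d) \<cdot> p) ((int k, 0, 0, 1) \<cdot> p)"
      using ka by (simp add: eqv_def cong_iff_dvd_diff)
  qed simp
  have len: "real (length (filter Q [0..<n])) = (\<Sum>l<n. of_bool (Q l))" for Q n
    by (induction n) simp_all
  have "real (fixed_total M L (int k)) =
      (\<Sum>p\<in>set L. \<Sum>l<M. of_bool (eqv M ((1, int l, 0, 1) \<cdot> p) ((int k, 0, 0, 1) \<cdot> p)))"
    using distinct_classes_distinct[of M L] cert(1)
    by (simp add: fixed_total_def genus_zero_cert_def sum_list_distinct_conv_sum_set len)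
  also have "\<dots> = real M * fixed_cusps a d"
    using M_pos by (simp add: fixed_cusps_def cusp_count_def delta_def eq)
  finally have tot: "real (fixed_total M L (int k)) = real M * fixed_cusps a d" .
  have q: "q dvd M" using cert(2) by (simp add: fixed_cusps_cert_def)
  then have "[int d * int k = int a] (mod int q)" using ka by (meson cong_dvd_modulus int_dvd_int_iff)
  moreover have "coprime (int d) (int q)" using cop(2) q by (metis coprime_divisors dvd_refl int_dvd_int_iff)
  ultimately have "(int k - 1) mod int q = 0 \<longleftrightarrow> [int a = int d] (mod int q)"
    by (metis cong_iff_dvd_diff cong_mult_lcancel cong_sym cong_trans mod_eq_0_iff_dvd mult.right_neutral)
  moreover have "fixed_total M L (int k) = M * (if (int k - 1) mod int q = 0 then v else w)"
    using cert(2) k(2) kM by (simp add: fixed_cusps_cert_def list_all_iff)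
  ultimately show ?thesis using tot M_pos by (simp add: cong_int_iff)
qed

text \<open>The common form of all the relations: \<open>v\<close> and \<open>w\<close> are the numbers of cusps fixed by
  \<open>diag(a, d)\<close> according to whether \<open>a \<equiv> d (mod q)\<close> or not.\<close>

definition hecke_relation :: "nat \<Rightarrow> nat \<Rightarrow> nat \<Rightarrow> nat \<Rightarrow> bool"
  where "hecke_relation M q v w \<longleftrightarrow> (\<forall>N. N > 0 \<and> coprime N M \<and> \<not> is_square N \<longrightarrow>
    (\<Sum>x | x\<^sup>2 < 4 * int N. hurwitz_class_number M (4 * int N - x\<^sup>2)) =
    2 * (\<Sum>(a, d)\<in>desc_pairs N.
      real a - (real (if [a = d] (mod q) then v else w) - 1) * real d))"

lemma hecke_relationI:
  assumes cert: "genus_zero_cert M C L" "fixed_cusps_cert M L q v w"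
  shows "hecke_relation M q v w"
  unfolding hecke_relation_def
proof (intro allI impI, elim conjE)
  fix N assume N: "N > 0" "coprime N M" "\<not> is_square N"
  obtain X Y where "genus_zero M N (set L) X Y (1, 0) (0, 1)"
    using genus_zero_exists[OF cert(1) N(1,2)] by blast
  then interpret genus_zero M N "set L" X Y "(1, 0)" "(0, 1)" .
  have fc: "fixed_cusps a d = real (if [a = d] (mod q) then v else w)" if "(a, d) \<in> factor_pairs N" for a d
    by (rule fixed_cusps_value[OF cert N(1,2) that])
  have "(\<Sum>x | x\<^sup>2 < 4 * int N. hurwitz_class_number M (4 * int N - x\<^sup>2)) =
    (\<Sum>(a, d)\<in>desc_pairs N. 2 * real (a + d) - real d * (fixed_cusps a d + fixed_cusps d a))"
    unfolding sum_hurwitz pair_wt_ell[OF N(3)] by simp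
  also have "\<dots> = (\<Sum>(a, d)\<in>desc_pairs N.
      2 * (real a - (real (if [a = d] (mod q) then v else w) - 1) * real d))"
  proof (rule sum.cong[OF refl])
    fix x assume x: "x \<in> desc_pairs N"
    obtain a d where ad: "x = (a, d)" by (cases x)
    have "(a, d) \<in> factor_pairs N" "(d, a) \<in> factor_pairs N"
      using x by (auto simp: ad factor_pairs_def mult.commute)
    then show "(case x of (a, d) \<Rightarrow> 2 * real (a + d) - real d * (fixed_cusps a d + fixed_cusps d a)) =
        (case x of (a, d) \<Rightarrow> 2 * (real a - (real (if [a = d] (mod q) then v else w) - 1) * real d))"
      by (simp add: ad fc cong_sym_eq[of d a] algebra_simps)
  qed
  finally show "(\<Sum>x | x\<^sup>2 < 4 * int N. hurwitz_class_number M (4 * int N - x\<^sup>2)) =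
    2 * (\<Sum>(a, d)\<in>desc_pairs N.
      real a - (real (if [a = d] (mod q) then v else w) - 1) * real d)"
    by (simp add: sum_distrib_left split_def)
qed

text \<open>Here and below, C has one vector for each cusp other than that of 0, so v is the length
  of C plus 1, and L lists the projective line in an elimination order. With q = 1 every cusp is
  fixed.\<close>

lemma hecke_relation_2: "hecke_relation 2 1 2 2"
  by (rule hecke_relationI[where C = "[(1, 0)]" and
      L = "[(1, 0), (1, 1), (0, 1)]"]; code_simp)

lemma hecke_relation_3: "hecke_relation 3 1 2 2"
  by (rule hecke_relationI[where C = "[(1, 0)]" and
      L = "[(1, 0), (1, 2), (0, 1), (1, 1)]"]; code_simp)

lemma hecke_relation_4: "hecke_relation 4 1 3 3"
  by (rule hecke_relationI[where C = "[(1, 0), (1, 2)]" and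
      L = "[(1, 0), (1, 2), (2, 1), (0, 1), (1, 1), (1, 3)]"]; code_simp)

lemma hecke_relation_5: "hecke_relation 5 1 2 2"
  by (rule hecke_relationI[where C = "[(1, 0)]" and
      L = "[(1, 0), (1, 2), (1, 3), (1, 4), (0, 1), (1, 1)]"]; code_simp)

lemma hecke_relation_6: "hecke_relation 6 1 4 4"
  by (rule hecke_relationI[where C = "[(1, 0), (1, 2), (1, 3)]" and
      L = "[(1, 0), (1, 2), (1, 3), (2, 5), (3, 1), (3, 2), (0, 1), (1, 1), (1, 5), (2, 1), (2, 3),
          (1, 4)]"]; code_simp)

lemma hecke_relation_7: "hecke_relation 7 1 2 2"
  by (rule hecke_relationI[where C = "[(1, 0)]" and
      L = "[(1, 0), (1, 3), (1, 5), (0, 1), (1, 1), (1, 2), (1, 4), (1, 6)]"]; code_simp)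

lemma hecke_relation_8: "hecke_relation 8 1 4 4"
  by (rule hecke_relationI[where C = "[(1, 0), (1, 2), (1, 4)]" and
      L = "[(1, 0), (1, 2), (1, 4), (2, 3), (4, 1), (0, 1), (1, 1), (1, 5), (1, 7), (2, 1), (1, 3),
          (1, 6)]"]; code_simp)

text \<open>diag(a, d) carries (1, 3) to (a, 3d), which lies in the cusp of (1, 6) unless a and d
  agree modulo 3, so two of the four cusps may be exchanged. The levels 16, 18 and 25 behave
  likewise with q = 4, 3 and 5.\<close>

lemma hecke_relation_9: "hecke_relation 9 3 4 2"
  by (rule hecke_relationI[where C = "[(1, 0), (1, 3), (1, 6)]" and
      L = "[(1, 0), (1, 3), (1, 6), (3, 1), (3, 2), (0, 1), (1, 1), (1, 4), (1, 7), (1, 8), (1, 2),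
          (1, 5)]"]; code_simp)

lemma hecke_relation_10: "hecke_relation 10 1 4 4"
  by (rule hecke_relationI[where C = "[(1, 0), (1, 2), (1, 5)]" and
      L = "[(1, 0), (1, 2), (1, 3), (1, 5), (1, 7), (2, 9), (5, 1), (0, 1), (1, 1), (1, 4), (1, 9),
          (2, 1), (2, 7), (5, 2), (1, 8), (2, 3), (2, 5), (1, 6)]"]; code_simp)

lemma hecke_relation_12: "hecke_relation 12 1 6 6"
  by (rule hecke_relationI[where C = "[(1, 0), (1, 2), (1, 3), (1, 4), (1, 6)]" and
      L = "[(1, 0), (1, 2), (1, 3), (1, 4), (1, 6), (2, 5), (3, 2), (3, 7), (4, 3), (4, 5), (6, 1),
          (0, 1), (1, 1), (1, 7), (1, 11), (2, 1), (2, 3), (3, 4), (1, 5), (1, 8), (1, 10), (3, 1),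
          (4, 1), (1, 9)]"]; code_simp)

lemma hecke_relation_13: "hecke_relation 13 1 2 2"
  by (rule hecke_relationI[where C = "[(1, 0)]" and
      L = "[(1, 0), (1, 4), (1, 5), (1, 8), (1, 10), (0, 1), (1, 1), (1, 3), (1, 6), (1, 9), (1, 11),
          (1, 12), (1, 2), (1, 7)]"]; code_simp)

lemma hecke_relation_16: "hecke_relation 16 4 6 4"
  by (rule hecke_relationI[where C = "[(1, 0), (1, 2), (1, 4), (1, 8), (1, 12)]" and
      L = "[(1, 0), (1, 2), (1, 4), (1, 8), (1, 12), (2, 7), (4, 1), (4, 3), (8, 1), (0, 1), (1, 1),
          (1, 5), (1, 9), (1, 13), (1, 15), (2, 1), (1, 3), (1, 6), (1, 7), (1, 11), (1, 14),
          (2, 3), (2, 5), (1, 10)]"]; code_simp)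

lemma hecke_relation_18: "hecke_relation 18 3 8 4"
  by (rule hecke_relationI[where C = "[(1, 0), (1, 2), (1, 3), (1, 6), (1, 9), (1, 12), (1, 15)]" and
      L = "[(1, 0), (1, 2), (1, 3), (1, 6), (1, 9), (1, 12), (1, 15), (2, 17), (3, 1), (3, 2),
          (3, 5), (6, 1), (6, 5), (9, 1), (0, 1), (1, 1), (1, 7), (1, 13), (1, 17), (2, 1),
          (2, 15), (1, 4), (1, 5), (1, 11), (1, 16), (2, 3), (2, 13), (3, 4), (1, 8), (2, 5),
          (2, 11), (9, 2), (1, 14), (2, 7), (2, 9), (1, 10)]"]; code_simp)

lemma hecke_relation_25: "hecke_relation 25 5 6 2"
  by (rule hecke_relationI[where C = "[(1, 0), (1, 5), (1, 10), (1, 15), (1, 20)]" and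
      L = "[(1, 0), (1, 5), (1, 7), (1, 10), (1, 15), (1, 18), (1, 20), (5, 1), (5, 2), (5, 3),
          (5, 4), (0, 1), (1, 1), (1, 6), (1, 11), (1, 16), (1, 21), (1, 24), (1, 4), (1, 8),
          (1, 9), (1, 14), (1, 19), (1, 22), (1, 3), (1, 12), (1, 17), (1, 23), (1, 2), (1, 13)]"]; code_simp)

section \<open>Specialization to residue classes of N\<close>

lemma hecke_relationD:
  assumes "hecke_relation M q v w" "N > 0" "coprime N M" "\<not> is_square N"
    and "\<And>a d. (a, d) \<in> factor_pairs N \<Longrightarrow> (if [a = d] (mod q) then v else w) = u"
  shows "(\<Sum>x | x\<^sup>2 < 4 * int N. hurwitz_class_number M (4 * int N - x\<^sup>2)) =
    2 * (\<Sum>(a, d)\<in>desc_pairs N. real a - (real u - 1) * real d)"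
proof -
  have "(\<Sum>(a, d)\<in>desc_pairs N.
      real a - (real (if [a = d] (mod q) then v else w) - 1) * real d) =
    (\<Sum>(a, d)\<in>desc_pairs N. real a - (real u - 1) * real d)"
    by (rule sum.cong[OF refl]) (use assms(5) in \<open>clarsimp split del: if_split\<close>)
  then show ?thesis using assms(1-4) unfolding hecke_relation_def by simp
qed

lemma sum_factor_pairs_abs_diff:
  assumes "N > 0" "\<not> is_square N"
  shows "(\<Sum>(a, d)\<in>factor_pairs N. \<bar>real a - real d\<bar>) =
    2 * (\<Sum>(a, d)\<in>desc_pairs N. real a - real d)"
  unfolding sum_factor_pairs_split[OF assms(2,1)] sum_distrib_left by (rule sum.cong) auto

lemma factor_pairs_mod: "(a, d) \<in> factor_pairs N \<Longrightarrow> N mod q = (a mod q) * (d mod q) mod q"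
  by (auto simp: factor_pairs_def mod_mult_eq)

lemma factor_pairs_cong_3:
  assumes "(a, d) \<in> factor_pairs N"
  shows "N mod 3 = 1 \<Longrightarrow> [a = d] (mod 3)" "N mod 3 = 2 \<Longrightarrow> \<not> [a = d] (mod 3)"
proof -
  have "a mod 3 = 0 \<or> a mod 3 = 1 \<or> a mod 3 = 2" "d mod 3 = 0 \<or> d mod 3 = 1 \<or> d mod 3 = 2"
    by presburger+
  then show "N mod 3 = 1 \<Longrightarrow> [a = d] (mod 3)" "N mod 3 = 2 \<Longrightarrow> \<not> [a = d] (mod 3)"
    using factor_pairs_mod[OF assms, of 3] by (auto simp: cong_def)
qed

lemma factor_pairs_cong_4:
  assumes "(a, d) \<in> factor_pairs N"
  shows "N mod 4 = 1 \<Longrightarrow> [a = d] (mod 4)" "N mod 4 = 3 \<Longrightarrow> \<not> [a = d] (mod 4)"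
proof -
  have "a mod 4 = 0 \<or> a mod 4 = 1 \<or> a mod 4 = 2 \<or> a mod 4 = 3"
    "d mod 4 = 0 \<or> d mod 4 = 1 \<or> d mod 4 = 2 \<or> d mod 4 = 3"
    by presburger+
  then show "N mod 4 = 1 \<Longrightarrow> [a = d] (mod 4)" "N mod 4 = 3 \<Longrightarrow> \<not> [a = d] (mod 4)"
    using factor_pairs_mod[OF assms, of 4] by (auto simp: cong_def)
qed

text \<open>If a and d agreed, N would be a square modulo 5, but 2 and 3 are not.\<close>

lemma factor_pairs_cong_5:
  assumes "(a, d) \<in> factor_pairs N" "N mod 5 = 2 \<or> N mod 5 = 3"
  shows "\<not> [a = d] (mod 5)"
proof
  assume "[a = d] (mod 5)"
  then have "N mod 5 = (a mod 5) * (a mod 5) mod 5"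
    using factor_pairs_mod[OF assms(1), of 5] by (simp add: cong_def)
  moreover have "a mod 5 = 0 \<or> a mod 5 = 1 \<or> a mod 5 = 2 \<or> a mod 5 = 3 \<or> a mod 5 = 4" by presburger
  ultimately show False using assms(2) by (elim disjE) simp_all
qed

theorem theorem1p1:
  fixes M N :: nat
  assumes M: "2 \<le> M \<and> M \<le> 10 \<or> M \<in> {12, 13, 16, 18, 25}"
    and N: "N > 0" "coprime N M" "\<not> is_square N"
  shows
    "(M \<in> {2, 3, 5, 7, 13} \<or>
      (M = 9 \<and> [int N = -1] (mod 3)) \<or>
      (M = 25 \<and> ([int N = 2] (mod 5) \<or> [int N = -2] (mod 5))) \<longrightarrow>
        (\<Sum>x | x\<^sup>2 < 4 * int N. hurwitz_class_number M (4 * int N - x\<^sup>2)) =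
        (\<Sum>(a, d) \<in> factor_pairs N. \<bar>real a - real d\<bar>))
   \<and> (M = 4 \<longrightarrow>
        (\<Sum>x | x\<^sup>2 < 4 * int N. hurwitz_class_number 4 (4 * int N - x\<^sup>2)) =
        2 * (\<Sum>(a, d) \<in> {(a, d) \<in> factor_pairs N. a > d}. real a - 2 * real d))
   \<and> (M \<in> {6, 8, 10} \<or>
      (M = 9 \<and> [int N = 1] (mod 3)) \<or>
      (M = 16 \<and> [int N = -1] (mod 4)) \<or>
      (M = 18 \<and> [int N = -1] (mod 6)) \<longrightarrow>
        (\<Sum>x | x\<^sup>2 < 4 * int N. hurwitz_class_number M (4 * int N - x\<^sup>2)) =
        2 * (\<Sum>(a, d) \<in> {(a, d) \<in> factor_pairs N. a > d}. real a - 3 * real d))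
   \<and> (M = 12 \<or>
      (M = 16 \<and> [int N = 1] (mod 4)) \<longrightarrow>
        (\<Sum>x | x\<^sup>2 < 4 * int N. hurwitz_class_number M (4 * int N - x\<^sup>2)) =
        2 * (\<Sum>(a, d) \<in> {(a, d) \<in> factor_pairs N. a > d}. real a - 5 * real d))
   \<and> (M = 18 \<and> [int N = 1] (mod 6) \<longrightarrow>
        (\<Sum>x | x\<^sup>2 < 4 * int N. hurwitz_class_number 18 (4 * int N - x\<^sup>2)) =
        2 * (\<Sum>(a, d) \<in> {(a, d) \<in> factor_pairs N. a > d}. real a - 7 * real d))
   \<and> (M = 25 \<and> ([int N = 1] (mod 5) \<or> [int N = -1] (mod 5)) \<longrightarrow>
        (\<Sum>x | x\<^sup>2 < 4 * int N. hurwitz_class_number 25 (4 * int N - x\<^sup>2)) =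
        (\<Sum>(a, d) \<in> factor_pairs N. \<bar>real a - real d\<bar>) -
        8 * (\<Sum>(a, d) \<in> {(a, d) \<in> factor_pairs N. a > d \<and> [a = d] (mod 5)}. real d))"
proof -
  let ?H = "\<lambda>M. \<Sum>x | x\<^sup>2 < 4 * int N. hurwitz_class_number M (4 * int N - x\<^sup>2)"
  note rel = hecke_relationD[OF _ N(1) _ N(3)]
  \<comment> \<open>For M = 18 the number of fixed cusps depends on a and d modulo 3 only, so the
    classes modulo 6 are reduced to classes modulo 3.\<close>
  have res: "[int N = -1] (mod 3) \<Longrightarrow> N mod 3 = 2" "[int N = 1] (mod 3) \<Longrightarrow> N mod 3 = 1"
    "[int N = -1] (mod 4) \<Longrightarrow> N mod 4 = 3" "[int N = 1] (mod 4) \<Longrightarrow> N mod 4 = 1"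
    "[int N = -1] (mod 6) \<Longrightarrow> N mod 3 = 2" "[int N = 1] (mod 6) \<Longrightarrow> N mod 3 = 1"
    "[int N = 2] (mod 5) \<Longrightarrow> N mod 5 = 2" "[int N = -2] (mod 5) \<Longrightarrow> N mod 5 = 3"
    unfolding cong_def by (simp, presburger)+
  have 1: "?H M = (\<Sum>(a, d) \<in> factor_pairs N. \<bar>real a - real d\<bar>)"
    if "M \<in> {2, 3, 5, 7, 13} \<or> (M = 9 \<and> [int N = -1] (mod 3)) \<or>
      (M = 25 \<and> ([int N = 2] (mod 5) \<or> [int N = -2] (mod 5)))"
  proof -
    have "?H M = 2 * (\<Sum>(a, d)\<in>desc_pairs N. real a - (real 2 - 1) * real d)"
      using that
    proof (elim disjE conjE)
      assume "M \<in> {2, 3, 5, 7, 13}"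
      then show ?thesis
        using N(2) rel[OF hecke_relation_2, of 2] rel[OF hecke_relation_3, of 2]
          rel[OF hecke_relation_5, of 2] rel[OF hecke_relation_7, of 2]
          rel[OF hecke_relation_13, of 2] by auto
    next
      assume "M = 9" "[int N = -1] (mod 3)"
      then show ?thesis
        using N(2) rel[OF hecke_relation_9, of 2] factor_pairs_cong_3 res by simp
    next
      assume "M = 25" "[int N = 2] (mod 5)"
      then show ?thesis
        using N(2) rel[OF hecke_relation_25, of 2] factor_pairs_cong_5 res by simp
    next
      assume "M = 25" "[int N = -2] (mod 5)"
      then show ?thesis
        using N(2) rel[OF hecke_relation_25, of 2] factor_pairs_cong_5 res by simp
    qed
    then show ?thesis by (simp add: sum_factor_pairs_abs_diff[OF N(1,3)])
  qed
  have 2: "?H 4 = 2 * (\<Sum>(a, d)\<in>desc_pairs N. real a - 2 * real d)" if "M = 4"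
    using that N(2) rel[OF hecke_relation_4, of 3] by simp
  have 3: "?H M = 2 * (\<Sum>(a, d)\<in>desc_pairs N. real a - 3 * real d)"
    if "M \<in> {6, 8, 10} \<or> (M = 9 \<and> [int N = 1] (mod 3)) \<or> (M = 16 \<and> [int N = -1] (mod 4)) \<or>
      (M = 18 \<and> [int N = -1] (mod 6))"
    using that
  proof (elim disjE conjE)
    assume "M \<in> {6, 8, 10}"
    then show ?thesis
      using N(2) rel[OF hecke_relation_6, of 4] rel[OF hecke_relation_8, of 4]
        rel[OF hecke_relation_10, of 4] by auto
  next
    assume "M = 9" "[int N = 1] (mod 3)"
    then show ?thesis
      using N(2) rel[OF hecke_relation_9, of 4] factor_pairs_cong_3 res by simp
  next
    assume "M = 16" "[int N = -1] (mod 4)"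
    then show ?thesis
      using N(2) rel[OF hecke_relation_16, of 4] factor_pairs_cong_4 res by simp
  next
    assume "M = 18" "[int N = -1] (mod 6)"
    then show ?thesis
      using N(2) rel[OF hecke_relation_18, of 4] factor_pairs_cong_3 res by simp
  qed
  have 4: "?H M = 2 * (\<Sum>(a, d)\<in>desc_pairs N. real a - 5 * real d)"
    if "M = 12 \<or> (M = 16 \<and> [int N = 1] (mod 4))"
    using that
  proof (elim disjE conjE)
    assume "M = 12"
    then show ?thesis using N(2) rel[OF hecke_relation_12, of 6] by simp
  next
    assume "M = 16" "[int N = 1] (mod 4)"
    then show ?thesis
      using N(2) rel[OF hecke_relation_16, of 6] factor_pairs_cong_4 res by simp
  qed
  have 5: "?H 18 = 2 * (\<Sum>(a, d)\<in>desc_pairs N. real a - 7 * real d)" if "M = 18" "[int N = 1] (mod 6)"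
    using that N(2) rel[OF hecke_relation_18, of 8] factor_pairs_cong_3 res by simp
  have 6: "?H 25 = (\<Sum>(a, d) \<in> factor_pairs N. \<bar>real a - real d\<bar>) -
      8 * (\<Sum>(a, d) \<in> {(a, d) \<in> factor_pairs N. a > d \<and> [a = d] (mod 5)}. real d)" if "M = 25"
  proof -
    have fin: "finite (desc_pairs N)" by (rule finite_subset[OF _ finite_factor_pairs[OF N(1)]]) auto
    have "(\<Sum>(a, d) \<in> {(a, d) \<in> factor_pairs N. a > d \<and> [a = d] (mod 5)}. real d) =
        (\<Sum>(a, d)\<in>desc_pairs N. if [a = d] (mod 5) then real d else 0)"
      using sum.inter_filter[OF fin, of "\<lambda>x. real (snd x)" "\<lambda>x. [fst x = snd x] (mod 5)"]
      by (simp add: split_def)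
    moreover have "?H 25 = 2 * (\<Sum>(a, d)\<in>desc_pairs N. real a - (real (if [a = d] (mod 5) then 6 else 2) - 1) * real d)"
      using hecke_relation_25 that N unfolding hecke_relation_def by simp
    \<comment> \<open>The coefficient 6 - 1 exceeds 2 - 1 by 4; doubled, this is the 8 of the
      claim.\<close>
    moreover have "(\<Sum>(a, d)\<in>desc_pairs N. real a - (real (if [a = d] (mod 5) then 6 else 2) - 1) * real d) =
        (\<Sum>(a, d)\<in>desc_pairs N. real a - real d) - 4 * (\<Sum>(a, d)\<in>desc_pairs N. if [a = d] (mod 5) then real d else 0)"
      unfolding sum_distrib_left sum_subtractf[symmetric] by (rule sum.cong) auto
    ultimately show ?thesis by (simp add: sum_factor_pairs_abs_diff[OF N(1,3)])
  qed
  show ?thesis using 1 2 3 4 5 6 by blast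
qed

end
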